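(* For $n=0,1,2,\ldots$ let $H_n^{(1)}(x)=e^{-x^2/2}H_n(x)$, where $H_n$ is the Hermite polynomial normalized by $\lim_{x\to\infty}x^{-n}H_n(x)=2^n$, and let $$G_n(x)=\frac1\pi\int_{-\infty}^\infty\frac{H_n^{(1)}(t)\,dt}{t-x},\qquad -\infty<x<\infty,$$ be its Hilbert transform (principal value integral). Then the functions $G_n$, $n=0,1,\ldots$, form a complete orthogonal system in $L^2(-\infty,\infty)$, with $$\int_{-\infty}^\infty G_n(x)G_m(x)\,dx=\sqrt{\pi}\,2^n n!\,\delta_{mn},\qquad m,n=0,1,\ldots,$$ and they admit the following representations for all $m=0,1,\ldots$ and all real $x$: $$G_{2m}(x)=-\sqrt2\,(2m)!\,x\,e^{-x^2/2}\sum_{k=0}^m\frac{(-1)^k2^k\,\Phi(1/2-k,3/2;x^2/2)}{(m-k)!\,\Gamma(k+1/2)},$$ $$G_{2m+1}(x)=\sqrt2\,(2m+1)!\,e^{-x^2/2}\sum_{k=0}^m\frac{(-1)^k2^k\,\Phi(-1/2-k,1/2;x^2/2)}{(m-k)!\,\Gamma(k+3/2)}.$$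
   Context: $H_n$ are the Hermite polynomials orthogonal on $(-\infty,\infty)$ with weight $e^{-x^2}$, with leading coefficient $2^n$. Singular integrals are Cauchy principal values at $t=x$. $\Phi(a,c;x)=\sum_{k=0}^\infty \frac{(a)_k x^k}{(c)_k k!}$ is the confluent hypergeometric function, $(a)_k=a(a+1)\cdots(a+k-1)$, and $\delta_{mn}$ is the Kronecker symbol. *)

theory Defs
  imports "HOL-Analysis.Analysis" "HOL-Computational_Algebra.Polynomial"
begin

text \<open>
  The polynomials orthogonal on the real line with respect to the weight \<open>exp (- x^2)\<close> and
  normalized by the leading coefficient \<open>2 ^ n\<close>; these conditions determine the family uniquely.
\<close>

definition hermite_system :: "(nat \<Rightarrow> real poly) \<Rightarrow> bool" where
  "hermite_system H \<longleftrightarrow>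
     (\<forall>n. degree (H n) = n \<and> lead_coeff (H n) = 2 ^ n) \<and>
     (\<forall>m n. m \<noteq> n \<longrightarrow> (LINT x|lborel. poly (H m) x * poly (H n) x * exp (- x\<^sup>2)) = 0)"

definition hermite :: "nat \<Rightarrow> real poly" where
  "hermite = (THE H. hermite_system H)"

definition hermite_fun :: "nat \<Rightarrow> real \<Rightarrow> real" where
  "hermite_fun n x = exp (- x\<^sup>2 / 2) * poly (hermite n) x"

text \<open>
  Cauchy principal value over the real line with a single singularity at \<open>c\<close>.  Only the
  singularity is regularized: away from it, and in particular at infinity, absolute
  integrability is required.
\<close>

definition has_pv_integral :: "(real \<Rightarrow> real) \<Rightarrow> real \<Rightarrow> real \<Rightarrow> bool" where
  "has_pv_integral f c I \<longleftrightarrow>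
     (\<forall>\<epsilon>>0. set_integrable lborel {t. \<epsilon> < \<bar>t - c\<bar>} f) \<and>
     ((\<lambda>\<epsilon>. LINT t:{t. \<epsilon> < \<bar>t - c\<bar>}|lborel. f t) \<longlongrightarrow> I) (at_right 0)"

definition pv_integral :: "(real \<Rightarrow> real) \<Rightarrow> real \<Rightarrow> real" where
  "pv_integral f c = (THE I. has_pv_integral f c I)"

definition hilbert_transform :: "(real \<Rightarrow> real) \<Rightarrow> real \<Rightarrow> real" where
  "hilbert_transform f x = 1 / pi * pv_integral (\<lambda>t. f t / (t - x)) x"

definition G :: "nat \<Rightarrow> real \<Rightarrow> real" where
  "G n = hilbert_transform (hermite_fun n)"

text \<open>Confluent hypergeometric function (for \<open>c\<close> not a non-positive integer).\<close>

definition kummer :: "real \<Rightarrow> real \<Rightarrow> real \<Rightarrow> real" where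
  "kummer a c x = (\<Sum>k. pochhammer a k * x ^ k / (pochhammer c k * fact k))"

text \<open>Real \<open>L\<^sup>2\<close> of the line, with functions as representatives of their classes.\<close>

definition L2 :: "(real \<Rightarrow> real) set" where
  "L2 = {f \<in> borel_measurable lborel. integrable lborel (\<lambda>x. (f x)\<^sup>2)}"

text \<open>
  Nonzero, pairwise orthogonal members of \<open>L\<^sup>2\<close> whose finite linear combinations are dense in
  the \<open>L\<^sup>2\<close> norm.
\<close>

definition complete_orthogonal_system :: "(nat \<Rightarrow> real \<Rightarrow> real) \<Rightarrow> bool" where
  "complete_orthogonal_system \<phi> \<longleftrightarrow>
     (\<forall>n. \<phi> n \<in> L2 \<and> (LINT x|lborel. (\<phi> n x)\<^sup>2) \<noteq> 0) \<and>
     (\<forall>m n. m \<noteq> n \<longrightarrow> (LINT x|lborel. \<phi> m x * \<phi> n x) = 0) \<and>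
     (\<forall>f\<in>L2. \<forall>\<epsilon>>0. \<exists>N c. sqrt (LINT x|lborel. (f x - (\<Sum>k<N. c k * \<phi> k x))\<^sup>2) < \<epsilon>)"

end

theory Submission
  imports Defs "HOL-Probability.Sinc_Integral"
begin

text \<open>
  Both the Hermite functions \<open>h\<^sub>n = hermite_fun n\<close> and their Hilbert transforms \<open>G\<^sub>n\<close> satisfy
  \<open>u\<^sub>n' = n u\<^sub>n\<^sub>-\<^sub>1 - u\<^sub>n\<^sub>+\<^sub>1 / 2\<close> and \<open>x u\<^sub>n = n u\<^sub>n\<^sub>-\<^sub>1 + u\<^sub>n\<^sub>+\<^sub>1 / 2 - p\<^sub>n\<close>, where \<open>p\<^sub>n\<close> is \<open>0\<close> for \<open>h\<^sub>n\<close> and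
  \<open>(\<integral>h\<^sub>n) / \<pi>\<close> for \<open>G\<^sub>n\<close>.  For the explicit Kummer sums the first relation is a contiguity relation and
  the second follows from it by differentiation; for the principal values the second comes from
  \<open>t / (t - x) = 1 + x / (t - x)\<close>, so both agree once \<open>G\<^sub>0\<close> has been computed.  Integrating
  \<open>(u\<^sub>n v\<^sub>m)'\<close> turns the relations into a recursion for inner products, which gives orthogonality (from
  \<open>\<integral>G\<^sub>0\<^sup>2 = sqrt \<pi>\<close>) and the skew symmetry \<open>\<langle>h\<^sub>n, G\<^sub>m\<rangle> = - \<langle>G\<^sub>n, h\<^sub>m\<rangle>\<close>.  The latter
  transfers completeness from the Hermite functions, where it is a consequence of the
  Stone--Weierstrass theorem on the circle, to the \<open>G\<^sub>n\<close>.
\<close>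


subsection \<open>Polynomials times a Gaussian\<close>

text \<open>The Kummer sums and the principal values carry complementary information about
  \<open>G n\<close>. The sums can be differentiated term by term; the bounds come from the
  principal value, whose symmetrized integrand is a difference quotient of a Lipschitz function. The
  relation for x G_n then turns boundedness into decay like 1/x. The obstacle is that this decay is
  sharp for even n: there the integral of h_n is positive, x G_n tends to a nonzero constant and
  \<open>G n\<close> is not integrable. Products of two such functions are integrable, but the
  constants p_n bring integrals of a single \<open>G n\<close> into the recursion. They are
  evaluated only for odd n, where p_n = 0 lets the relation be used twice and the decay improves to
  1/x^2; parity settles the remaining index pairs. The starting value is a norm computation: up to
  scaling, \<open>G 0\<close> is Dawson's function exp (-y^2) \<integral> exp (t^2) dt over [0, y].
  Writing its square as a double integral over the unit square leaves Gaussian second moments in x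
  and then an elementary arctangent integral.\<close>

definition gauss_poly :: "real poly \<Rightarrow> real \<Rightarrow> real" where
  "gauss_poly p x = exp (- x\<^sup>2 / 2) * poly p x"

text \<open>This is the true rate of \<open>G n\<close> for even n, and it makes boundary terms
  vanish. A product of two such functions is \<open>decay2\<close>, hence dominated by a multiple of
  1 / (1 + x^2) and integrable.\<close>

definition decay1 :: "(real \<Rightarrow> real) \<Rightarrow> bool" where
  "decay1 f \<longleftrightarrow> (\<exists>K. \<forall>x. (1 + \<bar>x\<bar>) * \<bar>f x\<bar> \<le> K)"

definition decay2 :: "(real \<Rightarrow> real) \<Rightarrow> bool" where
  "decay2 f \<longleftrightarrow> (\<exists>K. \<forall>x. (1 + x\<^sup>2) * \<bar>f x\<bar> \<le> K)"

lemma power_le_fact_exp: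
  fixes y :: real assumes "0 \<le> y" shows "y ^ k \<le> fact k * exp y"
proof -
  have s: "(\<lambda>n. y ^ n /\<^sub>R fact n) sums exp y"
    by (rule exp_converges)
  have "(\<Sum>n\<in>{k}. y ^ n /\<^sub>R fact n) \<le> exp y"
    unfolding sums_unique[OF s] using assms
    by (intro sum_le_suminf sums_summable[OF s]) auto
  then show ?thesis by (simp add: field_simps)
qed

text \<open>Comparing |x|^k with 1 + (x^2)^k treats odd and even k alike: the right side is
  controlled by a single term of the series of exp (x^2 / 2).\<close>

lemma bounded_power_gauss: "\<exists>K. \<forall>x::real. \<bar>x\<bar> ^ k * exp (- x\<^sup>2 / 2) \<le> K"
proof (intro exI allI)
  fix x :: real
  have "\<bar>x\<bar> ^ k \<le> 1 + (x\<^sup>2) ^ k"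
  proof (cases "\<bar>x\<bar> \<le> 1")
    case True
    then have "\<bar>x\<bar> ^ k \<le> 1" by (simp add: power_le_one)
    moreover have "0 \<le> (x\<^sup>2) ^ k" by simp
    ultimately show ?thesis by linarith
  next
    case False
    then have "\<bar>x\<bar> ^ 1 \<le> \<bar>x\<bar> ^ 2" by (intro power_increasing) auto
    then have "\<bar>x\<bar> \<le> \<bar>x\<bar>\<^sup>2" by simp
    then have "\<bar>x\<bar> ^ k \<le> (\<bar>x\<bar>\<^sup>2) ^ k" by (intro power_mono) auto
    then show ?thesis by simp
  qed
  also have "(x\<^sup>2) ^ k \<le> 2 ^ k * fact k * exp (x\<^sup>2 / 2)"
    using power_le_fact_exp[of "x\<^sup>2 / 2" k] by (simp add: power_divide field_simps)
  also have "1 + 2 ^ k * fact k * exp (x\<^sup>2 / 2) \<le> (1 + 2 ^ k * fact k) * exp (x\<^sup>2 / 2)"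
    by (simp add: algebra_simps)
  finally have "\<bar>x\<bar> ^ k \<le> (1 + 2 ^ k * fact k) * exp (x\<^sup>2 / 2)" by simp
  then have "\<bar>x\<bar> ^ k * exp (- x\<^sup>2 / 2) \<le> (1 + 2 ^ k * fact k) * exp (x\<^sup>2 / 2) * exp (- x\<^sup>2 / 2)"
    by (intro mult_right_mono) auto
  then show "\<bar>x\<bar> ^ k * exp (- x\<^sup>2 / 2) \<le> 1 + 2 ^ k * fact k"
    by (simp add: exp_minus field_simps)
qed

lemma gauss_poly_bounded: "\<exists>K. \<forall>x. \<bar>gauss_poly p x\<bar> \<le> K"
proof -
  obtain K where K: "\<And>k x. \<bar>x::real\<bar> ^ k * exp (- x\<^sup>2 / 2) \<le> K k"
    using bounded_power_gauss by metis
  have "\<bar>gauss_poly p x\<bar> \<le> (\<Sum>i\<le>degree p. \<bar>coeff p i\<bar> * K i)" for x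
  proof -
    have "gauss_poly p x = (\<Sum>i\<le>degree p. coeff p i * (x ^ i * exp (- x\<^sup>2 / 2)))"
      by (simp add: gauss_poly_def poly_altdef sum_distrib_left algebra_simps)
    also have "\<bar>\<dots>\<bar> \<le> (\<Sum>i\<le>degree p. \<bar>coeff p i * (x ^ i * exp (- x\<^sup>2 / 2))\<bar>)"
      by (rule sum_abs)
    also have "\<dots> \<le> (\<Sum>i\<le>degree p. \<bar>coeff p i\<bar> * K i)"
      by (intro sum_mono) (use K in \<open>auto simp: abs_mult power_abs intro!: mult_left_mono\<close>)
    finally show ?thesis .
  qed
  then show ?thesis by blast
qed

lemma gauss_poly_mult: "gauss_poly (q * p) x = poly q x * gauss_poly p x"
  by (simp add: gauss_poly_def)

lemma gauss_poly_add: "gauss_poly (p + q) x = gauss_poly p x + gauss_poly q x"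
  by (simp add: gauss_poly_def algebra_simps)

lemma gauss_poly_smult: "gauss_poly (smult c p) x = c * gauss_poly p x"
  by (simp add: gauss_poly_def algebra_simps)

text \<open>Multiplication by 1 + x^2 stays within the class, so decay reduces to
  boundedness.\<close>

lemma gauss_poly_decay2: "decay2 (gauss_poly p)"
proof -
  obtain K where K: "\<And>x. \<bar>gauss_poly ([:1,0,1:] * p) x\<bar> \<le> K"
    using gauss_poly_bounded by blast
  have "(1 + x\<^sup>2) * \<bar>gauss_poly p x\<bar> \<le> K" for x
  proof -
    have "gauss_poly ([:1,0,1:] * p) x = (1 + x\<^sup>2) * gauss_poly p x"
      unfolding gauss_poly_mult by (simp add: power2_eq_square)
    then show ?thesis using K[of x] by (simp add: abs_mult)
  qed
  then show ?thesis unfolding decay2_def by blast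
qed

lemma gauss_poly_continuous [continuous_intros]: "continuous_on A (gauss_poly p)"
  unfolding gauss_poly_def by (intro continuous_intros) auto

lemma gauss_poly_DERIV:
  "(gauss_poly p has_real_derivative gauss_poly (pderiv p - [:0,1:] * p) x) (at x)"
  unfolding gauss_poly_def
  by (auto intro!: derivative_eq_intros simp: algebra_simps)

section \<open>Decay, integrability and limits at infinity\<close>

lemma decay2_imp_decay1:
  assumes "decay2 f" shows "decay1 f"
proof -
  obtain K where K: "\<And>x. (1 + x\<^sup>2) * \<bar>f x\<bar> \<le> K" using assms unfolding decay2_def by blast
  have "(1 + \<bar>x\<bar>) * \<bar>f x\<bar> \<le> 2 * K" for x
  proof -
    have "0 \<le> (\<bar>x\<bar> - 1)\<^sup>2" by simp
    then have "2 * \<bar>x\<bar> \<le> 1 + x\<^sup>2" by (simp add: power2_eq_square algebra_simps)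
    moreover have "0 \<le> x\<^sup>2" by simp
    ultimately have "1 + \<bar>x\<bar> \<le> 2 * (1 + x\<^sup>2)" using abs_ge_zero[of x] unfolding distrib_left by linarith
    then have "(1 + \<bar>x\<bar>) * \<bar>f x\<bar> \<le> 2 * (1 + x\<^sup>2) * \<bar>f x\<bar>" by (intro mult_right_mono) auto
    then show ?thesis using K[of x] by linarith
  qed
  then show ?thesis unfolding decay1_def by blast
qed

lemma decay1_I:
  assumes "\<And>x. \<bar>f x\<bar> \<le> K" "\<And>x. \<bar>x * f x\<bar> \<le> L"
  shows "decay1 f"
  unfolding decay1_def
proof (intro exI allI)
  fix x show "(1 + \<bar>x\<bar>) * \<bar>f x\<bar> \<le> K + L"
    using assms(1)[of x] assms(2)[of x] by (simp add: algebra_simps abs_mult)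
qed

lemma decay2_I:
  assumes "\<And>x. \<bar>f x\<bar> \<le> K" "\<And>x. \<bar>x\<^sup>2 * f x\<bar> \<le> L"
  shows "decay2 f"
  unfolding decay2_def
proof (intro exI allI)
  fix x show "(1 + x\<^sup>2) * \<bar>f x\<bar> \<le> K + L"
    using assms(1)[of x] assms(2)[of x] by (simp add: algebra_simps abs_mult)
qed

lemma decay1_mult:
  assumes "decay1 f" "decay1 g" shows "decay2 (\<lambda>x. f x * g x)"
proof -
  obtain K where K: "\<And>x. (1 + \<bar>x\<bar>) * \<bar>f x\<bar> \<le> K" using assms unfolding decay1_def by blast
  obtain L where L: "\<And>x. (1 + \<bar>x\<bar>) * \<bar>g x\<bar> \<le> L" using assms unfolding decay1_def by blast
  have "(1 + x\<^sup>2) * \<bar>f x * g x\<bar> \<le> K * L" for x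
  proof -
    have "1 + x\<^sup>2 \<le> (1 + \<bar>x\<bar>) * (1 + \<bar>x\<bar>)"
      by (simp add: algebra_simps power2_eq_square)
    then have "(1 + x\<^sup>2) * \<bar>f x * g x\<bar> \<le> ((1 + \<bar>x\<bar>) * (1 + \<bar>x\<bar>)) * \<bar>f x * g x\<bar>"
      by (intro mult_right_mono) auto
    also have "\<dots> = ((1 + \<bar>x\<bar>) * \<bar>f x\<bar>) * ((1 + \<bar>x\<bar>) * \<bar>g x\<bar>)"
      by (simp add: abs_mult)
    also have "\<dots> \<le> K * L"
    proof (intro mult_mono K L)
      show "0 \<le> K" by (rule order_trans[OF _ K[of 0]]) simp
    qed simp
    finally show ?thesis .
  qed
  then show ?thesis unfolding decay2_def by blast
qed

lemma integrable_inverse_1_plus_square_UNIV: "integrable lborel (\<lambda>x::real. inverse (1 + x\<^sup>2))"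
  using integrable_inverse_1_plus_square
  by (simp add: einterval_def set_integrable_def)

lemma decay2_integrable:
  assumes "decay2 f" "f \<in> borel_measurable borel" shows "integrable lborel f"
proof -
  obtain K where K: "\<And>x. (1 + x\<^sup>2) * \<bar>f x\<bar> \<le> K" using assms unfolding decay2_def by blast
  show ?thesis
  proof (rule Bochner_Integration.integrable_bound)
    show "integrable lborel (\<lambda>x. K * inverse (1 + x\<^sup>2))"
      by (intro integrable_mult_right integrable_inverse_1_plus_square_UNIV)
    show "f \<in> borel_measurable lborel" using assms by simp
    show "AE x in lborel. norm (f x) \<le> norm (K * inverse (1 + x\<^sup>2))"
    proof (intro AE_I2)
      fix x :: real
      have p: "0 < 1 + x\<^sup>2" by (simp add: add_pos_nonneg)
      have "\<bar>f x\<bar> \<le> K * inverse (1 + x\<^sup>2)"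
        using K[of x] p by (simp add: field_simps)
      then show "norm (f x) \<le> norm (K * inverse (1 + x\<^sup>2))" by simp
    qed
  qed
qed

lemma decay1_tendsto:
  assumes "decay1 f" shows "(f \<longlongrightarrow> 0) at_top" "(f \<longlongrightarrow> 0) at_bot"
proof -
  obtain K where K: "\<And>x. (1 + \<bar>x\<bar>) * \<bar>f x\<bar> \<le> K" using assms unfolding decay1_def by blast
  have b: "norm (f x) \<le> K * inverse (1 + \<bar>x\<bar>)" for x
  proof -
    have "0 < 1 + \<bar>x\<bar>" by linarith
    then show ?thesis using K[of x] by (simp add: field_simps)
  qed
  have t: "filterlim (\<lambda>x::real. 1 + \<bar>x\<bar>) at_top at_top" "filterlim (\<lambda>x::real. 1 + \<bar>x\<bar>) at_top at_bot"
    by (rule filterlim_at_top_mono[OF filterlim_ident] filterlim_at_top_mono[OF filterlim_uminus_at_top_at_bot],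
        intro always_eventually allI, linarith)+
  have "((\<lambda>x. K * inverse (1 + \<bar>x\<bar>)) \<longlongrightarrow> 0) at_top" "((\<lambda>x. K * inverse (1 + \<bar>x\<bar>)) \<longlongrightarrow> 0) at_bot"
    using tendsto_mult_right_zero[OF tendsto_inverse_0_at_top[OF t(1)]]
      tendsto_mult_right_zero[OF tendsto_inverse_0_at_top[OF t(2)]] by auto
  then show "(f \<longlongrightarrow> 0) at_top" "(f \<longlongrightarrow> 0) at_bot"
    by - (rule Lim_null_comparison[OF always_eventually[OF allI[OF b]]], assumption)+
qed

section \<open>Integration by parts on the line\<close>

lemma integral_derivative_zero:
  fixes F f :: "real \<Rightarrow> real"
  assumes d: "\<And>x. (F has_real_derivative f x) (at x)" and c: "\<And>x. isCont f x"
    and i: "integrable lborel f" and "decay1 F"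
  shows "(LINT x|lborel. f x) = 0"
proof -
  have "(LBINT x=-\<infinity>..\<infinity>. f x) = 0 - 0"
  proof (rule interval_integral_FTC_integrable[where F = F])
    show "set_integrable lborel (einterval (-\<infinity>) \<infinity>) f"
      using i by (simp add: einterval_def set_integrable_def)
    show "((F \<circ> real_of_ereal) \<longlongrightarrow> 0) (at_right (-\<infinity>))"
      using decay1_tendsto[OF assms(4)] by (simp add: ereal_tendsto_simps)
    show "((F \<circ> real_of_ereal) \<longlongrightarrow> 0) (at_left \<infinity>)"
      using decay1_tendsto[OF assms(4)] by (simp add: ereal_tendsto_simps)
  qed (use d c in \<open>auto simp: has_real_derivative_iff_has_vector_derivative\<close>)
  then show ?thesis
    by (simp add: interval_lebesgue_integral_def einterval_def set_lebesgue_integral_def)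
qed

text \<open>Applied to the pairs (h, h), (G, G), (G, h) and (h, G), which is why \<open>u\<close>
  and \<open>v\<close> carry separate constants \<open>p\<close> and \<open>q\<close>. Integrability
  in \<open>r\<close> is asked only of the combination, because a single \<open>G n\<close> with n
  even is not integrable.\<close>

lemma ladder_integral:
  fixes u v :: "nat \<Rightarrow> real \<Rightarrow> real"
  assumes du: "\<And>n x. (u n has_real_derivative real n * u (n - 1) x - u (Suc n) x / 2) (at x)"
    and dv: "\<And>n x. (v n has_real_derivative real n * v (n - 1) x - v (Suc n) x / 2) (at x)"
    and xu: "\<And>n x. x * u n x = real n * u (n - 1) x + u (Suc n) x / 2 - p n"
    and xv: "\<And>n x. x * v n x = real n * v (n - 1) x + v (Suc n) x / 2 - q n"
    and u1: "\<And>n. decay1 (u n)" and v1: "\<And>n. decay1 (v n)"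
    and r: "integrable lborel (\<lambda>x. p n * v m x - q m * u n x)"
  shows "(LINT x|lborel. u n x * v (Suc m) x) =
    2 * real n * (LINT x|lborel. u (n - 1) x * v m x) - (LINT x|lborel. p n * v m x - q m * u n x)"
proof -
  have cu: "isCont (u n) x" for n x using du DERIV_isCont by blast
  have cv: "isCont (v n) x" for n x using dv DERIV_isCont by blast
  have [measurable]: "u n \<in> borel_measurable borel" "v n \<in> borel_measurable borel" for n
    by (intro borel_measurable_continuous_onI continuous_at_imp_continuous_on ballI cu cv)+
  have i: "integrable lborel (\<lambda>x. u i x * v j x)" for i j
    by (rule decay2_integrable[OF decay1_mult[OF u1 v1]]) measurable
  define f where "f x = 2 * real n * (u (n - 1) x * v m x) - u n x * v (Suc m) x
    - (p n * v m x - q m * u n x)" for x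
  have f: "f x = (real n * u (n - 1) x - u (Suc n) x / 2) * v m x
      + u n x * (real m * v (m - 1) x - v (Suc m) x / 2)" for x
  proof -
    \<comment> \<open>Both sides are x u_n v_m. The equation trades the products
      \<open>u (Suc n) * v m\<close> and \<open>u n * v (m - 1)\<close> of the derivative for the
      two that occur in the claim.\<close>
    have "(real n * u (n - 1) x + u (Suc n) x / 2 - p n) * v m x
        = u n x * (real m * v (m - 1) x + v (Suc m) x / 2 - q m)"
      unfolding xu[symmetric] xv[symmetric] by simp
    then show ?thesis unfolding f_def by (simp add: algebra_simps)
  qed
  have "(LINT x|lborel. f x) = 0"
  proof (rule integral_derivative_zero)
    show "((\<lambda>x. u n x * v m x) has_real_derivative f x) (at x)" for x
      unfolding f by (rule DERIV_cong[OF DERIV_mult[OF du dv]]) simp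
    show "isCont f x" for x
      unfolding f_def by (intro continuous_intros cu cv)
    show "integrable lborel f"
      unfolding f_def by (intro Bochner_Integration.integrable_diff integrable_mult_right i r)
    show "decay1 (\<lambda>x. u n x * v m x)"
      by (intro decay2_imp_decay1 decay1_mult u1 v1)
  qed
  moreover have "(LINT x|lborel. f x) = 2 * real n * (LINT x|lborel. u (n - 1) x * v m x)
      - (LINT x|lborel. u n x * v (Suc m) x) - (LINT x|lborel. p n * v m x - q m * u n x)"
    unfolding f_def
    by (subst Bochner_Integration.integral_diff[OF Bochner_Integration.integrable_diff[OF integrable_mult_right i] r])
      (simp_all add: Bochner_Integration.integral_diff[OF integrable_mult_right i] i)
  ultimately show ?thesis by linarith
qed


subsection \<open>Hermite polynomials\<close>

fun hermite_rec :: "nat \<Rightarrow> real poly" where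
  "hermite_rec 0 = 1"
| "hermite_rec (Suc 0) = [:0, 2:]"
| "hermite_rec (Suc (Suc n)) = [:0, 2:] * hermite_rec (Suc n) - smult (2 * real (Suc n)) (hermite_rec n)"

text \<open>At n = 0 the truncated \<open>n - 1\<close> is multiplied by zero, so the recurrence
  takes one form for all n; every ladder relation below relies on the same convention.\<close>

lemma hermite_rec_step:
  "[:0, 2:] * hermite_rec n = smult (2 * real n) (hermite_rec (n - 1)) + hermite_rec (Suc n)"
  by (cases n) auto

text \<open>Differentiating the recurrence and inserting the induction hypotheses leaves 2 H_(n+1)
  plus 2 (n + 1) times (2x H_n - 2n H_(n-1)), and the bracket is H_(n+1) again.\<close>

lemma pderiv_hermite_rec: "pderiv (hermite_rec n) = smult (2 * real n) (hermite_rec (n - 1))"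
proof (induction n rule: hermite_rec.induct)
  case (3 n)
  have "pderiv (hermite_rec (Suc (Suc n))) = smult 2 (hermite_rec (Suc n))
      + [:0, 2:] * smult (2 * real (Suc n)) (hermite_rec n)
      - smult (2 * real (Suc n)) (smult (2 * real n) (hermite_rec (n - 1)))"
    using 3 by (simp add: pderiv_diff pderiv_mult pderiv_smult pderiv_pCons del: mult_pCons_left)
  also have "[:0, 2:] * smult (2 * real (Suc n)) (hermite_rec n)
      = smult (2 * real (Suc n)) (smult (2 * real n) (hermite_rec (n - 1)) + hermite_rec (Suc n))"
    unfolding mult_smult_right hermite_rec_step ..
  finally show ?case
    by (simp add: smult_add_right smult_add_left[symmetric] del: hermite_rec.simps)
qed (simp_all add: pderiv_pCons)

lemma degree_hermite_rec: "degree (hermite_rec n) = n \<and> coeff (hermite_rec n) n = 2 ^ n"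
proof (induction n rule: hermite_rec.induct)
  case (3 n)
  let ?A = "[:0, 2:] * hermite_rec (Suc n)" and ?B = "smult (2 * real (Suc n)) (hermite_rec n)"
  have nz: "hermite_rec (Suc n) \<noteq> 0" using 3 by auto
  have dA: "degree ?A = Suc (Suc n)" using 3 nz by (subst degree_mult_eq) auto
  moreover have dB: "degree ?B < Suc (Suc n)" using 3 by simp
  ultimately have d: "degree (?A - ?B) = Suc (Suc n)"
    using degree_add_eq_left[of "- ?B" ?A] by (simp del: mult_pCons_left)
  have "coeff ?A (Suc (Suc n)) = 2 * 2 ^ Suc n" using 3 by simp
  moreover have "coeff ?B (Suc (Suc n)) = 0" using dB by (rule coeff_eq_0)
  ultimately show ?case using d by (simp del: mult_pCons_left)
qed auto

abbreviation hermite_fun_rec :: "nat \<Rightarrow> real \<Rightarrow> real" where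
  "hermite_fun_rec n \<equiv> gauss_poly (hermite_rec n)"

text \<open>The trailing \<open>- 0\<close> gives the shape required by
  \<open>ladder_integral\<close> with zero constants.\<close>

lemma hermite_fun_rec_times:
  "x * hermite_fun_rec n x = real n * hermite_fun_rec (n - 1) x + hermite_fun_rec (Suc n) x / 2 - 0"
proof -
  have "2 * (x * hermite_fun_rec n x) = gauss_poly ([:0, 2:] * hermite_rec n) x"
    by (simp add: gauss_poly_mult del: mult_pCons_left)
  then show ?thesis
    unfolding hermite_rec_step by (simp add: gauss_poly_add gauss_poly_smult)
qed

lemma hermite_fun_rec_DERIV:
  "(hermite_fun_rec n has_real_derivative
     real n * hermite_fun_rec (n - 1) x - hermite_fun_rec (Suc n) x / 2) (at x)"
proof -
  have "gauss_poly (pderiv (hermite_rec n) - [:0,1:] * hermite_rec n) x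
      = 2 * real n * hermite_fun_rec (n - 1) x - x * hermite_fun_rec n x"
    unfolding pderiv_hermite_rec by (simp add: gauss_poly_def algebra_simps)
  then show ?thesis
    using gauss_poly_DERIV[of "hermite_rec n" x] hermite_fun_rec_times[of x n] by simp
qed

lemma gauss_poly_measurable [measurable]: "gauss_poly p \<in> borel_measurable borel"
  by (intro borel_measurable_continuous_onI continuous_intros)

lemma gauss_poly_decay1: "decay1 (gauss_poly p)"
  by (intro decay2_imp_decay1 gauss_poly_decay2)

lemma gauss_poly_integrable: "integrable lborel (gauss_poly p)"
  by (intro decay2_integrable gauss_poly_decay2 gauss_poly_measurable)

lemma gauss_poly_mult_integrable: "integrable lborel (\<lambda>x. gauss_poly p x * gauss_poly q x)"
  by (intro decay2_integrable decay1_mult gauss_poly_decay1 measurable)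

lemma gaussian_integral: "(LINT x|lborel. exp (- x\<^sup>2 / 2)) = sqrt (2 * pi)"
proof -
  have "(LINT x|lborel. std_normal_density x) = 1" by simp
  then show ?thesis
    unfolding std_normal_density_def by (simp add: field_simps)
qed

lemma gaussian_integral': "(LINT x|lborel. exp (- (x::real)\<^sup>2)) = sqrt pi"
proof -
  \<comment> \<open>Variance 1/2 makes the exponent of the density exactly - x^2.\<close>
  have "(LINT x|lborel. normal_density 0 (1 / sqrt 2) x) = 1" by simp
  then show ?thesis
    unfolding normal_density_def by (simp add: power_divide real_sqrt_mult real_sqrt_divide field_simps)
qed

lemma hermite_fun_rec_inner_Suc:
  "(LINT x|lborel. hermite_fun_rec n x * hermite_fun_rec (Suc m) x)
     = 2 * real n * (LINT x|lborel. hermite_fun_rec (n - 1) x * hermite_fun_rec m x)"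
  using ladder_integral[where u = hermite_fun_rec and v = hermite_fun_rec and p = "\<lambda>_. 0" and q = "\<lambda>_. 0",
      OF hermite_fun_rec_DERIV hermite_fun_rec_DERIV hermite_fun_rec_times hermite_fun_rec_times
      gauss_poly_decay1 gauss_poly_decay1, where n = n and m = m]
  by simp

text \<open>Each step lowers both indices, so everything reduces to pairs with an index 0. There the
  factor n = 0 annihilates \<open>a 0 (Suc k)\<close>, and symmetry carries this over to
  \<open>a (Suc k) 0\<close>.\<close>

lemma ladder_values:
  fixes a :: "nat \<Rightarrow> nat \<Rightarrow> real"
  assumes step: "\<And>n m. a n (Suc m) = 2 * real n * a (n - 1) m" and sym: "\<And>n m. a n m = a m n"
  shows "a n m = (if n = m then 2 ^ n * fact n * a 0 0 else 0)"
proof (induction m arbitrary: n)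
  case 0
  show ?case
  proof (cases n)
    case (Suc k)
    have "a 0 (Suc k) = 0" using step[of 0 k] by simp
    then show ?thesis using sym[of n 0] Suc by simp
  qed simp
next
  case (Suc m)
  show ?case
    using Suc step[of n m] by (cases n) auto
qed

lemma hermite_fun_rec_inner:
  "(LINT x|lborel. hermite_fun_rec n x * hermite_fun_rec m x)
     = (if n = m then sqrt pi * 2 ^ n * fact n else 0)"
proof -
  have "(LINT x|lborel. hermite_fun_rec 0 x * hermite_fun_rec 0 x) = sqrt pi"
    using gaussian_integral' by (simp add: gauss_poly_def exp_add[symmetric])
  moreover have "(LINT x|lborel. hermite_fun_rec n x * hermite_fun_rec m x)
    = (if n = m then 2 ^ n * fact n * (LINT x|lborel. hermite_fun_rec 0 x * hermite_fun_rec 0 x) else 0)"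
    by (rule ladder_values[of "\<lambda>n m. LINT x|lborel. hermite_fun_rec n x * hermite_fun_rec m x"])
      (rule hermite_fun_rec_inner_Suc, simp only: mult.commute)
  ultimately show ?thesis by simp
qed

lemma gauss_poly_times: "gauss_poly p x * gauss_poly q x = poly p x * poly q x * exp (- x\<^sup>2)"
proof -
  have "exp (- x\<^sup>2 / 2) * exp (- x\<^sup>2 / 2) = exp (- x\<^sup>2)"
    by (simp add: exp_add[symmetric])
  then show ?thesis unfolding gauss_poly_def by (simp add: algebra_simps)
qed

lemma hermite_system_iff: "hermite_system H \<longleftrightarrow> (\<forall>n. degree (H n) = n \<and> lead_coeff (H n) = 2 ^ n) \<and>
     (\<forall>m n. m \<noteq> n \<longrightarrow> (LINT x|lborel. gauss_poly (H m) x * gauss_poly (H n) x) = 0)"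
  unfolding hermite_system_def gauss_poly_times ..

section \<open>Uniqueness of the Hermite system\<close>

lemma hermite_system_degree:
  assumes "hermite_system H" shows "degree (H n) = n" "coeff (H n) n = 2 ^ n"
proof -
  have "degree (H n) = n \<and> lead_coeff (H n) = 2 ^ n"
    using assms unfolding hermite_system_iff by blast
  then show "degree (H n) = n" "coeff (H n) n = 2 ^ n" by auto
qed

lemma hermite_system_hermite_rec: "hermite_system hermite_rec"
  unfolding hermite_system_iff using degree_hermite_rec by (simp add: hermite_fun_rec_inner)

text \<open>Subtracting a multiple of the system member of the same degree removes the leading term
  of \<open>p\<close>; that member is orthogonal to \<open>H n\<close> because its degree is below
  n.\<close>

lemma hermite_system_orthogonal:
  assumes H: "hermite_system H" and "degree p < n"
  shows "(LINT x|lborel. gauss_poly (H n) x * gauss_poly p x) = 0"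
  using assms(2)
proof (induction "degree p" arbitrary: p rule: less_induct)
  case less
  define c where "c = lead_coeff p / 2 ^ degree p"
  define r where "r = p - smult c (H (degree p))"
  note dH = hermite_system_degree[OF H]
  \<comment> \<open>For constant \<open>p\<close> the degree cannot drop, but then the remainder is
    zero.\<close>
  have rz: "r = 0 \<or> degree r < degree p"
  proof (cases "degree p = 0")
    case True
    have "degree r \<le> 0" unfolding r_def
      using True dH(1)[of 0] by (metis degree_diff_le degree_smult_le le_zero_eq)
    moreover have "coeff r 0 = 0" using True dH(2)[of 0] by (simp add: r_def c_def)
    ultimately show ?thesis by (metis leading_coeff_0_iff le_zero_eq)
  next
    case False
    have "degree r \<le> degree p" unfolding r_def
      using dH(1)[of "degree p"] by (metis degree_diff_le degree_smult_le order_refl)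
    moreover have "coeff r (degree p) = 0" by (simp add: r_def c_def dH(2))
    ultimately show ?thesis
      using False by (metis leading_coeff_0_iff le_neq_implies_less)
  qed
  have r0: "(LINT x|lborel. gauss_poly (H n) x * gauss_poly r x) = 0"
    using rz
  proof
    assume "r = 0" then show ?thesis by (simp add: gauss_poly_def)
  next
    assume "degree r < degree p" then show ?thesis using less by auto
  qed
  have "gauss_poly p x = gauss_poly r x + c * gauss_poly (H (degree p)) x" for x
    by (simp add: r_def gauss_poly_def algebra_simps)
  then have "(LINT x|lborel. gauss_poly (H n) x * gauss_poly p x)
     = (LINT x|lborel. gauss_poly (H n) x * gauss_poly r x + c * (gauss_poly (H n) x * gauss_poly (H (degree p)) x))"
    by (simp add: algebra_simps)
  also have "\<dots> = 0"
    using r0 H less.prems unfolding hermite_system_iff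
    by (subst Bochner_Integration.integral_add) (auto intro!: integrable_mult_right gauss_poly_mult_integrable)
  finally show ?case .
qed

text \<open>Equal leading terms make the difference \<open>d\<close> of degree below n, hence
  orthogonal to \<open>H n\<close>, to \<open>K n\<close> and so to itself. Vanishing weighted norm
  forces \<open>d\<close> to vanish almost everywhere, while a nonzero polynomial has only finitely
  many roots. This makes the description in \<open>hermite\<close> well defined.\<close>

lemma hermite_system_unique:
  assumes H: "hermite_system H" and K: "hermite_system K" shows "H = K"
proof
  fix n
  define d where "d = H n - K n"
  note dH = hermite_system_degree[OF H, of n] hermite_system_degree[OF K, of n]
  show "H n = K n"
  proof (rule ccontr)
    assume ne: "H n \<noteq> K n"
    then have "d \<noteq> 0" by (simp add: d_def)
    have "degree d \<le> n" unfolding d_def using dH by (metis degree_diff_le order_refl)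
    moreover have "coeff d n = 0" using dH by (simp add: d_def)
    ultimately have "degree d < n" using \<open>d \<noteq> 0\<close>
      by (metis leading_coeff_0_iff le_neq_implies_less)
    then have z: "(LINT x|lborel. gauss_poly (H n) x * gauss_poly d x) = 0"
       "(LINT x|lborel. gauss_poly (K n) x * gauss_poly d x) = 0"
      by (intro hermite_system_orthogonal H K; simp)+
    have "(LINT x|lborel. gauss_poly d x * gauss_poly d x)
       = (LINT x|lborel. gauss_poly (H n) x * gauss_poly d x - gauss_poly (K n) x * gauss_poly d x)"
      by (simp add: d_def gauss_poly_def algebra_simps)
    also have "\<dots> = 0"
      using z by (subst Bochner_Integration.integral_diff) (auto intro!: gauss_poly_mult_integrable)
    finally have "AE x in lborel. gauss_poly d x * gauss_poly d x = 0"
      by (subst integral_nonneg_eq_0_iff_AE[symmetric]) (auto intro!: gauss_poly_mult_integrable)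
    then have "AE x in lborel. x \<in> {x. poly d x = 0}"
      by (simp add: gauss_poly_def)
    moreover have "finite {x. poly d x = 0}"
      using \<open>d \<noteq> 0\<close> by (rule poly_roots_finite)
    then have "AE x in lborel. x \<notin> {x. poly d x = 0}"
      by (intro AE_not_in countable_imp_null_set_lborel countable_finite)
    ultimately have "AE x in (lborel :: real measure). False" by eventually_elim simp
    then show False
      using ae_filter_eq_bot_iff[of "lborel :: real measure"] by (simp add: trivial_limit_def)
  qed
qed

lemma hermite_eq: "hermite = hermite_rec"
  unfolding hermite_def
  using hermite_system_hermite_rec hermite_system_unique by blast

lemma hermite_fun_eq: "hermite_fun n = hermite_fun_rec n"
  by (simp add: fun_eq_iff hermite_fun_def gauss_poly_def hermite_eq)


subsection \<open>Kummer functions\<close>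

definition kummer_coeff :: "real \<Rightarrow> real \<Rightarrow> nat \<Rightarrow> real" where
  "kummer_coeff a c k = pochhammer a k / (pochhammer c k * fact k)"

lemma kummer_eq: "kummer a c x = (\<Sum>k. kummer_coeff a c k * x ^ k)"
  by (simp add: kummer_def kummer_coeff_def)

lemma kummer_coeff_Suc:
  "kummer_coeff a c (Suc k) = kummer_coeff a c k * ((a + real k) / ((c + real k) * real (Suc k)))"
  by (simp add: kummer_coeff_def pochhammer_Suc algebra_simps)

lemma summable_kummer:
  assumes "0 < c" shows "summable (\<lambda>k. kummer_coeff a c k * x ^ k)"
proof (rule summable_ratio_test[where c = "1/2"])
  \<comment> \<open>Since |a + k| is at most M (c + k), consecutive terms have ratio at most M |x| /
    (k + 1), which is below 1/2 once k reaches 2 M |x|.\<close>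
  define M where "M = \<bar>a\<bar> / c + 1"
  fix k assume k: "nat \<lceil>2 * M * \<bar>x\<bar>\<rceil> \<le> k"
  have "2 * M * \<bar>x\<bar> \<le> real k" using k by linarith
  then have Mx: "M * \<bar>x\<bar> / real (Suc k) \<le> 1 / 2" by (simp add: field_simps)
  have "\<bar>a + real k\<bar> \<le> M * (c + real k)"
  proof -
    have "\<bar>a + real k\<bar> \<le> \<bar>a\<bar> + real k" by linarith
    also have "\<dots> \<le> M * (c + real k)"
    proof -
      have "\<bar>a\<bar> / c * (c + real k) = \<bar>a\<bar> + \<bar>a\<bar> / c * real k" "0 \<le> \<bar>a\<bar> / c * real k"
        using assms by (simp_all add: field_simps)
      then show ?thesis using assms unfolding M_def distrib_right mult_1 by linarith
    qed
    finally show ?thesis .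
  qed
  then have "\<bar>(a + real k) / ((c + real k) * real (Suc k))\<bar> \<le> M / real (Suc k)"
  proof -
    assume "\<bar>a + real k\<bar> \<le> M * (c + real k)"
    then have "\<bar>a + real k\<bar> / (c + real k) \<le> M" using assms by (simp add: divide_le_eq)
    then have "\<bar>a + real k\<bar> / (c + real k) / real (Suc k) \<le> M / real (Suc k)"
      by (intro divide_right_mono) auto
    then show ?thesis using assms by (simp add: abs_mult)
  qed
  then have "\<bar>(a + real k) / ((c + real k) * real (Suc k))\<bar> * \<bar>x\<bar> \<le> M / real (Suc k) * \<bar>x\<bar>"
    by (intro mult_right_mono) auto
  also have "M / real (Suc k) * \<bar>x\<bar> \<le> 1 / 2" using Mx by simp
  finally have r: "\<bar>(a + real k) / ((c + real k) * real (Suc k))\<bar> * \<bar>x\<bar> \<le> 1 / 2" .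
  have "norm (kummer_coeff a c (Suc k) * x ^ Suc k)
      = norm (kummer_coeff a c k * x ^ k) * (\<bar>(a + real k) / ((c + real k) * real (Suc k))\<bar> * \<bar>x\<bar>)"
    by (simp only: kummer_coeff_Suc power_Suc real_norm_def abs_mult mult_ac)
  also have "\<dots> \<le> norm (kummer_coeff a c k * x ^ k) * (1 / 2)"
    by (rule mult_left_mono[OF r]) simp
  finally show "norm (kummer_coeff a c (Suc k) * x ^ Suc k) \<le> 1 / 2 * norm (kummer_coeff a c k * x ^ k)"
    by simp
qed simp

lemma kummer_sums: "0 < c \<Longrightarrow> (\<lambda>k. kummer_coeff a c k * x ^ k) sums kummer a c x"
  unfolding kummer_eq by (intro summable_sums summable_kummer)

lemma diffs_kummer_coeff:
  assumes "0 < c" shows "diffs (kummer_coeff a c) k = a / c * kummer_coeff (a + 1) (c + 1) k"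
  using assms by (simp add: diffs_def kummer_coeff_def pochhammer_rec divide_simps del: of_nat_Suc)

lemma kummer_DERIV:
  assumes "0 < c"
  shows "(kummer a c has_real_derivative a / c * kummer (a + 1) (c + 1) x) (at x)"
proof -
  have "((\<lambda>x. \<Sum>k. kummer_coeff a c k * x ^ k) has_real_derivative
      (\<Sum>k. diffs (kummer_coeff a c) k * x ^ k)) (at x)"
    by (intro termdiffs_strong_converges_everywhere summable_kummer assms)
  moreover have "(\<Sum>k. diffs (kummer_coeff a c) k * x ^ k) = a / c * kummer (a + 1) (c + 1) x"
    unfolding diffs_kummer_coeff[OF assms] kummer_eq mult.assoc
    by (subst suminf_mult) (use assms in \<open>auto intro!: summable_kummer\<close>)
  ultimately show ?thesis
    by (simp add: kummer_eq[abs_def])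
qed

text \<open>This and the next two lemmas expand F', z F' and z F in powers of z with matching
  exponents, so that the contiguity relations can be checked coefficient by coefficient.\<close>

lemma kummer_deriv_sums:
  assumes "0 < c"
  shows "(\<lambda>k. real (Suc k) * kummer_coeff a c (Suc k) * x ^ k) sums (a / c * kummer (a + 1) (c + 1) x)"
  using sums_mult[OF kummer_sums[of "c + 1" "a + 1" x], of "a / c"] assms
    diffs_kummer_coeff[of c a] by (simp add: diffs_def mult.assoc)

lemma times_kummer_deriv_sums:
  assumes "0 < c"
  shows "(\<lambda>k. real k * kummer_coeff a c k * x ^ k) sums (x * (a / c * kummer (a + 1) (c + 1) x))"
proof -
  have "(\<lambda>k. real (Suc k) * kummer_coeff a c (Suc k) * x ^ Suc k) sums (x * (a / c * kummer (a + 1) (c + 1) x))"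
    using sums_mult[OF kummer_deriv_sums[OF assms, of a x], of x] by (simp add: mult_ac)
  then show ?thesis by (subst (asm) sums_Suc_iff) simp
qed

lemma times_kummer_sums:
  assumes "0 < c"
  shows "(\<lambda>k. (if k = 0 then 0 else kummer_coeff a c (k - 1)) * x ^ k) sums (x * kummer a c x)"
proof -
  have "(\<lambda>k. kummer_coeff a c k * x ^ Suc k) sums (x * kummer a c x)"
    using sums_mult[OF kummer_sums[OF assms, of a x], of x] by (simp add: mult_ac)
  then show ?thesis
    using sums_Suc_iff[of "\<lambda>k. (if k = 0 then 0 else kummer_coeff a c (k - 1)) * x ^ k"] by simp
qed

section \<open>Contiguity relations at half-integer parameters\<close>

lemma pochhammer_half:
  "pochhammer (3/2) k = (1 + 2 * real k) * pochhammer (1/2 :: real) k"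
  "pochhammer (1/2) (Suc k) = pochhammer (3/2 :: real) k / 2"
proof -
  have h: "pochhammer (1/2) (Suc k) = pochhammer (3/2 :: real) k / 2"
    using pochhammer_rec[of "1/2::real" k] by simp
  then show "pochhammer (1/2) (Suc k) = pochhammer (3/2 :: real) k / 2" .
  show "pochhammer (3/2) k = (1 + 2 * real k) * pochhammer (1/2 :: real) k"
    using h unfolding pochhammer_Suc by (simp add: field_simps)
qed

lemma pochhammer_three_halves_pos: "0 < pochhammer (3/2 :: real) k"
  by (intro pochhammer_pos) simp

text \<open>With z = x^2 / 2, the left side is what differentiating x exp (-z) F(a, 3/2; z) in x
  leaves beside the factor exp (-z). For a = 1/2 - k the right side is the function inside
  \<open>kummer_cos k\<close>.\<close>

lemma kummer_contiguous_sin: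
  "(1 - 2 * z) * kummer a (3/2) z + 2 * z * (a / (3/2) * kummer (a + 1) (5/2) z) = kummer (a - 1) (1/2) z"
proof -
  have "(\<lambda>k. kummer_coeff a (3/2) k * z ^ k - 2 * ((if k = 0 then 0 else kummer_coeff a (3/2) (k - 1)) * z ^ k)
        + 2 * (real k * kummer_coeff a (3/2) k * z ^ k))
     sums (kummer a (3/2) z - 2 * (z * kummer a (3/2) z) + 2 * (z * (a / (3/2) * kummer (a + 1) (3/2 + 1) z)))"
    by (intro sums_add sums_diff sums_mult kummer_sums times_kummer_sums times_kummer_deriv_sums) simp_all
  also have "(\<lambda>k. kummer_coeff a (3/2) k * z ^ k - 2 * ((if k = 0 then 0 else kummer_coeff a (3/2) (k - 1)) * z ^ k)
        + 2 * (real k * kummer_coeff a (3/2) k * z ^ k)) = (\<lambda>k. kummer_coeff (a - 1) (1/2) k * z ^ k)"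
  proof
    fix k
    have "kummer_coeff a (3/2) k - 2 * (if k = 0 then 0 else kummer_coeff a (3/2) (k - 1))
        + 2 * (real k * kummer_coeff a (3/2) k) = kummer_coeff (a - 1) (1/2) k"
    proof (cases k)
      case 0 then show ?thesis by (simp add: kummer_coeff_def)
    next
      case (Suc i)
      have "pochhammer (a - 1) (Suc i) = (a - 1) * pochhammer a i"
        using pochhammer_rec[of "a - 1" i] by simp
      moreover have "pochhammer (3/2) (Suc i) = pochhammer (3/2 :: real) i * (3/2 + real i)"
        by (simp add: pochhammer_Suc)
      ultimately show ?thesis
        using pochhammer_three_halves_pos[of i] unfolding Suc
        by (simp add: kummer_coeff_def pochhammer_half(2) pochhammer_Suc[of a])
          (simp add: divide_simps, simp add: algebra_simps)
    qed
    moreover have "c * z ^ k - 2 * (b * z ^ k) + 2 * (real k * c * z ^ k) = (c - 2 * b + 2 * (real k * c)) * z ^ k"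
      for b c by (simp add: algebra_simps)
    ultimately show "kummer_coeff a (3/2) k * z ^ k - 2 * ((if k = 0 then 0 else kummer_coeff a (3/2) (k - 1)) * z ^ k)
        + 2 * (real k * kummer_coeff a (3/2) k * z ^ k) = kummer_coeff (a - 1) (1/2) k * z ^ k"
      by metis
  qed
  finally show ?thesis
    using sums_unique2[OF _ kummer_sums[of "1/2" "a - 1" z]] by (simp add: algebra_simps)
qed

text \<open>The left side is F' - F for F = F(b, 1/2; z), the factor arising from the derivative of
  exp (-z) F. At b = -1/2 - k the constant 2b - 1 equals -2 (k + 1).\<close>

lemma kummer_contiguous_cos:
  "b / (1/2) * kummer (b + 1) (3/2) z - kummer b (1/2) z = (2 * b - 1) * kummer b (3/2) z"
proof -
  have "(\<lambda>k. real (Suc k) * kummer_coeff b (1/2) (Suc k) * z ^ k - kummer_coeff b (1/2) k * z ^ k)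
     sums (b / (1/2) * kummer (b + 1) (1/2 + 1) z - kummer b (1/2) z)"
    by (intro sums_diff kummer_sums kummer_deriv_sums) simp_all
  also have "(\<lambda>k. real (Suc k) * kummer_coeff b (1/2) (Suc k) * z ^ k - kummer_coeff b (1/2) k * z ^ k)
      = (\<lambda>k. (2 * b - 1) * (kummer_coeff b (3/2) k * z ^ k))"
  proof
    fix k
    have p: "pochhammer (1/2::real) k > 0" by (intro pochhammer_pos) simp
    have "real (Suc k) * kummer_coeff b (1/2) (Suc k) - kummer_coeff b (1/2) k
        = (2 * b - 1) * kummer_coeff b (3/2) k"
      using p by (simp add: kummer_coeff_def pochhammer_half pochhammer_Suc[of b])
        (simp add: divide_simps, simp add: algebra_simps)
    then show "real (Suc k) * kummer_coeff b (1/2) (Suc k) * z ^ k - kummer_coeff b (1/2) k * z ^ k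
      = (2 * b - 1) * (kummer_coeff b (3/2) k * z ^ k)"
      by (simp flip: left_diff_distrib mult.assoc)
  qed
  finally show ?thesis
    using sums_unique2[OF _ sums_mult[OF kummer_sums[of "3/2" b z], of "2 * b - 1"]] by simp
qed

text \<open>The coefficients of F(1/2, 3/2; z) are 1 / ((2k + 1) k!), and F + 2 z F' multiplies them
  by 2k + 1. Equivalently, s F(z s^2) has s-derivative exp (z s^2).\<close>

lemma kummer_half_exp:
  "kummer (1/2) (3/2) z + 2 * z * ((1/2) / (3/2) * kummer (3/2) (5/2) z) = exp z"
proof -
  have "(\<lambda>k. kummer_coeff (1/2) (3/2) k * z ^ k + 2 * (real k * kummer_coeff (1/2) (3/2) k * z ^ k))
     sums (kummer (1/2) (3/2) z + 2 * (z * ((1/2) / (3/2) * kummer (1/2 + 1) (3/2 + 1) z)))"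
    by (intro sums_add sums_mult kummer_sums times_kummer_deriv_sums) simp_all
  also have "(\<lambda>k. kummer_coeff (1/2) (3/2) k * z ^ k + 2 * (real k * kummer_coeff (1/2) (3/2) k * z ^ k))
      = (\<lambda>k. z ^ k /\<^sub>R fact k)"
  proof
    fix k
    have p: "pochhammer (1/2::real) k > 0" by (intro pochhammer_pos) simp
    have "(1 + 2 * real k) * kummer_coeff (1/2) (3/2) k = inverse (fact k)"
      using p by (simp add: kummer_coeff_def pochhammer_half divide_simps)
    then have "(1 + 2 * real k) * kummer_coeff (1/2) (3/2) k * z ^ k = inverse (fact k) * z ^ k" by simp
    then show "kummer_coeff (1/2) (3/2) k * z ^ k + 2 * (real k * kummer_coeff (1/2) (3/2) k * z ^ k)
      = z ^ k /\<^sub>R fact k"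
      by (simp add: algebra_simps)
  qed
  finally show ?thesis
    using sums_unique2[OF _ exp_converges[of z]] by simp
qed

text \<open>Up to constant factors, the sine transform of \<open>t ^ (2 * k) * exp (- t\<^sup>2 / 2)\<close> and the cosine
  transform of \<open>t ^ (2 * k + 1) * exp (- t\<^sup>2 / 2)\<close>, which explains the derivative rules below.\<close>

definition kummer_sin :: "nat \<Rightarrow> real \<Rightarrow> real" where
  "kummer_sin k x = x * exp (- x\<^sup>2 / 2) * kummer (1/2 - real k) (3/2) (x\<^sup>2 / 2)"

definition kummer_cos :: "nat \<Rightarrow> real \<Rightarrow> real" where
  "kummer_cos k x = exp (- x\<^sup>2 / 2) * kummer (-1/2 - real k) (1/2) (x\<^sup>2 / 2)"

lemma kummer_square_DERIV:
  assumes "0 < c"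
  shows "((\<lambda>x. kummer a c (x\<^sup>2 / 2)) has_real_derivative x * (a / c * kummer (a + 1) (c + 1) (x\<^sup>2 / 2))) (at x)"
proof -
  have "((\<lambda>x::real. x\<^sup>2 / 2) has_real_derivative x) (at x)"
    by (auto intro!: derivative_eq_intros)
  from DERIV_chain2[OF kummer_DERIV[OF assms, of a "x\<^sup>2 / 2"] this]
  show ?thesis by (simp add: mult.commute)
qed

lemma exp_square_DERIV:
  "((\<lambda>x::real. exp (- x\<^sup>2 / 2)) has_real_derivative - x * exp (- x\<^sup>2 / 2)) (at x)"
  by (auto intro!: derivative_eq_intros)

lemma kummer_sin_DERIV: "(kummer_sin k has_real_derivative kummer_cos k x) (at x)"
proof -
  let ?a = "1/2 - real k"
  have "(kummer_sin k has_real_derivative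
      (1 * exp (- x\<^sup>2 / 2) + - x * exp (- x\<^sup>2 / 2) * x) * kummer ?a (3/2) (x\<^sup>2 / 2)
      + x * (?a / (3/2) * kummer (?a + 1) (3/2 + 1) (x\<^sup>2 / 2)) * (x * exp (- x\<^sup>2 / 2))) (at x)"
    unfolding kummer_sin_def[abs_def]
    by (rule DERIV_mult[OF DERIV_mult[OF DERIV_ident exp_square_DERIV] kummer_square_DERIV]) simp
  also have "(1 * exp (- x\<^sup>2 / 2) + - x * exp (- x\<^sup>2 / 2) * x) * kummer ?a (3/2) (x\<^sup>2 / 2)
      + x * (?a / (3/2) * kummer (?a + 1) (3/2 + 1) (x\<^sup>2 / 2)) * (x * exp (- x\<^sup>2 / 2))
      = exp (- x\<^sup>2 / 2) * ((1 - 2 * (x\<^sup>2 / 2)) * kummer ?a (3/2) (x\<^sup>2 / 2)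
        + 2 * (x\<^sup>2 / 2) * (?a / (3/2) * kummer (?a + 1) (5/2) (x\<^sup>2 / 2)))"
    by (simp add: algebra_simps power2_eq_square)
  also have "\<dots> = kummer_cos k x"
    unfolding kummer_contiguous_sin by (simp add: kummer_cos_def)
  finally show ?thesis .
qed

lemma kummer_cos_DERIV:
  "(kummer_cos k has_real_derivative - 2 * real (Suc k) * kummer_sin (Suc k) x) (at x)"
proof -
  let ?b = "-1/2 - real k"
  have "(kummer_cos k has_real_derivative
      - x * exp (- x\<^sup>2 / 2) * kummer ?b (1/2) (x\<^sup>2 / 2)
      + x * (?b / (1/2) * kummer (?b + 1) (1/2 + 1) (x\<^sup>2 / 2)) * exp (- x\<^sup>2 / 2)) (at x)"
    unfolding kummer_cos_def[abs_def]
    by (rule DERIV_mult[OF exp_square_DERIV kummer_square_DERIV]) simp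
  also have "- x * exp (- x\<^sup>2 / 2) * kummer ?b (1/2) (x\<^sup>2 / 2)
      + x * (?b / (1/2) * kummer (?b + 1) (1/2 + 1) (x\<^sup>2 / 2)) * exp (- x\<^sup>2 / 2)
      = x * exp (- x\<^sup>2 / 2) * (?b / (1/2) * kummer (?b + 1) (3/2) (x\<^sup>2 / 2) - kummer ?b (1/2) (x\<^sup>2 / 2))"
    by (simp add: algebra_simps)
  also have "\<dots> = - 2 * real (Suc k) * kummer_sin (Suc k) x"
  proof -
    have b: "?b = 1/2 - real (Suc k)" by simp
    show ?thesis
      unfolding kummer_contiguous_cos kummer_sin_def unfolding b by simp
  qed
  finally show ?thesis .
qed

text \<open>\<open>kummer_sin 0 x\<close> is sqrt 2 times Dawson's function at x / sqrt 2, and this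
  is its differential equation y' = 1 - x y, since y' is \<open>kummer_cos 0\<close>.\<close>

lemma kummer_cos_0: "kummer_cos 0 x = 1 - x * kummer_sin 0 x"
proof -
  have "kummer (-1/2) (1/2) (x\<^sup>2 / 2) = exp (x\<^sup>2 / 2) - x\<^sup>2 * kummer (1/2) (3/2) (x\<^sup>2 / 2)"
    using kummer_contiguous_sin[of "x\<^sup>2 / 2" "1/2"] kummer_half_exp[of "x\<^sup>2 / 2"]
    by (simp add: algebra_simps)
  then show ?thesis
    by (simp add: kummer_cos_def kummer_sin_def exp_minus field_simps power2_eq_square)
qed

text \<open>The guard keeps the truncated \<open>m - k\<close> from producing terms beyond \<open>k = m\<close>.\<close>

definition even_coeff :: "nat \<Rightarrow> nat \<Rightarrow> real" where
  "even_coeff m k = (if k \<le> m then - sqrt 2 * fact (2 * m) * ((-1) ^ k * 2 ^ k / (fact (m - k) * Gamma (real k + 1/2))) else 0)"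

definition odd_coeff :: "nat \<Rightarrow> nat \<Rightarrow> real" where
  "odd_coeff m k = (if k \<le> m then sqrt 2 * fact (2 * m + 1) * ((-1) ^ k * 2 ^ k / (fact (m - k) * Gamma (real k + 3/2))) else 0)"

text \<open>The two claimed representations under one index, so that the ladder relations can be
  stated for all n at once; \<open>n div 2\<close> is m both for n = 2m and for n = 2m + 1.\<close>

definition conj_hermite :: "nat \<Rightarrow> real \<Rightarrow> real" where
  "conj_hermite n x = (if even n then \<Sum>k\<le>n div 2. even_coeff (n div 2) k * kummer_sin k x
     else \<Sum>k\<le>n div 2. odd_coeff (n div 2) k * kummer_cos k x)"

text \<open>The upper limit is free because neighbouring indices have sums of different length, and
  these must be compared term by term.\<close>

lemma conj_hermite_even:
  assumes "m \<le> N" shows "conj_hermite (2 * m) x = (\<Sum>k\<le>N. even_coeff m k * kummer_sin k x)"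
proof -
  have "(\<Sum>k\<le>N. even_coeff m k * kummer_sin k x) = (\<Sum>k\<le>m. even_coeff m k * kummer_sin k x)"
    using assms by (intro sum.mono_neutral_right) (auto simp: even_coeff_def)
  then show ?thesis by (simp add: conj_hermite_def)
qed

lemma conj_hermite_odd:
  assumes "m \<le> N" shows "conj_hermite (Suc (2 * m)) x = (\<Sum>k\<le>N. odd_coeff m k * kummer_cos k x)"
proof -
  have "(\<Sum>k\<le>N. odd_coeff m k * kummer_cos k x) = (\<Sum>k\<le>m. odd_coeff m k * kummer_cos k x)"
    using assms by (intro sum.mono_neutral_right) (auto simp: odd_coeff_def)
  then show ?thesis by (simp add: conj_hermite_def)
qed

lemma conj_hermite_0: "conj_hermite 0 x = - (sqrt 2 / sqrt pi) * kummer_sin 0 x"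
  using conj_hermite_even[of 0 0 x] by (simp add: even_coeff_def Gamma_one_half_real)

lemma Gamma_half_shift:
  "Gamma (real k + 3/2) = (real k + 1/2) * Gamma (real k + 1/2)" "Gamma (real k + 1/2) > 0"
proof -
  have "real k + 1/2 \<notin> \<int>\<^sub>\<le>\<^sub>0" by (auto elim!: nonpos_Ints_cases)
  from Gamma_plus1[OF this] show "Gamma (real k + 3/2) = (real k + 1/2) * Gamma (real k + 1/2)"
    by (simp add: add.commute add.left_commute)
  show "Gamma (real k + 1/2) > 0" by (intro Gamma_real_pos) simp
qed

section \<open>Derivatives of the Kummer sums\<close>

text \<open>The coefficient of \<open>kummer_cos k\<close> in the derivative relation for index
  2m.\<close>

lemma even_coeff_odd_coeff:
  "even_coeff m k = 2 * real m * odd_coeff (m - 1) k - odd_coeff m k / 2"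
proof -
  consider "m < k" | "m = k" | i where "m = k + Suc i"
    by (metis less_imp_Suc_add linorder_neqE_nat add_Suc_right)
  then show ?thesis
  proof cases
    case 1
    then show ?thesis by (simp add: even_coeff_def odd_coeff_def)
  next
    case 2
    show ?thesis
    \<comment> \<open>For positive k the guard annihilates \<open>odd_coeff (m - 1) k\<close>. For k
      = 0 the truncated \<open>m - 1\<close> is again 0 and only the factor m removes that
      term.\<close>
    proof (cases k)
      case (Suc j)
      then show ?thesis using 2 Gamma_half_shift[of k]
        by (simp add: even_coeff_def odd_coeff_def divide_simps, (simp add: algebra_simps)?)
    qed (use 2 Gamma_half_shift[of 0] in \<open>simp add: even_coeff_def odd_coeff_def divide_simps\<close>)
  next
    case (3 i)
    have f: "fact (2 * m + 1) = (2 * real m + 1) * fact (2 * m)"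
       "fact (2 * m) = 2 * real m * fact (2 * (m - 1) + 1)"
      using 3 by (simp_all add: fact_reduce[of "2 * m"] algebra_simps)
    define F where "F = (fact (2 * (m - 1) + 1) :: real)"
    define P where "P = ((-1) ^ k * 2 ^ k :: real)"
    define g where "g = Gamma (real k + 1/2)"
    have gp: "g > 0" unfolding g_def by (rule Gamma_half_shift)
    have m: "m - k = Suc i" "m - 1 - k = i" "k \<le> m" "k \<le> m - 1" "real m = real k + real i + 1" using 3 by auto
    show ?thesis
      unfolding even_coeff_def odd_coeff_def f F_def[symmetric] P_def[symmetric] m(1,2)
        Gamma_half_shift(1) g_def[symmetric]
      using gp m(3-5)
      by (simp add: divide_simps, (simp add: algebra_simps)?)
  qed
qed

text \<open>The coefficient of \<open>kummer_sin (Suc k)\<close> in the derivative relation for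
  index 2m + 1, solved for the highest index.\<close>

lemma even_coeff_Suc_odd_coeff:
  "even_coeff (Suc m) (Suc k) = 2 * real (2 * m + 1) * even_coeff m (Suc k) + 4 * real (Suc k) * odd_coeff m k"
proof -
  have f: "fact (2 * Suc m) = 2 * real (Suc m) * fact (2 * m + 1)"
     "fact (2 * m + 1) = (2 * real m + 1) * fact (2 * m)"
    by (simp_all add: algebra_simps)
  define F where "F = (fact (2 * m) :: real)"
  define P where "P = ((-1) ^ k * 2 ^ k :: real)"
  have g: "Gamma (real (Suc k) + 1/2) = Gamma (real k + 3/2)" by (simp add: add.commute add.left_commute)
  have gp: "Gamma (real k + 3/2) > 0" by (intro Gamma_real_pos) simp
  consider "m < k" | "m = k" | i where "m = k + Suc i"
    by (metis less_imp_Suc_add linorder_neqE_nat add_Suc_right)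
  then show ?thesis
  proof cases
    case 1
    then show ?thesis by (simp add: even_coeff_def odd_coeff_def)
  next
    case 2
    then show ?thesis unfolding even_coeff_def odd_coeff_def f g using gp
      by (simp add: divide_simps, (simp add: algebra_simps)?)
  next
    case (3 i)
    have m: "Suc m - Suc k = Suc i" "m - Suc k = i" "m - k = Suc i" "Suc k \<le> Suc m" "Suc k \<le> m" "k \<le> m"
      "real m = real k + real i + 1" using 3 by auto
    show ?thesis
      unfolding even_coeff_def odd_coeff_def f g F_def[symmetric] m(1-3) power_Suc
      unfolding mult.assoc
      using gp m(4-7)
      by (simp add: divide_simps, (simp add: algebra_simps)?)
  qed
qed

text \<open>Differentiating a \<open>kummer_cos k\<close> never produces
  \<open>kummer_sin 0\<close>, so the contributions of the neighbouring even indices to that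
  function have to cancel.\<close>

lemma even_coeff_Suc_0: "even_coeff (Suc m) 0 = 2 * real (2 * m + 1) * even_coeff m 0"
proof -
  have "fact (2 * Suc m) = 2 * real (Suc m) * ((2 * real m + 1) * fact (2 * m))"
    by (simp add: algebra_simps)
  then show ?thesis unfolding even_coeff_def using Gamma_half_shift(2)[of 0]
    by (simp add: divide_simps, (simp add: algebra_simps)?)
qed

lemma conj_hermite_DERIV:
  "(conj_hermite n has_real_derivative
     real n * conj_hermite (n - 1) x - conj_hermite (Suc n) x / 2) (at x)"
proof (cases "even n")
  case True
  then obtain m where m: "n = 2 * m" by (auto elim: evenE)
  have "(conj_hermite n has_real_derivative (\<Sum>k\<le>m. even_coeff m k * kummer_cos k x)) (at x)"
    unfolding m conj_hermite_even[OF order_refl, abs_def]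
    by (intro DERIV_sum DERIV_cmult kummer_sin_DERIV)
  also have "(\<Sum>k\<le>m. even_coeff m k * kummer_cos k x)
      = 2 * real m * (\<Sum>k\<le>m. odd_coeff (m - 1) k * kummer_cos k x) - (\<Sum>k\<le>m. odd_coeff m k * kummer_cos k x) / 2"
    by (simp add: even_coeff_odd_coeff[of m] left_diff_distrib sum_subtractf sum_distrib_left sum_divide_distrib mult.assoc)
  also have "\<dots> = real n * conj_hermite (n - 1) x - conj_hermite (Suc n) x / 2"
  proof (cases m)
    case 0 then show ?thesis using m by (simp add: conj_hermite_odd[of 0 0, simplified])
  next
    case (Suc j)
    have "n - 1 = Suc (2 * j)" using m Suc by simp
    then show ?thesis
      using conj_hermite_odd[of j m x] conj_hermite_odd[of m m x] Suc m by simp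
  qed
  finally show ?thesis .
next
  case False
  then obtain m where m: "n = Suc (2 * m)" by (auto elim: oddE)
  have "(conj_hermite n has_real_derivative
      (\<Sum>k\<le>m. odd_coeff m k * (- 2 * real (Suc k) * kummer_sin (Suc k) x))) (at x)"
    unfolding m conj_hermite_odd[OF order_refl, abs_def]
    by (intro DERIV_sum DERIV_cmult kummer_cos_DERIV)
  also have "(\<Sum>k\<le>m. odd_coeff m k * (- 2 * real (Suc k) * kummer_sin (Suc k) x))
     = (\<Sum>k\<le>m. (real (2 * m + 1) * even_coeff m (Suc k) - even_coeff (Suc m) (Suc k) / 2) * kummer_sin (Suc k) x)"
    by (intro sum.cong refl) (simp add: even_coeff_Suc_odd_coeff algebra_simps)
  \<comment> \<open>The shifted sum gains a term k = 0, whose coefficient is zero by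
    \<open>even_coeff_Suc_0\<close>.\<close>
  also have "\<dots> = (\<Sum>k\<le>Suc m. (real (2 * m + 1) * even_coeff m k - even_coeff (Suc m) k / 2) * kummer_sin k x)"
    unfolding sum.atMost_Suc_shift by (simp add: even_coeff_Suc_0)
  also have "\<dots> = real (2 * m + 1) * (\<Sum>k\<le>Suc m. even_coeff m k * kummer_sin k x)
      - (\<Sum>k\<le>Suc m. even_coeff (Suc m) k * kummer_sin k x) / 2"
    by (simp add: left_diff_distrib sum_subtractf sum_distrib_left sum_divide_distrib mult.assoc
        del: sum.atMost_Suc)
  also have "\<dots> = real n * conj_hermite (n - 1) x - conj_hermite (Suc n) x / 2"
    using conj_hermite_even[of m "Suc m" x] conj_hermite_even[of "Suc m" "Suc m" x] m
    by (simp del: sum.atMost_Suc)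
  finally show ?thesis .
qed

section \<open>Integrals of the Hermite functions and multiplication by x\<close>

definition hermite_mass :: "nat \<Rightarrow> real" where
  "hermite_mass n = (LINT x|lborel. hermite_fun_rec n x) / pi"

text \<open>The derivative relation for h_n, integrated over the line.\<close>

lemma hermite_mass_Suc: "hermite_mass (Suc n) = 2 * real n * hermite_mass (n - 1)"
proof -
  have "(LINT x|lborel. real n * hermite_fun_rec (n - 1) x - hermite_fun_rec (Suc n) x / 2) = 0"
    by (rule integral_derivative_zero[OF hermite_fun_rec_DERIV _ _ gauss_poly_decay1])
      (use continuous_on_eq_continuous_at[of UNIV] gauss_poly_continuous in
        \<open>auto intro!: continuous_intros Bochner_Integration.integrable_diff gauss_poly_integrable\<close>)
  then show ?thesis
    by (simp add: hermite_mass_def gauss_poly_integrable field_simps)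
qed

lemma hermite_mass_0: "hermite_mass 0 = sqrt 2 / sqrt pi"
proof -
  have "hermite_mass 0 = sqrt 2 * sqrt pi / (sqrt pi * sqrt pi)"
    using gaussian_integral by (simp add: hermite_mass_def gauss_poly_def real_sqrt_mult)
  then show ?thesis by (simp del: real_sqrt_mult_self)
qed

lemma hermite_mass_odd: "odd n \<Longrightarrow> hermite_mass n = 0"
proof (induction n rule: less_induct)
  case (less n)
  then obtain m where "n = Suc (2 * m)" by (auto elim: oddE)
  then show ?case using less(1)[of "2 * m - 1"] hermite_mass_Suc[of "2 * m"]
    by (cases m) auto
qed

text \<open>The base case is Dawson's equation, whose constant 1 becomes
  \<open>hermite_mass 0\<close>. In the step the constant at j disappears under differentiation; the
  one at j - 1 survives and is turned into the constant at j + 1 by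
  \<open>hermite_mass_Suc\<close>.\<close>

lemma conj_hermite_times:
  "x * conj_hermite n x = real n * conj_hermite (n - 1) x + conj_hermite (Suc n) x / 2 - hermite_mass n"
proof (induction n arbitrary: x rule: less_induct)
  case (less n)
  note D = conj_hermite_DERIV
  show ?case
  proof (cases n)
    case 0
    have "conj_hermite 0 x = - (sqrt 2 / sqrt pi) * kummer_sin 0 x"
      by (rule conj_hermite_0)
    moreover have "conj_hermite (Suc 0) x = 2 * (sqrt 2 / sqrt pi) * (1 - x * kummer_sin 0 x)"
    proof -
      have "Gamma (3/2 :: real) = sqrt pi / 2"
        using Gamma_half_shift(1)[of 0] by (simp add: Gamma_one_half_real)
      moreover have "conj_hermite (Suc 0) x = sqrt 2 * (1 - x * kummer_sin 0 x) / Gamma (3/2)"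
        using conj_hermite_odd[of 0 0 x] by (simp add: odd_coeff_def kummer_cos_0)
      ultimately show ?thesis by (simp only:) simp
    qed
    ultimately show ?thesis using 0 by (simp add: hermite_mass_0 algebra_simps diff_divide_distrib)
  next
    case (Suc j)
    text \<open>The identity for \<open>Suc j\<close> is what differentiating the identity for \<open>j\<close> leaves after
      eliminating \<open>x * conj_hermite (j - 1) x\<close>.\<close>
    have eq: "(\<lambda>x. x * conj_hermite j x) =
        (\<lambda>x. real j * conj_hermite (j - 1) x + conj_hermite (Suc j) x / 2 - hermite_mass j)"
      using less Suc by auto
    have d1: "((\<lambda>x. x * conj_hermite j x) has_real_derivative
        1 * conj_hermite j x + (real j * conj_hermite (j - 1) x - conj_hermite (Suc j) x / 2) * x) (at x)"
      by (rule DERIV_mult[OF DERIV_ident D])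
    have d2: "((\<lambda>x. x * conj_hermite j x) has_real_derivative
        real j * (real (j - 1) * conj_hermite (j - 1 - 1) x - conj_hermite (Suc (j - 1)) x / 2)
        + (real (Suc j) * conj_hermite (Suc j - 1) x - conj_hermite (Suc (Suc j)) x / 2) / 2 - 0) (at x)"
      unfolding eq by (intro DERIV_diff DERIV_add DERIV_cmult DERIV_cdivide DERIV_const D)
    note e = DERIV_unique[OF d1 d2]
    \<comment> \<open>The factor j covers j = 0, where \<open>j - 1\<close> is truncated and the
      hypothesis would speak of the wrong index.\<close>
    have e': "real j * (x * conj_hermite (j - 1) x) =
        real j * (real (j - 1) * conj_hermite (j - 1 - 1) x + conj_hermite j x / 2 - hermite_mass (j - 1))"
      using less(1)[of "j - 1" x] Suc by (cases j) auto
    have e2: "real j * conj_hermite (Suc (j - 1)) x = real j * conj_hermite j x" by (cases j) auto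
    show ?thesis unfolding Suc hermite_mass_Suc
      using e e' e2
      by (simp only: algebra_simps add_divide_distrib diff_divide_distrib times_divide_eq_left
          times_divide_eq_right diff_Suc_1 of_nat_Suc)
  qed
qed

lemma conj_hermite_parity: "conj_hermite n (- x) = (-1) ^ Suc n * conj_hermite n x"
  by (auto simp: conj_hermite_def kummer_sin_def kummer_cos_def sum_negf)


subsection \<open>Principal values\<close>

lemma LINT_punctured_tendsto:
  fixes f :: "real \<Rightarrow> real"
  assumes f: "integrable lborel f"
  shows "((\<lambda>\<epsilon>. LINT t:{t. \<epsilon> < \<bar>t - c\<bar>}|lborel. f t) \<longlongrightarrow> (LINT t|lborel. f t)) (at_right 0)"
  unfolding tendsto_at_iff_sequentially
proof (intro allI impI)
  fix X :: "nat \<Rightarrow> real" assume X: "\<forall>i. X i \<in> {0<..} - {0}" "X \<longlonglongrightarrow> 0"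
  have "(\<lambda>i. LINT t:{t. X i < \<bar>t - c\<bar>}|lborel. f t) \<longlonglongrightarrow> (LINT t|lborel. f t)"
    unfolding set_lebesgue_integral_def
  proof (rule integral_dominated_convergence[where w = "\<lambda>t. norm (f t)"])
    show "f \<in> borel_measurable lborel" using f by auto
    then show "(\<lambda>t. indicator {t. X i < \<bar>t - c\<bar>} t *\<^sub>R f t) \<in> borel_measurable lborel" for i
      by measurable
    show "integrable lborel (\<lambda>t. norm (f t))" using f by (rule integrable_norm)
    show "AE t in lborel. norm (indicator {t. X i < \<bar>t - c\<bar>} t *\<^sub>R f t) \<le> norm (f t)" for i
      by (auto simp: indicator_def)
    have "AE t in lborel. t \<noteq> c" by (rule AE_lborel_singleton)
    then show "AE t in lborel. (\<lambda>i. indicator {t. X i < \<bar>t - c\<bar>} t *\<^sub>R f t) \<longlonglongrightarrow> f t"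
    proof eventually_elim
      case (elim t)
      then have "\<forall>\<^sub>F i in sequentially. X i < \<bar>t - c\<bar>"
        using order_tendstoD(2)[OF X(2), of "\<bar>t - c\<bar>"] by simp
      then have "\<forall>\<^sub>F i in sequentially. indicator {t. X i < \<bar>t - c\<bar>} t *\<^sub>R f t = f t"
        by eventually_elim simp
      then show ?case by (rule tendsto_eventually)
    qed
  qed
  then show "((\<lambda>\<epsilon>. LINT t:{t. \<epsilon> < \<bar>t - c\<bar>}|lborel. f t) \<circ> X) \<longlonglongrightarrow> (LINT t|lborel. f t)"
    by (simp add: comp_def)
qed

lemma punctured_kernel_integrable:
  fixes h :: "real \<Rightarrow> real"
  assumes "integrable lborel h" "0 < \<epsilon>"
  shows "set_integrable lborel {t. \<epsilon> < \<bar>t - c\<bar>} (\<lambda>t. h t / (t - c))"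
  unfolding set_integrable_def
proof (rule Bochner_Integration.integrable_bound)
  show "integrable lborel (\<lambda>t. h t / \<epsilon>)" using assms by simp
  have [measurable]: "h \<in> borel_measurable lborel" using assms by auto
  show "(\<lambda>t. indicator {t. \<epsilon> < \<bar>t - c\<bar>} t *\<^sub>R (h t / (t - c))) \<in> borel_measurable lborel" by measurable
  show "AE t in lborel. norm (indicator {t. \<epsilon> < \<bar>t - c\<bar>} t *\<^sub>R (h t / (t - c))) \<le> norm (h t / \<epsilon>)"
    using assms(2) by (auto simp: indicator_def intro!: divide_left_mono mult_pos_pos)
qed

text \<open>Averaging the substitutions t = x + u and t = x - u replaces the singular kernel by a
  symmetric difference quotient. The set is written with \<open>u - 0\<close> to fit
  \<open>LINT_punctured_tendsto\<close> at centre 0.\<close>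

lemma punctured_integral_symmetric:
  fixes h :: "real \<Rightarrow> real"
  assumes h: "integrable lborel h" and "0 < \<epsilon>"
  shows "(LINT t:{t. \<epsilon> < \<bar>t - x\<bar>}|lborel. h t / (t - x))
    = (LINT u:{u. \<epsilon> < \<bar>u - 0\<bar>}|lborel. (h (x + u) - h (x - u)) / u) / 2"
proof -
  define \<phi> where "\<phi> t = indicator {t. \<epsilon> < \<bar>t - x\<bar>} t *\<^sub>R (h t / (t - x))" for t
  have i: "integrable lborel \<phi>"
    using punctured_kernel_integrable[OF assms] by (simp add: \<phi>_def[abs_def] set_integrable_def)
  have i1: "integrable lborel (\<lambda>u. \<phi> (x + u))" "integrable lborel (\<lambda>u. \<phi> (x - u))"
    using lborel_integrable_real_affine[OF i, of 1 x] lborel_integrable_real_affine[OF i, of "-1" x] by auto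
  have "(LINT u|lborel. \<phi> (x + u)) = (LINT u|lborel. \<phi> u)" "(LINT u|lborel. \<phi> (x - u)) = (LINT u|lborel. \<phi> u)"
    using lborel_integral_real_affine[of 1 \<phi> x] lborel_integral_real_affine[of "-1" \<phi> x] by auto
  then have "(LINT u|lborel. \<phi> u) = (LINT u|lborel. \<phi> (x + u) + \<phi> (x - u)) / 2"
    by (simp add: i1)
  also have "(\<lambda>u. \<phi> (x + u) + \<phi> (x - u)) = (\<lambda>u. indicator {u. \<epsilon> < \<bar>u - 0\<bar>} u *\<^sub>R ((h (x + u) - h (x - u)) / u))"
    by (auto simp: fun_eq_iff \<phi>_def indicator_def diff_divide_distrib)
  finally show ?thesis by (simp add: \<phi>_def set_lebesgue_integral_def)
qed

text \<open>In the symmetrized integral the quotient is at most 2L on |u| \<le> 1 by the Lipschitz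
  condition, and at most |h (x + u)| + |h (x - u)| beyond. The resulting bound does not depend on
  x.\<close>

lemma pv_bounded:
  fixes h :: "real \<Rightarrow> real"
  assumes h: "integrable lborel h" and L: "\<And>a b. \<bar>h a - h b\<bar> \<le> L * \<bar>a - b\<bar>"
    and pv: "has_pv_integral (\<lambda>t. h t / (t - x)) x I"
  shows "\<bar>I\<bar> \<le> 2 * L + (LINT t|lborel. \<bar>h t\<bar>)"
proof -
  have [measurable]: "h \<in> borel_measurable borel" using h by auto
  have ii: "integrable lborel (indicator {-1..1::real} :: real \<Rightarrow> real)" by simp
  have a1: "integrable lborel (\<lambda>u. \<bar>h (x + u)\<bar>)" "integrable lborel (\<lambda>u. \<bar>h (x - u)\<bar>)"
    using lborel_integrable_real_affine[OF integrable_abs[OF h], of 1 x]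
      lborel_integrable_real_affine[OF integrable_abs[OF h], of "-1" x] by auto
  have a2: "(LINT u|lborel. \<bar>h (x + u)\<bar>) = (LINT u|lborel. \<bar>h u\<bar>)" "(LINT u|lborel. \<bar>h (x - u)\<bar>) = (LINT u|lborel. \<bar>h u\<bar>)"
    using lborel_integral_real_affine[of 1 "\<lambda>u. \<bar>h u\<bar>" x] lborel_integral_real_affine[of "-1" "\<lambda>u. \<bar>h u\<bar>" x] by auto
  let ?W = "\<lambda>u. 2 * L * indicator {-1..1} u + (\<bar>h (x + u)\<bar> + \<bar>h (x - u)\<bar>)"
  have L0: "0 \<le> L" using L[of 1 0] abs_ge_zero[of "h 1 - h 0"] by simp
  have w: "\<bar>(h (x + u) - h (x - u)) / u\<bar> \<le> ?W u" for u
  proof (cases "\<bar>u\<bar> \<le> 1")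
    case True
    have "\<bar>h (x + u) - h (x - u)\<bar> \<le> L * \<bar>2 * u\<bar>" using L[of "x + u" "x - u"] by simp
    then have "\<bar>(h (x + u) - h (x - u)) / u\<bar> \<le> 2 * L"
      using L0 by (cases "u = 0") (auto simp: abs_mult field_simps)
    also have "\<dots> \<le> ?W u" using True by (auto simp: indicator_def)
    finally show ?thesis .
  next
    case False
    have "\<bar>(h (x + u) - h (x - u)) / u\<bar> \<le> \<bar>h (x + u) - h (x - u)\<bar>"
      using False by (simp add: divide_le_eq) (smt (verit) mult_left_le abs_ge_zero mult_le_cancel_left1)
    also have "\<dots> \<le> \<bar>h (x + u)\<bar> + \<bar>h (x - u)\<bar>" by linarith
    also have "\<dots> \<le> ?W u" using L0 by (auto simp: indicator_def)
    finally show ?thesis .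
  qed
  have Wi: "integrable lborel ?W"
    by (intro Bochner_Integration.integrable_add integrable_mult_right ii a1)
  have W: "(LINT u|lborel. ?W u) = 4 * L + 2 * (LINT t|lborel. \<bar>h t\<bar>)"
    by (subst Bochner_Integration.integral_add)
      (auto intro!: Bochner_Integration.integrable_add integrable_mult_right ii a1 simp: a1 a2)
  have "\<bar>LINT t:{t. \<epsilon> < \<bar>t - x\<bar>}|lborel. h t / (t - x)\<bar> \<le> 2 * L + (LINT t|lborel. \<bar>h t\<bar>)" if "0 < \<epsilon>" for \<epsilon>
  proof -
    have "norm (LINT u:{u. \<epsilon> < \<bar>u - 0\<bar>}|lborel. (h (x + u) - h (x - u)) / u) \<le> (LINT u|lborel. ?W u)"
      unfolding set_lebesgue_integral_def
    proof (rule Bochner_Integration.integral_norm_bound_integral[OF _ Wi])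
      show "integrable lborel (\<lambda>u. indicator {u. \<epsilon> < \<bar>u - 0\<bar>} u *\<^sub>R ((h (x + u) - h (x - u)) / u))"
      proof (rule Bochner_Integration.integrable_bound[OF Wi])
        show "AE u in lborel. norm (indicator {u. \<epsilon> < \<bar>u - 0\<bar>} u *\<^sub>R ((h (x + u) - h (x - u)) / u)) \<le> norm (?W u)"
        proof (intro AE_I2)
          fix u
          show "norm (indicator {u. \<epsilon> < \<bar>u - 0\<bar>} u *\<^sub>R ((h (x + u) - h (x - u)) / u)) \<le> norm (?W u)"
            using w[of u] order_trans[OF abs_ge_zero w[of u]] by (cases "\<epsilon> < \<bar>u - 0\<bar>") simp_all
        qed
      qed measurable
      show "norm (indicator {u. \<epsilon> < \<bar>u - 0\<bar>} u *\<^sub>R ((h (x + u) - h (x - u)) / u)) \<le> ?W u" for u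
        using w[of u] order_trans[OF abs_ge_zero w[of u]] 
        by (cases "\<epsilon> < \<bar>u - 0\<bar>") simp_all
    qed
    then show ?thesis unfolding punctured_integral_symmetric[OF h that] W by simp
  qed
  then have "\<forall>\<^sub>F \<epsilon> in at_right 0. \<bar>LINT t:{t. \<epsilon> < \<bar>t - x\<bar>}|lborel. h t / (t - x)\<bar> \<le> 2 * L + (LINT t|lborel. \<bar>h t\<bar>)"
    by (auto simp: eventually_at_right_field intro: exI[of _ 1])
  moreover have "((\<lambda>\<epsilon>. \<bar>LINT t:{t. \<epsilon> < \<bar>t - x\<bar>}|lborel. h t / (t - x)\<bar>) \<longlongrightarrow> \<bar>I\<bar>) (at_right 0)"
    using pv unfolding has_pv_integral_def by (intro tendsto_rabs) auto
  ultimately show ?thesis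
    by (intro tendsto_upperbound) auto
qed

lemma pv_integral_eq:
  assumes "has_pv_integral f c I" shows "pv_integral f c = I"
  unfolding pv_integral_def using assms
  by (intro the_equality) (auto simp: has_pv_integral_def intro: tendsto_unique[rotated])

lemma has_pv_integral_times:
  fixes h :: "real \<Rightarrow> real"
  assumes h: "integrable lborel h" and th: "integrable lborel (\<lambda>t. t * h t)"
    and pv: "has_pv_integral (\<lambda>t. h t / (t - x)) x I"
  shows "has_pv_integral (\<lambda>t. t * h t / (t - x)) x ((LINT t|lborel. h t) + x * I)"
  unfolding has_pv_integral_def
proof (intro conjI allI impI)
  show "set_integrable lborel {t. \<epsilon> < \<bar>t - x\<bar>} (\<lambda>t. t * h t / (t - x))" if "0 < \<epsilon>" for \<epsilon>
    by (rule punctured_kernel_integrable[OF th that])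
  have m: "{t. \<epsilon> < \<bar>t - x\<bar>} \<in> sets lborel" for \<epsilon> by measurable
  have hi: "set_integrable lborel {t. \<epsilon> < \<bar>t - x\<bar>} h" for \<epsilon>
    using set_integrable_subset[of lborel UNIV h, OF _ m] h by (simp add: set_integrable_def)
  have "(LINT t:{t. \<epsilon> < \<bar>t - x\<bar>}|lborel. t * h t / (t - x))
      = (LINT t:{t. \<epsilon> < \<bar>t - x\<bar>}|lborel. h t) + x * (LINT t:{t. \<epsilon> < \<bar>t - x\<bar>}|lborel. h t / (t - x))" if "0 < \<epsilon>" for \<epsilon>
  proof -
    have "(LINT t:{t. \<epsilon> < \<bar>t - x\<bar>}|lborel. t * h t / (t - x)) = (LINT t:{t. \<epsilon> < \<bar>t - x\<bar>}|lborel. h t + x * (h t / (t - x)))"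
      using that by (intro set_lebesgue_integral_cong m) (auto simp: field_simps)
    also have "\<dots> = (LINT t:{t. \<epsilon> < \<bar>t - x\<bar>}|lborel. h t) + (LINT t:{t. \<epsilon> < \<bar>t - x\<bar>}|lborel. x * (h t / (t - x)))"
      by (intro set_integral_add hi set_integrable_mult_right impI punctured_kernel_integrable h that)
    also have "(LINT t:{t. \<epsilon> < \<bar>t - x\<bar>}|lborel. x * (h t / (t - x))) = x * (LINT t:{t. \<epsilon> < \<bar>t - x\<bar>}|lborel. h t / (t - x))"
      by (intro set_integral_mult_right)
    finally show ?thesis .
  qed
  then have "\<forall>\<^sub>F \<epsilon> in at_right 0. (LINT t:{t. \<epsilon> < \<bar>t - x\<bar>}|lborel. h t) + x * (LINT t:{t. \<epsilon> < \<bar>t - x\<bar>}|lborel. h t / (t - x))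
      = (LINT t:{t. \<epsilon> < \<bar>t - x\<bar>}|lborel. t * h t / (t - x))"
    by (auto simp: eventually_at_right_field intro: exI[of _ 1])
  moreover have "((\<lambda>\<epsilon>. (LINT t:{t. \<epsilon> < \<bar>t - x\<bar>}|lborel. h t) + x * (LINT t:{t. \<epsilon> < \<bar>t - x\<bar>}|lborel. h t / (t - x)))
      \<longlongrightarrow> (LINT t|lborel. h t) + x * I) (at_right 0)"
    using pv unfolding has_pv_integral_def by (intro tendsto_intros LINT_punctured_tendsto h) auto
  ultimately show "((\<lambda>\<epsilon>. LINT t:{t. \<epsilon> < \<bar>t - x\<bar>}|lborel. t * h t / (t - x)) \<longlongrightarrow> (LINT t|lborel. h t) + x * I) (at_right 0)"
    by (rule Lim_transform_eventually[rotated])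
qed

lemma has_pv_integral_lincomb:
  assumes f: "has_pv_integral f c I" and g: "has_pv_integral g c J"
  shows "has_pv_integral (\<lambda>t. a * f t - b * g t) c (a * I - b * J)"
  unfolding has_pv_integral_def
proof (intro conjI allI impI)
  have fi: "set_integrable lborel {t. \<epsilon> < \<bar>t - c\<bar>} f" and gi: "set_integrable lborel {t. \<epsilon> < \<bar>t - c\<bar>} g" if "0 < \<epsilon>" for \<epsilon>
    using f g that unfolding has_pv_integral_def by blast+
  show "set_integrable lborel {t. \<epsilon> < \<bar>t - c\<bar>} (\<lambda>t. a * f t - b * g t)" if "0 < \<epsilon>" for \<epsilon>
    by (intro set_integral_diff set_integrable_mult_right impI fi gi that)
  have "\<forall>\<^sub>F \<epsilon> in at_right 0. a * (LINT t:{t. \<epsilon> < \<bar>t - c\<bar>}|lborel. f t) - b * (LINT t:{t. \<epsilon> < \<bar>t - c\<bar>}|lborel. g t)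
      = (LINT t:{t. \<epsilon> < \<bar>t - c\<bar>}|lborel. a * f t - b * g t)"
    unfolding eventually_at_right_field
    by (intro exI[of _ 1]) (simp add: set_integral_diff fi gi set_integrable_mult_right)
  moreover have "((\<lambda>\<epsilon>. a * (LINT t:{t. \<epsilon> < \<bar>t - c\<bar>}|lborel. f t) - b * (LINT t:{t. \<epsilon> < \<bar>t - c\<bar>}|lborel. g t)) \<longlongrightarrow> a * I - b * J) (at_right 0)"
    using f g unfolding has_pv_integral_def by (intro tendsto_intros) auto
  ultimately show "((\<lambda>\<epsilon>. LINT t:{t. \<epsilon> < \<bar>t - c\<bar>}|lborel. a * f t - b * g t) \<longlongrightarrow> a * I - b * J) (at_right 0)"
    by (rule Lim_transform_eventually[rotated])
qed

section \<open>The principal value for the Gaussian\<close>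

lemma LINT_Icc_derivative:
  fixes F f :: "real \<Rightarrow> real"
  assumes "\<And>s. (F has_real_derivative f s) (at s)" "\<And>s. isCont f s" "a \<le> b"
  shows "set_integrable lborel {a..b} f" "(LINT s:{a..b}|lborel. f s) = F b - F a"
proof -
  show "set_integrable lborel {a..b} f"
    by (intro borel_integrable_atLeastAtMost' continuous_at_imp_continuous_on ballI assms(2))
  show "(LINT s:{a..b}|lborel. f s) = F b - F a"
    unfolding set_lebesgue_integral_def
    using has_field_derivative_at_within[OF assms(1)] assms(2,3)
    by (intro integral_FTC_Icc)
      (auto intro!: continuous_at_imp_continuous_on simp flip: has_real_derivative_iff_has_vector_derivative)
qed

lemma kummer_half_integral: "(LINT s:{0..1}|lborel. exp (z * s\<^sup>2)) = kummer (1/2) (3/2) z"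
proof -
  have "((\<lambda>s. s * kummer (1/2) (3/2) (z * s\<^sup>2)) has_real_derivative exp (z * s\<^sup>2)) (at s)" for s
  proof -
    have "((\<lambda>s. z * s\<^sup>2) has_real_derivative z * (2 * s)) (at s)"
      by (auto intro!: derivative_eq_intros)
    from DERIV_mult[OF DERIV_ident DERIV_chain2[OF kummer_DERIV[where a = "1/2" and c = "3/2"] this]]
    show ?thesis
      using kummer_half_exp[of "z * s\<^sup>2"] by (simp add: algebra_simps power2_eq_square)
  qed
  from LINT_Icc_derivative(2)[OF this, of 0 1] show ?thesis by simp
qed

text \<open>Completing the square: the integrand is a multiple of the normal density with mean
  c.\<close>

lemma gaussian_exp_integral:
  "has_bochner_integral lborel (\<lambda>u. exp (- u\<^sup>2 / 2) * exp (c * u)) (sqrt (2 * pi) * exp (c\<^sup>2 / 2))"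
proof -
  have "has_bochner_integral lborel (normal_density c 1) 1"
    by (simp add: has_bochner_integral_iff)
  from has_bochner_integral_mult_right[OF this, of "sqrt (2 * pi) * exp (c\<^sup>2 / 2)"]
  have "has_bochner_integral lborel (\<lambda>u. sqrt (2 * pi) * exp (c\<^sup>2 / 2) * normal_density c 1 u) (sqrt (2 * pi) * exp (c\<^sup>2 / 2))"
    by simp
  moreover have "sqrt (2 * pi) * exp (c\<^sup>2 / 2) * normal_density c 1 u = exp (- u\<^sup>2 / 2) * exp (c * u)" for u
    unfolding normal_density_def
    by (simp add: exp_add[symmetric] power2_diff field_simps)
  ultimately show ?thesis by simp
qed

lemma gaussian_cosh_integral:
  "has_bochner_integral lborel (\<lambda>u. exp (- u\<^sup>2 / 2) * cosh (c * u)) (sqrt (2 * pi) * exp (c\<^sup>2 / 2))"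
proof -
  have "has_bochner_integral lborel (\<lambda>u. (exp (- u\<^sup>2 / 2) * exp (c * u) + exp (- u\<^sup>2 / 2) * exp (- c * u)) / 2)
      ((sqrt (2 * pi) * exp (c\<^sup>2 / 2) + sqrt (2 * pi) * exp ((- c)\<^sup>2 / 2)) / 2)"
    by (intro has_bochner_integral_divide has_bochner_integral_add gaussian_exp_integral)
  moreover have "(exp (- u\<^sup>2 / 2) * exp (c * u) + exp (- u\<^sup>2 / 2) * exp (- c * u)) / 2 = exp (- u\<^sup>2 / 2) * cosh (c * u)" for u
    by (simp add: cosh_def algebra_simps add_divide_distrib)
  ultimately show ?thesis by simp
qed

text \<open>Since sinh (x u) / u is x times the integral of cosh (x s u) over s in [0, 1], Fubini
  reduces the claim to Gaussian cosh integrals and then to the integral representation of the Kummer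
  function.\<close>

lemma gaussian_sinh_integral:
  shows "integrable lborel (\<lambda>u. exp (- u\<^sup>2 / 2) * (sinh (x * u) / u))"
    and "(LINT u|lborel. exp (- u\<^sup>2 / 2) * (sinh (x * u) / u)) = sqrt (2 * pi) * (x * kummer (1/2) (3/2) (x\<^sup>2 / 2))"
proof -
  define f :: "real \<times> real \<Rightarrow> real" where
    "f = (\<lambda>(s, u). indicator {0..1} s * (exp (- u\<^sup>2 / 2) * cosh (x * s * u)))"
  have [measurable]: "f \<in> borel_measurable (lborel \<Otimes>\<^sub>M lborel)"
    unfolding f_def cosh_def by measurable
  have inner: "has_bochner_integral lborel (\<lambda>u. f (s, u)) (indicator {0..1} s * (sqrt (2 * pi) * exp ((x * s)\<^sup>2 / 2)))" for s
    unfolding f_def prod.case by (intro has_bochner_integral_mult_right gaussian_cosh_integral)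
  have nn: "norm (f p) = f p" for p
    by (auto simp: f_def split: prod.split)
  have ei: "set_integrable lborel {0..1} (\<lambda>s. exp (x\<^sup>2 / 2 * s\<^sup>2))"
    by (intro borel_integrable_atLeastAtMost' continuous_intros)
  have e: "exp ((x * s)\<^sup>2 / 2) = exp (x\<^sup>2 / 2 * s\<^sup>2)" for s by (simp add: power_mult_distrib)
  have fi: "integrable (lborel \<Otimes>\<^sub>M lborel) f"
  proof (rule lborel_pair.Fubini_integrable)
    show "integrable lborel (\<lambda>s. LINT u|lborel. norm (f (s, u)))"
    proof -
      have "integrable lborel (\<lambda>s. sqrt (2 * pi) * (indicator {0..1} s *\<^sub>R exp (x\<^sup>2 / 2 * s\<^sup>2)))"
        by (intro integrable_mult_right ei[unfolded set_integrable_def])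
      then show ?thesis
        unfolding nn has_bochner_integral_integral_eq[OF inner] e by (simp add: mult_ac)
    qed
    show "AE s in lborel. integrable lborel (\<lambda>u. f (s, u))"
      using inner by (auto intro: integrable.intros)
  qed measurable
  have outer: "(LINT s|lborel. f (s, u)) = exp (- u\<^sup>2 / 2) * (sinh (x * u) / (x * u))" if "x \<noteq> 0" "u \<noteq> 0" for u
  proof -
    have "((\<lambda>s. sinh (x * s * u) / (x * u)) has_real_derivative cosh (x * s * u)) (at s)" for s
      using that by (auto intro!: derivative_eq_intros)
    moreover have "isCont (\<lambda>s. cosh (x * s * u)) s" for s
      unfolding cosh_def by (intro continuous_intros)
    ultimately have "(LINT s:{0..1}|lborel. cosh (x * s * u)) = sinh (x * u) / (x * u)"
      using LINT_Icc_derivative(2)[of "\<lambda>s. sinh (x * s * u) / (x * u)" "\<lambda>s. cosh (x * s * u)" 0 1] by simp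
    then have "exp (- u\<^sup>2 / 2) * (LINT s|lborel. indicator {0..1} s * cosh (x * s * u)) = exp (- u\<^sup>2 / 2) * (sinh (x * u) / (x * u))"
      by (simp add: set_lebesgue_integral_def)
    then show ?thesis
      unfolding f_def by (simp flip: integral_mult_right_zero add: mult.left_commute)
  qed
  have "integrable lborel (\<lambda>u. exp (- u\<^sup>2 / 2) * (sinh (x * u) / u)) \<and>
     (LINT u|lborel. exp (- u\<^sup>2 / 2) * (sinh (x * u) / u)) = sqrt (2 * pi) * (x * kummer (1/2) (3/2) (x\<^sup>2 / 2))"
  proof (cases "x = 0")
    case False
    \<comment> \<open>At u = 0 the left side is x, while division by zero makes the right side 0;
      that point is a null set.\<close>
    have ae: "AE u in lborel. x * (LINT s|lborel. f (s, u)) = exp (- u\<^sup>2 / 2) * (sinh (x * u) / u)"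
      using AE_lborel_singleton[of 0] by eventually_elim (use False in \<open>simp add: outer\<close>)
    have oi: "integrable lborel (\<lambda>u. x * (LINT s|lborel. f (s, u)))"
      by (intro integrable_mult_right lborel_pair.integrable_snd) (use fi in \<open>simp add: split_beta\<close>)
    have mm: "(\<lambda>u. exp (- u\<^sup>2 / 2) * (sinh (x * u) / u)) \<in> borel_measurable lborel"
      unfolding sinh_def by measurable
    have 1: "integrable lborel (\<lambda>u. exp (- u\<^sup>2 / 2) * (sinh (x * u) / u))"
      using oi by (rule integrable_cong_AE_imp) (use ae mm in auto)
    have "(LINT u|lborel. exp (- u\<^sup>2 / 2) * (sinh (x * u) / u)) = (LINT u|lborel. x * (LINT s|lborel. f (s, u)))"
      by (intro integral_cong_AE) (use ae oi mm in auto)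
    also have "\<dots> = x * (LINT s|lborel. LINT u|lborel. f (s, u))"
      using lborel_pair.Fubini_integral[of "\<lambda>s u. f (s, u)"] fi by (simp add: split_beta)
    also have "(LINT s|lborel. LINT u|lborel. f (s, u)) = (LINT s|lborel. sqrt (2 * pi) * (indicator {0..1} s * exp (x\<^sup>2 / 2 * s\<^sup>2)))"
      unfolding has_bochner_integral_integral_eq[OF inner] e by (simp add: mult_ac)
    also have "\<dots> = sqrt (2 * pi) * kummer (1/2) (3/2) (x\<^sup>2 / 2)"
      unfolding kummer_half_integral[symmetric] by (simp add: set_lebesgue_integral_def)
    finally show ?thesis using 1 by simp
  qed simp
  then show "integrable lborel (\<lambda>u. exp (- u\<^sup>2 / 2) * (sinh (x * u) / u))"
    and "(LINT u|lborel. exp (- u\<^sup>2 / 2) * (sinh (x * u) / u)) = sqrt (2 * pi) * (x * kummer (1/2) (3/2) (x\<^sup>2 / 2))"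
    by blast+
qed

text \<open>Symmetrization turns the difference of the two shifted Gaussians into - 2 exp (-x^2 / 2)
  exp (-u^2 / 2) sinh (x u), so the quotient by u is absolutely integrable and the limit is an
  ordinary integral.\<close>

lemma has_pv_integral_gaussian:
  "has_pv_integral (\<lambda>t. exp (- t\<^sup>2 / 2) / (t - x)) x (- (sqrt (2 * pi) * kummer_sin 0 x))"
  unfolding has_pv_integral_def
proof (intro conjI allI impI)
  have h: "integrable lborel (\<lambda>t::real. exp (- t\<^sup>2 / 2))"
    using gauss_poly_integrable[of 1] by (simp add: gauss_poly_def[abs_def])
  show "set_integrable lborel {t. \<epsilon> < \<bar>t - x\<bar>} (\<lambda>t. exp (- t\<^sup>2 / 2) / (t - x))" if "0 < \<epsilon>" for \<epsilon>
    by (rule punctured_kernel_integrable[OF h that])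
  have c: "(exp (- (x + u)\<^sup>2 / 2) - exp (- (x - u)\<^sup>2 / 2)) / u
      = - 2 * exp (- x\<^sup>2 / 2) * (exp (- u\<^sup>2 / 2) * (sinh (x * u) / u))" for u
  proof -
    have "exp (- (x + u)\<^sup>2 / 2) = exp (- x\<^sup>2 / 2) * exp (- u\<^sup>2 / 2) * exp (- (x * u))"
      "exp (- (x - u)\<^sup>2 / 2) = exp (- x\<^sup>2 / 2) * exp (- u\<^sup>2 / 2) * exp (x * u)"
      by (simp_all add: exp_add[symmetric] power2_eq_square field_simps)
    then show ?thesis unfolding sinh_def by (cases "u = 0") (simp_all add: field_simps)
  qed
  have "\<forall>\<^sub>F \<epsilon> in at_right 0. - exp (- x\<^sup>2 / 2) * (LINT u:{u. \<epsilon> < \<bar>u - 0\<bar>}|lborel. exp (- u\<^sup>2 / 2) * (sinh (x * u) / u))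
      = (LINT t:{t. \<epsilon> < \<bar>t - x\<bar>}|lborel. exp (- t\<^sup>2 / 2) / (t - x))"
    unfolding eventually_at_right_field
  proof (intro exI[of _ 1] conjI allI impI)
    fix \<epsilon> :: real assume "0 < \<epsilon>"
    show "- exp (- x\<^sup>2 / 2) * (LINT u:{u. \<epsilon> < \<bar>u - 0\<bar>}|lborel. exp (- u\<^sup>2 / 2) * (sinh (x * u) / u))
      = (LINT t:{t. \<epsilon> < \<bar>t - x\<bar>}|lborel. exp (- t\<^sup>2 / 2) / (t - x))"
      unfolding punctured_integral_symmetric[OF h \<open>0 < \<epsilon>\<close>] c set_integral_mult_right by simp
  qed simp
  moreover have "((\<lambda>\<epsilon>. - exp (- x\<^sup>2 / 2) * (LINT u:{u. \<epsilon> < \<bar>u - 0\<bar>}|lborel. exp (- u\<^sup>2 / 2) * (sinh (x * u) / u)))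
     \<longlongrightarrow> - exp (- x\<^sup>2 / 2) * (LINT u|lborel. exp (- u\<^sup>2 / 2) * (sinh (x * u) / u))) (at_right 0)"
    by (intro tendsto_intros LINT_punctured_tendsto gaussian_sinh_integral(1))
  ultimately have "((\<lambda>\<epsilon>. LINT t:{t. \<epsilon> < \<bar>t - x\<bar>}|lborel. exp (- t\<^sup>2 / 2) / (t - x))
     \<longlongrightarrow> - exp (- x\<^sup>2 / 2) * (LINT u|lborel. exp (- u\<^sup>2 / 2) * (sinh (x * u) / u))) (at_right 0)"
    by (rule Lim_transform_eventually[rotated])
  then show "((\<lambda>\<epsilon>. LINT t:{t. \<epsilon> < \<bar>t - x\<bar>}|lborel. exp (- t\<^sup>2 / 2) / (t - x))
     \<longlongrightarrow> - (sqrt (2 * pi) * kummer_sin 0 x)) (at_right 0)"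
    unfolding gaussian_sinh_integral(2) kummer_sin_def by (simp add: algebra_simps)
qed

lemma has_pv_integral_hermite:
  "has_pv_integral (\<lambda>t. hermite_fun_rec n t / (t - x)) x (pi * conj_hermite n x)"
proof (induction n rule: less_induct)
  case (less n)
  show ?case
  proof (cases n)
    case 0
    have "conj_hermite 0 x = - (sqrt 2 / sqrt pi) * kummer_sin 0 x"
      by (rule conj_hermite_0)
    moreover have "pi * (sqrt 2 / sqrt pi) = sqrt 2 * sqrt pi"
      by (metis real_div_sqrt mult.commute pi_ge_zero times_divide_eq_left)
    moreover have "pi * (- c * y) = - (pi * c * y)" for c y by simp
    ultimately have "pi * conj_hermite 0 x = - (sqrt (2 * pi) * kummer_sin 0 x)"
      by (simp only: real_sqrt_mult)
    then show ?thesis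
      using has_pv_integral_gaussian[of x] 0 by (simp add: gauss_poly_def)
  next
    case (Suc m)
    have ti: "integrable lborel (\<lambda>t. t * hermite_fun_rec m t)"
      using gauss_poly_integrable[of "[:0,1:] * hermite_rec m"] by (simp add: gauss_poly_mult[abs_def] del: mult_pCons_left)
    have "has_pv_integral (\<lambda>t. 2 * (t * hermite_fun_rec m t / (t - x)) - 2 * real m * (hermite_fun_rec (m - 1) t / (t - x))) x
       (2 * ((LINT t|lborel. hermite_fun_rec m t) + x * (pi * conj_hermite m x)) - 2 * real m * (pi * conj_hermite (m - 1) x))"
      using Suc by (intro has_pv_integral_lincomb has_pv_integral_times gauss_poly_integrable ti less) auto
    moreover have "2 * (t * hermite_fun_rec m t / (t - x)) - 2 * real m * (hermite_fun_rec (m - 1) t / (t - x))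
        = hermite_fun_rec n t / (t - x)" for t
    proof -
      have "2 * (t * hermite_fun_rec m t / (t - x)) - 2 * real m * (hermite_fun_rec (m - 1) t / (t - x))
          = (2 * (t * hermite_fun_rec m t) - 2 * real m * hermite_fun_rec (m - 1) t) / (t - x)"
        by (simp add: diff_divide_distrib)
      also have "2 * (t * hermite_fun_rec m t) - 2 * real m * hermite_fun_rec (m - 1) t = hermite_fun_rec n t"
        unfolding hermite_fun_rec_times Suc by (simp add: algebra_simps)
      finally show ?thesis .
    qed
    moreover have "2 * ((LINT t|lborel. hermite_fun_rec m t) + x * (pi * conj_hermite m x)) - 2 * real m * (pi * conj_hermite (m - 1) x)
        = pi * conj_hermite n x"
    proof -
      have "(LINT t|lborel. hermite_fun_rec m t) = pi * hermite_mass m" by (simp add: hermite_mass_def)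
      moreover have "x * (pi * conj_hermite m x) = pi * (x * conj_hermite m x)" by simp
      ultimately show ?thesis
        unfolding conj_hermite_times Suc by (simp add: algebra_simps)
    qed
    ultimately show ?thesis by simp
  qed
qed

lemma G_eq: "G n = conj_hermite n"
  by (simp add: fun_eq_iff G_def hilbert_transform_def hermite_fun_eq pv_integral_eq[OF has_pv_integral_hermite])

section \<open>Decay of the transforms\<close>

lemma gauss_poly_lipschitz: "\<exists>L. \<forall>a b. \<bar>gauss_poly p a - gauss_poly p b\<bar> \<le> L * \<bar>a - b\<bar>"
proof -
  obtain L where L: "\<And>x. \<bar>gauss_poly (pderiv p - [:0,1:] * p) x\<bar> \<le> L"
    using gauss_poly_bounded by blast
  have "norm (gauss_poly p a - gauss_poly p b) \<le> L * norm (a - b)" for a b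
  proof (rule field_differentiable_bound[of UNIV])
    show "(gauss_poly p has_field_derivative gauss_poly (pderiv p - [:0,1:] * p) x) (at x within UNIV)" for x
      by (rule gauss_poly_DERIV)
  qed (use L in auto)
  then show ?thesis by auto
qed

lemma conj_hermite_bounded: "\<exists>K. \<forall>x. \<bar>conj_hermite n x\<bar> \<le> K"
proof -
  obtain L where "\<And>a b. \<bar>hermite_fun_rec n a - hermite_fun_rec n b\<bar> \<le> L * \<bar>a - b\<bar>"
    using gauss_poly_lipschitz by blast
  then have "\<bar>pi * conj_hermite n x\<bar> \<le> 2 * L + (LINT t|lborel. \<bar>hermite_fun_rec n t\<bar>)" for x
    by (rule pv_bounded[OF gauss_poly_integrable _ has_pv_integral_hermite])
  then have "\<bar>conj_hermite n x\<bar> \<le> (2 * L + (LINT t|lborel. \<bar>hermite_fun_rec n t\<bar>)) / pi" for x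
    by (simp add: abs_mult field_simps)
  then show ?thesis by blast
qed

text \<open>By \<open>conj_hermite_times\<close>, x G_n is a combination of bounded functions and a
  constant.\<close>

lemma conj_hermite_times_bounded: "\<exists>K. \<forall>x. \<bar>x * conj_hermite n x\<bar> \<le> K"
proof -
  obtain K where K: "\<And>n x. \<bar>conj_hermite n x\<bar> \<le> K n"
    using conj_hermite_bounded by metis
  have "\<bar>x * conj_hermite n x\<bar> \<le> real n * K (n - 1) + K (Suc n) / 2 + \<bar>hermite_mass n\<bar>" for x
  proof -
    have "\<bar>real n * conj_hermite (n - 1) x\<bar> \<le> real n * K (n - 1)"
      by (simp add: abs_mult K mult_left_mono)
    then show ?thesis unfolding conj_hermite_times using K[of "Suc n" x] by linarith
  qed
  then show ?thesis by blast
qed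

lemma conj_hermite_decay1: "decay1 (conj_hermite n)"
  using conj_hermite_bounded[of n] conj_hermite_times_bounded[of n] by (auto intro: decay1_I)

text \<open>For odd n the constant is zero, so the relation may be multiplied by x once more and
  each term on the right stays bounded.\<close>

lemma conj_hermite_decay2:
  assumes "odd n" shows "decay2 (conj_hermite n)"
proof -
  obtain K where K: "\<And>n x. \<bar>x * conj_hermite n x\<bar> \<le> K n"
    using conj_hermite_times_bounded by metis
  have "\<bar>x\<^sup>2 * conj_hermite n x\<bar> \<le> real n * K (n - 1) + K (Suc n) / 2" for x
  proof -
    have "x\<^sup>2 * conj_hermite n x = x * (x * conj_hermite n x)" by (simp add: power2_eq_square)
    also have "\<dots> = real n * (x * conj_hermite (n - 1) x) + x * conj_hermite (Suc n) x / 2"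
      unfolding conj_hermite_times[of x n] hermite_mass_odd[OF assms] by (simp add: algebra_simps)
    finally have e: "x\<^sup>2 * conj_hermite n x = real n * (x * conj_hermite (n - 1) x) + x * conj_hermite (Suc n) x / 2" .
    have "\<bar>real n * (x * conj_hermite (n - 1) x)\<bar> \<le> real n * K (n - 1)"
      using K by (simp add: abs_mult mult_left_mono)
    then show ?thesis unfolding e using K[where n = "Suc n" and x = x] by linarith
  qed
  moreover obtain L where "\<And>x. \<bar>conj_hermite n x\<bar> \<le> L" using conj_hermite_bounded by blast
  ultimately show ?thesis by (intro decay2_I)
qed


subsection \<open>Inner products\<close>

lemma gaussian_second_moment:
  assumes "0 < c"
  shows "has_bochner_integral lborel (\<lambda>x. x\<^sup>2 * exp (- x\<^sup>2 * c / 2)) (sqrt (2 * pi) / (c * sqrt c))"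
proof -
  have "has_bochner_integral lborel (\<lambda>x. normal_density 0 (1 / sqrt c) x * (x - 0) ^ (2 * 1))
      (fact (2 * 1) / ((2 / (1 / sqrt c)\<^sup>2) ^ 1 * fact 1))"
    using assms by (intro normal_moment_even) simp
  from has_bochner_integral_mult_right[OF this, of "sqrt (2 * pi / c)"]
  have "has_bochner_integral lborel (\<lambda>x. sqrt (2 * pi / c) * (normal_density 0 (1 / sqrt c) x * x\<^sup>2)) (sqrt (2 * pi / c) * (1 / c))"
    using assms by (simp add: power_divide fact_numeral)
  moreover have "sqrt (2 * pi / c) * (normal_density 0 (1 / sqrt c) x * x\<^sup>2) = x\<^sup>2 * exp (- x\<^sup>2 * c / 2)" for x
    using assms unfolding normal_density_def by (simp add: power_divide real_sqrt_divide field_simps)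
  moreover have "sqrt (2 * pi / c) * (1 / c) = sqrt (2 * pi) / (c * sqrt c)"
    by (simp add: real_sqrt_divide)
  ultimately show ?thesis by simp
qed

text \<open>The integral representation with exp (-x^2 / 2) absorbed into the exponent, in extended
  nonnegative form so that Tonelli applies to the square before its integrability is known.\<close>

lemma ennreal_kummer_sin_0:
  "ennreal \<bar>kummer_sin 0 x\<bar> = (\<integral>\<^sup>+s. indicator {0..1} s * ennreal (\<bar>x\<bar> * exp (x\<^sup>2 * (s\<^sup>2 - 1) / 2)) \<partial>lborel)"
proof -
  have i: "set_integrable lborel {0..1} (\<lambda>s. exp (x\<^sup>2 / 2 * s\<^sup>2))"
    by (intro borel_integrable_atLeastAtMost' continuous_intros)
  have "\<bar>kummer_sin 0 x\<bar> = \<bar>x\<bar> * exp (- x\<^sup>2 / 2) * (LINT s:{0..1}|lborel. exp (x\<^sup>2 / 2 * s\<^sup>2))"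
  proof -
    have "0 \<le> (LINT s:{0..1}|lborel. exp (x\<^sup>2 / 2 * s\<^sup>2))"
      unfolding set_lebesgue_integral_def by (intro Bochner_Integration.integral_nonneg) auto
    then have "\<bar>kummer (1/2) (3/2) (x\<^sup>2 / 2)\<bar> = (LINT s:{0..1}|lborel. exp (x\<^sup>2 / 2 * s\<^sup>2))"
      unfolding kummer_half_integral by simp
    then show ?thesis by (simp add: kummer_sin_def abs_mult)
  qed
  also have "\<dots> = (LINT s|lborel. \<bar>x\<bar> * exp (- x\<^sup>2 / 2) * (indicator {0..1} s *\<^sub>R exp (x\<^sup>2 / 2 * s\<^sup>2)))"
    by (simp add: set_lebesgue_integral_def)
  finally have "ennreal \<bar>kummer_sin 0 x\<bar>
      = (\<integral>\<^sup>+s. ennreal (\<bar>x\<bar> * exp (- x\<^sup>2 / 2) * (indicator {0..1} s *\<^sub>R exp (x\<^sup>2 / 2 * s\<^sup>2))) \<partial>lborel)"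
    using i by (subst nn_integral_eq_integral) (auto simp: set_integrable_def)
  also have "\<dots> = (\<integral>\<^sup>+s. indicator {0..1} s * ennreal (\<bar>x\<bar> * exp (x\<^sup>2 * (s\<^sup>2 - 1) / 2)) \<partial>lborel)"
  proof (intro nn_integral_cong)
    fix s
    have "exp (x\<^sup>2 * (s\<^sup>2 - 1) / 2) = exp (- x\<^sup>2 / 2) * exp (x\<^sup>2 / 2 * s\<^sup>2)"
      by (simp add: exp_add[symmetric] field_simps)
    then show "ennreal (\<bar>x\<bar> * exp (- x\<^sup>2 / 2) * (indicator {0..1} s *\<^sub>R exp (x\<^sup>2 / 2 * s\<^sup>2)))
        = indicator {0..1} s * ennreal (\<bar>x\<bar> * exp (x\<^sup>2 * (s\<^sup>2 - 1) / 2))"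
      by (simp add: indicator_def)
  qed
  finally show ?thesis .
qed

text \<open>With a = 2 - s^2, an antiderivative in r is r / (a sqrt (a - r^2)). The condition s < 1
  keeps the radicand positive up to r = 1, where it equals 1 - s^2.\<close>

lemma nn_integral_inner_radical:
  assumes "0 \<le> s" "s < 1"
  shows "(\<integral>\<^sup>+r. indicator {0..1} r * ennreal (1 / ((2 - s\<^sup>2 - r\<^sup>2) * sqrt (2 - s\<^sup>2 - r\<^sup>2))) \<partial>lborel)
    = ennreal (1 / ((2 - s\<^sup>2) * sqrt (1 - s\<^sup>2)))"
proof -
  define a where "a = 2 - s\<^sup>2"
  have s1: "s\<^sup>2 < 1" using assms by (simp add: power_less_one_iff abs_square_less_1)
  have r: "0 < a - r\<^sup>2" if "0 \<le> r" "r \<le> 1" for r :: real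
  proof -
    have "r\<^sup>2 \<le> 1" using that by (simp add: power_le_one)
    then show ?thesis using s1 by (simp add: a_def)
  qed
  have "(\<integral>\<^sup>+r. ennreal (1 / ((a - r\<^sup>2) * sqrt (a - r\<^sup>2))) * indicator {0..1} r \<partial>lborel)
     = ennreal (1 / (a * sqrt (a - 1\<^sup>2)) - 0 / (a * sqrt (a - 0\<^sup>2)))"
  proof (rule nn_integral_FTC_Icc[where F = "\<lambda>x. x / (a * sqrt (a - x\<^sup>2))"])
    fix x :: real assume x: "x \<in> {0..1}"
    then have p: "0 < a - x\<^sup>2" using r by simp
    have a0: "a > 0" using s1 by (simp add: a_def)
    have q: "sqrt (a - x\<^sup>2) > 0" "sqrt (a - x\<^sup>2) * sqrt (a - x\<^sup>2) = a - x\<^sup>2" using p by auto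
    have "((\<lambda>x. x / (a * sqrt (a - x\<^sup>2))) has_real_derivative
        (1 * (a * sqrt (a - x\<^sup>2)) - x * (a * (- (2 * x) * (inverse (sqrt (a - x\<^sup>2)) / 2)))) / ((a * sqrt (a - x\<^sup>2)) * (a * sqrt (a - x\<^sup>2)))) (at x)"
      using p q a0 by (auto intro!: derivative_eq_intros)
    also have "(1 * (a * sqrt (a - x\<^sup>2)) - x * (a * (- (2 * x) * (inverse (sqrt (a - x\<^sup>2)) / 2)))) / ((a * sqrt (a - x\<^sup>2)) * (a * sqrt (a - x\<^sup>2)))
       = 1 / ((a - x\<^sup>2) * sqrt (a - x\<^sup>2))"
    proof -
      define t where "t = sqrt (a - x\<^sup>2)"
      have t: "t > 0" "a - x\<^sup>2 = t * t" "a = t * t + x * x" using q by (auto simp: t_def power2_eq_square)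
      have "(1 * (a * t) - x * (a * (- (2 * x) * (inverse t / 2)))) / ((a * t) * (a * t)) = 1 / (t * t * t)"
        using t(1) a0 unfolding divide_inverse[symmetric]
        by (simp add: divide_simps) (simp add: t(3) algebra_simps)
      then show ?thesis unfolding t_def q(2) .
    qed
    finally show "((\<lambda>x. x / (a * sqrt (a - x\<^sup>2))) has_real_derivative 1 / ((a - x\<^sup>2) * sqrt (a - x\<^sup>2))) (at x)" .
    show "0 \<le> 1 / ((a - x\<^sup>2) * sqrt (a - x\<^sup>2))" using p by simp
  qed (simp_all, measurable)
  then show ?thesis by (simp add: a_def mult.commute)
qed

text \<open>Substituting s = sin \<theta> and then \<tau> = tan \<theta> gives the integrand 1 / (2
  + \<tau>^2), which explains the antiderivative \<open>?F\<close>. Its argument tends to infinity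
  as s approaches 1, so the improper integral is (pi / 2) / sqrt 2.\<close>

lemma arctan_integral:
  "(\<integral>\<^sup>+s. indicator {0<..<1} s * ennreal (1 / ((2 - s\<^sup>2) * sqrt (1 - s\<^sup>2))) \<partial>lborel) = ennreal (pi / (2 * sqrt 2))"
proof -
  let ?f = "\<lambda>s::real. 1 / ((2 - s\<^sup>2) * sqrt (1 - s\<^sup>2))"
  let ?F = "\<lambda>s. arctan (s / (sqrt 2 * sqrt (1 - s\<^sup>2))) / sqrt 2"
  have s1: "0 < 1 - s\<^sup>2" if "0 < s" "s < 1" for s :: real
    using that by (simp add: power_less_one_iff abs_square_less_1)
  have d: "(?F has_real_derivative ?f s) (at s)" if "0 < s" "s < 1" for s
  proof -
    define t where "t = sqrt (1 - s\<^sup>2)"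
    have t: "t > 0" "s * s = 1 - t * t" using s1[OF that] by (auto simp: t_def power2_eq_square)
    have "((\<lambda>s. s / (sqrt 2 * sqrt (1 - s\<^sup>2))) has_real_derivative
       (1 * (sqrt 2 * t) - s * (sqrt 2 * (- (2 * s) * (inverse t / 2)))) / ((sqrt 2 * t) * (sqrt 2 * t))) (at s)"
      using s1[OF that] unfolding t_def by (auto intro!: derivative_eq_intros)
    from DERIV_cdivide[OF DERIV_chain2[OF DERIV_arctan this], of "sqrt 2"]
    have "(?F has_real_derivative
       inverse (1 + (s / (sqrt 2 * t))\<^sup>2) * ((1 * (sqrt 2 * t) - s * (sqrt 2 * (- (2 * s) * (inverse t / 2)))) / ((sqrt 2 * t) * (sqrt 2 * t))) / sqrt 2) (at s)"
      by (simp add: t_def)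
    also have "inverse (1 + (s / (sqrt 2 * t))\<^sup>2) * ((1 * (sqrt 2 * t) - s * (sqrt 2 * (- (2 * s) * (inverse t / 2)))) / ((sqrt 2 * t) * (sqrt 2 * t))) / sqrt 2
       = ?f s"
    proof -
      have e1: "1 + (s / (sqrt 2 * t))\<^sup>2 = (2 - s\<^sup>2) / (2 * (t * t))"
        using t by (simp add: power2_eq_square field_simps)
      have e2: "(1 * (sqrt 2 * t) - s * (sqrt 2 * (- (2 * s) * (inverse t / 2)))) = sqrt 2 / t"
      proof -
        have "(1 * (sqrt 2 * t) - s * (sqrt 2 * (- (2 * s) * (inverse t / 2)))) = sqrt 2 * (t * t + s * s) / t"
          using t(1) by (simp add: field_simps)
        then show ?thesis using t(2) by simp
      qed
      have "2 - s\<^sup>2 > 0" using s1[OF that] by simp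
      then show ?thesis
        unfolding e1 e2 t_def[symmetric] using t(1) by (simp add: field_simps)
    qed
    finally show ?thesis .
  qed
  have nz: "(2 - s\<^sup>2) * sqrt (1 - s\<^sup>2) \<noteq> 0" if "0 < s" "s < 1" for s using s1[OF that] by auto
  have lim0: "((?F \<circ> real_of_ereal) \<longlongrightarrow> 0) (at_right (ereal 0))"
  proof -
    have "isCont ?F 0" by (intro continuous_intros) auto
    then have "(?F \<longlongrightarrow> 0) (at_right 0)"
      unfolding isCont_def using filterlim_at_split by fastforce
    then show ?thesis by (simp add: ereal_tendsto_simps)
  qed
  have lim1: "((?F \<circ> real_of_ereal) \<longlongrightarrow> (pi / 2) / sqrt 2) (at_left (ereal 1))"
  proof -
    have "((\<lambda>s::real. sqrt 2 * sqrt (1 - s\<^sup>2)) \<longlongrightarrow> sqrt 2 * sqrt (1 - 1\<^sup>2)) (at_left 1)"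
      by (intro tendsto_intros)
    moreover have "\<forall>\<^sub>F s::real in at_left 1. 0 < sqrt 2 * sqrt (1 - s\<^sup>2)"
      using s1 by (auto simp: eventually_at_left_field intro!: exI[of _ 0])
    ultimately have "filterlim (\<lambda>s::real. sqrt 2 * sqrt (1 - s\<^sup>2)) (at_right 0) (at_left 1)"
      unfolding filterlim_at by (auto elim: eventually_mono)
    then have "filterlim (\<lambda>s::real. s / (sqrt 2 * sqrt (1 - s\<^sup>2))) at_top (at_left 1)"
      unfolding divide_inverse
      by (intro filterlim_tendsto_pos_mult_at_top[OF tendsto_ident_at] filterlim_compose[OF filterlim_inverse_at_top_right]) auto
    then have "((\<lambda>s. arctan (s / (sqrt 2 * sqrt (1 - s\<^sup>2)))) \<longlongrightarrow> pi / 2) (at_left 1)"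
      by (rule filterlim_compose[OF tendsto_arctan_at_top])
    then have "(?F \<longlongrightarrow> (pi / 2) / sqrt 2) (at_left 1)"
      by (intro tendsto_divide) auto
    then show ?thesis by (simp add: ereal_tendsto_simps)
  qed
  note FTC = interval_integral_FTC_nonneg[where F = ?F and f = ?f and a = "ereal 0" and b = "ereal 1", OF _ _ _ _ lim0 lim1]
  have c: "isCont ?f s" if "0 < s" "s < 1" for s
    using nz[OF that] by (intro continuous_intros) auto
  have nn: "0 \<le> ?f s" if "0 < s" "s < 1" for s
    using s1[OF that] by simp
  have "set_integrable lborel (einterval (ereal 0) (ereal 1)) ?f"
    by (rule FTC(1)) (use d c nn in \<open>auto intro!: AE_I2\<close>)
  moreover have "(LBINT s=ereal 0..ereal 1. ?f s) = (pi / 2) / sqrt 2 - 0"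
    by (rule FTC(2)) (use d c nn in \<open>auto intro!: AE_I2\<close>)
  ultimately have i: "integrable lborel (\<lambda>s. indicator {0<..<1} s * ?f s)" "(LINT s|lborel. indicator {0<..<1} s * ?f s) = pi / (2 * sqrt 2)"
    by (simp_all add: set_integrable_def interval_lebesgue_integral_def set_lebesgue_integral_def einterval_eq)
  have "(\<integral>\<^sup>+s. ennreal (indicator {0<..<1} s * ?f s) \<partial>lborel) = ennreal (pi / (2 * sqrt 2))"
    using nn_integral_eq_integral[OF i(1)] i(2) nn by (auto simp: indicator_def)
  moreover have "ennreal (indicator {0<..<1} s * ?f s) = indicator {0<..<1} s * ennreal (?f s)" for s
    by (simp add: indicator_def)
  ultimately show ?thesis by simp
qed

text \<open>The square is a double integral over (s, r) in the unit square. Integrating first in x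
  gives sqrt (2 pi) c^(-3/2) with c = 2 - s^2 - r^2; the r- and s-integrals are the two preceding
  lemmas.\<close>

lemma nn_integral_kummer_sin_0_square:
  "(\<integral>\<^sup>+x. ennreal ((kummer_sin 0 x)\<^sup>2) \<partial>lborel) = ennreal (pi * sqrt pi / 2)"
proof -
  let ?I = "\<lambda>s::real. indicator {0..1} s :: ennreal"
  let ?g = "\<lambda>x s. ennreal (\<bar>x\<bar> * exp (x\<^sup>2 * (s\<^sup>2 - 1) / 2))"
  let ?c = "\<lambda>s r::real. 2 - s\<^sup>2 - r\<^sup>2"
  have gg: "?g x s * ?g x r = ennreal (x\<^sup>2 * exp (- x\<^sup>2 * ?c s r / 2))" for x s r
  proof -
    have "exp (x\<^sup>2 * (s\<^sup>2 - 1) / 2) * exp (x\<^sup>2 * (r\<^sup>2 - 1) / 2) = exp (- x\<^sup>2 * ?c s r / 2)"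
      by (simp add: exp_add[symmetric] field_simps)
    moreover have "(\<bar>x\<bar> * exp (x\<^sup>2 * (s\<^sup>2 - 1) / 2)) * (\<bar>x\<bar> * exp (x\<^sup>2 * (r\<^sup>2 - 1) / 2))
      = x\<^sup>2 * (exp (x\<^sup>2 * (s\<^sup>2 - 1) / 2) * exp (x\<^sup>2 * (r\<^sup>2 - 1) / 2))"
      by (simp add: power2_eq_square mult_ac flip: abs_mult)
    ultimately show ?thesis by (simp flip: ennreal_mult')
  qed
  have sq: "ennreal ((kummer_sin 0 x)\<^sup>2) = (\<integral>\<^sup>+s. \<integral>\<^sup>+r. ?I s * ?I r * ennreal (x\<^sup>2 * exp (- x\<^sup>2 * ?c s r / 2)) \<partial>lborel \<partial>lborel)" for x
  proof -
    have "ennreal ((kummer_sin 0 x)\<^sup>2) = ennreal \<bar>kummer_sin 0 x\<bar> * ennreal \<bar>kummer_sin 0 x\<bar>"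
      by (simp add: power2_eq_square flip: ennreal_mult' abs_mult)
    also have "\<dots> = (\<integral>\<^sup>+s. \<integral>\<^sup>+r. (?I s * ?g x s) * (?I r * ?g x r) \<partial>lborel \<partial>lborel)"
      unfolding ennreal_kummer_sin_0 by (simp add: nn_integral_cmult nn_integral_multc)
    also have "\<dots> = (\<integral>\<^sup>+s. \<integral>\<^sup>+r. ?I s * ?I r * (?g x s * ?g x r) \<partial>lborel \<partial>lborel)"
      by (intro nn_integral_cong) (simp add: mult_ac)
    finally show ?thesis unfolding gg .
  qed
  \<comment> \<open>At s = r = 1 the exponent degenerates, c = 0; excluding s = 1 avoids this
    corner.\<close>
  have inner: "(\<integral>\<^sup>+x. ?I s * ?I r * ennreal (x\<^sup>2 * exp (- x\<^sup>2 * ?c s r / 2)) \<partial>lborel)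
      = ?I s * ?I r * (ennreal (sqrt (2 * pi)) * ennreal (1 / (?c s r * sqrt (?c s r))))" if "s \<noteq> 1" for s r
  proof (cases "s \<in> {0..1} \<and> r \<in> {0..1}")
    case True
    have "s\<^sup>2 < 1" "r\<^sup>2 \<le> 1" using True that by (auto simp: power_le_one abs_square_less_1)
    then have c: "0 < ?c s r" by simp
    from gaussian_second_moment[OF c] True c show ?thesis
      by (simp add: has_bochner_integral_iff nn_integral_eq_integral flip: ennreal_mult')
  qed (auto simp: indicator_def)
  have "(\<integral>\<^sup>+x. ennreal ((kummer_sin 0 x)\<^sup>2) \<partial>lborel)
     = (\<integral>\<^sup>+s. \<integral>\<^sup>+x. \<integral>\<^sup>+r. ?I s * ?I r * ennreal (x\<^sup>2 * exp (- x\<^sup>2 * ?c s r / 2)) \<partial>lborel \<partial>lborel \<partial>lborel)"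
    unfolding sq by (rule lborel_pair.Fubini') measurable
  also have "\<dots> = (\<integral>\<^sup>+s. \<integral>\<^sup>+r. \<integral>\<^sup>+x. ?I s * ?I r * ennreal (x\<^sup>2 * exp (- x\<^sup>2 * ?c s r / 2)) \<partial>lborel \<partial>lborel \<partial>lborel)"
    by (intro nn_integral_cong lborel_pair.Fubini') measurable
  also have "\<dots> = (\<integral>\<^sup>+s. ennreal (sqrt (2 * pi)) * (indicator {0<..<1} s * ennreal (1 / ((2 - s\<^sup>2) * sqrt (1 - s\<^sup>2)))) \<partial>lborel)"
  proof (intro nn_integral_cong_AE)
    show "AE s in lborel. (\<integral>\<^sup>+r. \<integral>\<^sup>+x. ?I s * ?I r * ennreal (x\<^sup>2 * exp (- x\<^sup>2 * ?c s r / 2)) \<partial>lborel \<partial>lborel)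
      = ennreal (sqrt (2 * pi)) * (indicator {0<..<1} s * ennreal (1 / ((2 - s\<^sup>2) * sqrt (1 - s\<^sup>2))))"
      \<comment> \<open>The two endpoints separate the closed interval of the representation from
        the open one of \<open>arctan_integral\<close>.\<close>
      using AE_lborel_singleton[of 0] AE_lborel_singleton[of 1]
    proof eventually_elim
      case (elim s)
      have "(\<integral>\<^sup>+r. \<integral>\<^sup>+x. ?I s * ?I r * ennreal (x\<^sup>2 * exp (- x\<^sup>2 * ?c s r / 2)) \<partial>lborel \<partial>lborel)
         = (\<integral>\<^sup>+r. ennreal (sqrt (2 * pi)) * ?I s * (?I r * ennreal (1 / (?c s r * sqrt (?c s r)))) \<partial>lborel)"
        unfolding inner[OF elim(2)] by (simp add: mult_ac)
      also have "\<dots> = ennreal (sqrt (2 * pi)) * ?I s * (\<integral>\<^sup>+r. ?I r * ennreal (1 / (?c s r * sqrt (?c s r))) \<partial>lborel)"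
        by (rule nn_integral_cmult) measurable
      also have "\<dots> = ennreal (sqrt (2 * pi)) * (indicator {0<..<1} s * ennreal (1 / ((2 - s\<^sup>2) * sqrt (1 - s\<^sup>2))))"
      proof (cases "0 < s \<and> s < 1")
        case True
        then show ?thesis by (subst nn_integral_inner_radical) simp_all
      qed (use elim in \<open>auto simp: indicator_def\<close>)
      finally show ?case .
    qed
  qed
  also have "\<dots> = ennreal (sqrt (2 * pi)) * ennreal (pi / (2 * sqrt 2))"
    by (subst nn_integral_cmult) (measurable, simp only: arctan_integral)
  also have "\<dots> = ennreal (pi * sqrt pi / 2)"
    by (simp add: real_sqrt_mult flip: ennreal_mult')
  finally show ?thesis .
qed

lemma conj_hermite_measurable [measurable]: "conj_hermite n \<in> borel_measurable borel"
  by (intro borel_measurable_continuous_onI continuous_at_imp_continuous_on ballI DERIV_isCont[OF conj_hermite_DERIV])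

lemma conj_hermite_0_square: "(LINT x|lborel. conj_hermite 0 x * conj_hermite 0 x) = sqrt pi"
proof -
  have "(LINT x|lborel. (kummer_sin 0 x)\<^sup>2) = pi * sqrt pi / 2"
  proof (subst integral_eq_nn_integral)
    have "isCont (kummer_sin 0) x" for x by (rule DERIV_isCont[OF kummer_sin_DERIV])
    then have [measurable]: "kummer_sin 0 \<in> borel_measurable borel"
      by (intro borel_measurable_continuous_onI continuous_at_imp_continuous_on) auto
    show "(\<lambda>x. (kummer_sin 0 x)\<^sup>2) \<in> borel_measurable lborel" by measurable
  qed (simp_all add: nn_integral_kummer_sin_0_square)
  moreover have "conj_hermite 0 x * conj_hermite 0 x = 2 / pi * (kummer_sin 0 x)\<^sup>2" for x
    unfolding conj_hermite_0 by (simp add: power2_eq_square)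
  then have "(LINT x|lborel. conj_hermite 0 x * conj_hermite 0 x) = 2 / pi * (LINT x|lborel. (kummer_sin 0 x)\<^sup>2)"
    by (simp only: integral_mult_right_zero)
  ultimately show ?thesis by (simp only:) (simp add: field_simps)
qed

section \<open>Orthogonality and skew symmetry\<close>

lemma integral_odd_function:
  fixes f :: "real \<Rightarrow> real"
  assumes "\<And>x. f (- x) = - f x" shows "(LINT x|lborel. f x) = 0"
  using lborel_integral_real_affine[of "-1" f 0] assms by simp

lemma conj_hermite_odd_integrable: "odd n \<Longrightarrow> integrable lborel (conj_hermite n)"
  by (intro decay2_integrable conj_hermite_decay2 conj_hermite_measurable)

text \<open>For odd n the function G_n is even, so reflection says nothing. Instead, integrating the
  derivative of G_(2m) relates the integrals at 2m + 1 and 2m - 1, with a factor that is zero at m =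
  0.\<close>

lemma conj_hermite_odd_integral: "odd n \<Longrightarrow> (LINT x|lborel. conj_hermite n x) = 0"
proof (induction n rule: less_induct)
  case (less n)
  then obtain m where n: "n = Suc (2 * m)" by (auto elim: oddE)
  have i: "integrable lborel (\<lambda>x. real (2 * m) * conj_hermite (2 * m - 1) x)"
    by (cases m) (auto intro!: integrable_mult_right conj_hermite_odd_integrable)
  have j: "integrable lborel (\<lambda>x. conj_hermite (Suc (2 * m)) x / 2)"
    by (auto intro!: conj_hermite_odd_integrable)
  have "(LINT x|lborel. real (2 * m) * conj_hermite (2 * m - 1) x - conj_hermite (Suc (2 * m)) x / 2) = 0"
    by (rule integral_derivative_zero[OF conj_hermite_DERIV _ Bochner_Integration.integrable_diff[OF i j] conj_hermite_decay1])
      (intro continuous_intros DERIV_isCont[OF conj_hermite_DERIV]; simp)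
  then have "real (2 * m) * (LINT x|lborel. conj_hermite (2 * m - 1) x) = (LINT x|lborel. conj_hermite n x) / 2"
    unfolding Bochner_Integration.integral_diff[OF i j] n by simp
  moreover have "real (2 * m) * (LINT x|lborel. conj_hermite (2 * m - 1) x) = 0"
    using less(1)[of "2 * m - 1"] n by (cases m) auto
  ultimately show ?case by linarith
qed

lemma conj_hermite_inner_parity:
  assumes "odd (n + m)" shows "(LINT x|lborel. conj_hermite n x * conj_hermite m x) = 0"
  by (rule integral_odd_function) (use assms in \<open>auto simp: conj_hermite_parity\<close>)

text \<open>If n + m is odd, the constant at the odd index is zero, so the remainder in
  \<open>ladder_integral\<close> is a multiple of the odd-indexed transform, which has integral
  zero. If n + m is even, both sides vanish by parity or by the factor n = 0.\<close>

lemma conj_hermite_inner_Suc: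
  "(LINT x|lborel. conj_hermite n x * conj_hermite (Suc m) x)
     = 2 * real n * (LINT x|lborel. conj_hermite (n - 1) x * conj_hermite m x)"
proof (cases "odd (n + m)")
  case True
  have 1: "integrable lborel (\<lambda>x. hermite_mass n * conj_hermite m x - hermite_mass m * conj_hermite n x)
    \<and> (LINT x|lborel. hermite_mass n * conj_hermite m x - hermite_mass m * conj_hermite n x) = 0"
    using True by (cases "odd n")
      (auto simp: hermite_mass_odd conj_hermite_odd_integrable conj_hermite_odd_integral)
  then show ?thesis
    using ladder_integral[where u = conj_hermite and v = conj_hermite and p = hermite_mass and q = hermite_mass,
      OF conj_hermite_DERIV conj_hermite_DERIV conj_hermite_times conj_hermite_times
      conj_hermite_decay1 conj_hermite_decay1, where n = n and m = m]
    by simp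
next
  case False
  then show ?thesis
    using conj_hermite_inner_parity[of n "Suc m"] conj_hermite_inner_parity[of "n - 1" m] by (cases n) auto
qed

lemma conj_hermite_inner:
  "(LINT x|lborel. conj_hermite n x * conj_hermite m x) = (if n = m then sqrt pi * 2 ^ n * fact n else 0)"
proof -
  have "(LINT x|lborel. conj_hermite n x * conj_hermite m x)
    = (if n = m then 2 ^ n * fact n * (LINT x|lborel. conj_hermite 0 x * conj_hermite 0 x) else 0)"
    by (rule ladder_values[of "\<lambda>n m. LINT x|lborel. conj_hermite n x * conj_hermite m x"])
      (rule conj_hermite_inner_Suc, simp only: mult.commute)
  then show ?thesis by (simp add: conj_hermite_0_square)
qed

text \<open>The remainders in the two mixed recursions are opposite multiples of
  \<open>hermite_mass n * hermite_mass m\<close>, so the symmetrized sum \<open>s\<close> satisfies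
  the homogeneous recursion. Its value at (0, 0) is zero because G_0 is odd and h_0 even.\<close>

lemma conj_hermite_skew:
  "(LINT x|lborel. hermite_fun_rec n x * conj_hermite m x) = - (LINT x|lborel. conj_hermite n x * hermite_fun_rec m x)"
proof -
  define s where "s n m = (LINT x|lborel. conj_hermite n x * hermite_fun_rec m x)
     + (LINT x|lborel. hermite_fun_rec n x * conj_hermite m x)" for n m
  have s1: "(LINT x|lborel. conj_hermite n x * hermite_fun_rec (Suc m) x)
     = 2 * real n * (LINT x|lborel. conj_hermite (n - 1) x * hermite_fun_rec m x) - hermite_mass n * (pi * hermite_mass m)" for n m
    using ladder_integral[where u = conj_hermite and v = hermite_fun_rec and p = hermite_mass and q = "\<lambda>_. 0",
      OF conj_hermite_DERIV hermite_fun_rec_DERIV conj_hermite_times hermite_fun_rec_times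
      conj_hermite_decay1 gauss_poly_decay1, where n = n and m = m]
    by (simp add: gauss_poly_integrable hermite_mass_def)
  have s2: "(LINT x|lborel. hermite_fun_rec n x * conj_hermite (Suc m) x)
     = 2 * real n * (LINT x|lborel. hermite_fun_rec (n - 1) x * conj_hermite m x) + hermite_mass m * (pi * hermite_mass n)" for n m
    using ladder_integral[where u = hermite_fun_rec and v = conj_hermite and p = "\<lambda>_. 0" and q = hermite_mass,
      OF hermite_fun_rec_DERIV conj_hermite_DERIV hermite_fun_rec_times conj_hermite_times
      gauss_poly_decay1 conj_hermite_decay1, where n = n and m = m]
    by (simp add: gauss_poly_integrable hermite_mass_def)
  have "s n m = (if n = m then 2 ^ n * fact n * s 0 0 else 0)"
  proof (rule ladder_values)
    show "s n (Suc m) = 2 * real n * s (n - 1) m" for n m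
      unfolding s_def s1 s2 by (simp add: algebra_simps)
    show "s n m = s m n" for n m
      unfolding s_def by (simp add: mult.commute add.commute)
  qed
  moreover have "s 0 0 = 0"
  proof -
    have "(LINT x|lborel. conj_hermite 0 x * hermite_fun_rec 0 x) = 0"
      by (rule integral_odd_function) (simp add: conj_hermite_parity gauss_poly_def)
    then show ?thesis by (simp add: s_def mult.commute)
  qed
  ultimately have "s n m = 0" by simp
  then show ?thesis by (simp add: s_def)
qed


subsection \<open>Completeness\<close>

definition approximable :: "(nat \<Rightarrow> real \<Rightarrow> real) \<Rightarrow> (real \<Rightarrow> real) \<Rightarrow> bool" where
  "approximable \<phi> f \<longleftrightarrow> (\<forall>\<epsilon>>0. \<exists>N c. (LINT x|lborel. (f x - (\<Sum>k<N. c k * \<phi> k x))\<^sup>2) < \<epsilon>)"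

lemma L2_measurable: "f \<in> L2 \<Longrightarrow> f \<in> borel_measurable borel"
  and L2_integrable_square: "f \<in> L2 \<Longrightarrow> integrable lborel (\<lambda>x. (f x)\<^sup>2)"
  by (simp_all add: L2_def)

lemma L2_I: "f \<in> borel_measurable borel \<Longrightarrow> integrable lborel (\<lambda>x. (f x)\<^sup>2) \<Longrightarrow> f \<in> L2"
  by (simp add: L2_def)

lemma L2_mult_integrable:
  assumes f: "f \<in> L2" and g: "g \<in> L2" shows "integrable lborel (\<lambda>x. f x * g x)"
proof (rule Bochner_Integration.integrable_bound)
  show "integrable lborel (\<lambda>x. (f x)\<^sup>2 + (g x)\<^sup>2)"
    by (intro Bochner_Integration.integrable_add L2_integrable_square f g)
  note [measurable] = L2_measurable[OF f] L2_measurable[OF g]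
  show "(\<lambda>x. f x * g x) \<in> borel_measurable lborel" by measurable
  have "\<bar>a * b\<bar> \<le> \<bar>a\<^sup>2 + b\<^sup>2\<bar>" for a b :: real
  proof -
    have "0 \<le> (\<bar>a\<bar> - \<bar>b\<bar>)\<^sup>2" by simp
    then have "2 * \<bar>a * b\<bar> \<le> a\<^sup>2 + b\<^sup>2" by (simp add: power2_diff abs_mult)
    then show ?thesis by linarith
  qed
  then show "AE x in lborel. norm (f x * g x) \<le> norm ((f x)\<^sup>2 + (g x)\<^sup>2)" by simp
qed

lemma L2_cmult: "f \<in> L2 \<Longrightarrow> (\<lambda>x. a * f x) \<in> L2"
  by (auto simp: L2_def power_mult_distrib)

lemma L2_add:
  assumes f: "f \<in> L2" and g: "g \<in> L2" shows "(\<lambda>x. f x + g x) \<in> L2"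
proof (rule L2_I)
  note [measurable] = L2_measurable[OF f] L2_measurable[OF g]
  show "(\<lambda>x. f x + g x) \<in> borel_measurable borel" by measurable
  have "integrable lborel (\<lambda>x. (f x)\<^sup>2 + (g x)\<^sup>2 + 2 * (f x * g x))"
    by (intro Bochner_Integration.integrable_add integrable_mult_right L2_integrable_square L2_mult_integrable f g)
  then show "integrable lborel (\<lambda>x. (f x + g x)\<^sup>2)" by (simp add: power2_sum mult.assoc)
qed

lemma L2_diff: "f \<in> L2 \<Longrightarrow> g \<in> L2 \<Longrightarrow> (\<lambda>x. f x - g x) \<in> L2"
  using L2_add[of f "\<lambda>x. (-1) * g x"] L2_cmult[of g "-1"] by simp

lemma L2_sum: "(\<And>k. \<phi> k \<in> L2) \<Longrightarrow> (\<lambda>x. \<Sum>k<(N::nat). c k * \<phi> k x) \<in> L2"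
proof (induction N)
  case 0 show ?case by (simp add: L2_def)
next
  case (Suc N)
  then show ?case using L2_add[OF Suc.IH L2_cmult[of "\<phi> N" "c N"]] by simp
qed

lemma decay1_L2: "decay1 f \<Longrightarrow> f \<in> borel_measurable borel \<Longrightarrow> f \<in> L2"
  using decay2_integrable[OF decay1_mult[of f f]] by (intro L2_I) (simp_all add: power2_eq_square)

text \<open>The substitute for the triangle inequality while working with squared norms; the factor
  2 is why the approximation arguments below split \<epsilon> into quarters.\<close>

lemma L2_square_add_le:
  assumes f: "f \<in> L2" and g: "g \<in> L2"
  shows "(LINT x|lborel. (f x + g x)\<^sup>2) \<le> 2 * (LINT x|lborel. (f x)\<^sup>2) + 2 * (LINT x|lborel. (g x)\<^sup>2)"
proof -
  have "(LINT x|lborel. (f x + g x)\<^sup>2) \<le> (LINT x|lborel. 2 * (f x)\<^sup>2 + 2 * (g x)\<^sup>2)"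
  proof (rule integral_mono)
    show "integrable lborel (\<lambda>x. (f x + g x)\<^sup>2)" by (intro L2_integrable_square L2_add f g)
    show "integrable lborel (\<lambda>x. 2 * (f x)\<^sup>2 + 2 * (g x)\<^sup>2)"
      by (intro Bochner_Integration.integrable_add integrable_mult_right L2_integrable_square f g)
    show "(f x + g x)\<^sup>2 \<le> 2 * (f x)\<^sup>2 + 2 * (g x)\<^sup>2" for x
      using zero_le_power2[of "f x - g x"] by (simp add: power2_sum power2_diff)
  qed
  also have "\<dots> = 2 * (LINT x|lborel. (f x)\<^sup>2) + 2 * (LINT x|lborel. (g x)\<^sup>2)"
    by (simp add: L2_integrable_square f g)
  finally show ?thesis .
qed

lemma approximable_closure:
  assumes \<phi>: "\<And>k. \<phi> k \<in> L2" and f: "f \<in> L2"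
    and a: "\<And>\<epsilon>. 0 < \<epsilon> \<Longrightarrow> \<exists>g\<in>L2. approximable \<phi> g \<and> (LINT x|lborel. (f x - g x)\<^sup>2) < \<epsilon>"
  shows "approximable \<phi> f"
  unfolding approximable_def
proof (intro allI impI)
  fix \<epsilon> :: real assume e: "0 < \<epsilon>"
  then obtain g where g: "g \<in> L2" "approximable \<phi> g" "(LINT x|lborel. (f x - g x)\<^sup>2) < \<epsilon> / 4"
    using a[of "\<epsilon> / 4"] by auto
  then obtain N c where c: "(LINT x|lborel. (g x - (\<Sum>k<N. c k * \<phi> k x))\<^sup>2) < \<epsilon> / 4"
    unfolding approximable_def using e by (meson divide_pos_pos zero_less_numeral)
  have "(LINT x|lborel. ((f x - g x) + (g x - (\<Sum>k<N. c k * \<phi> k x)))\<^sup>2)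
     \<le> 2 * (LINT x|lborel. (f x - g x)\<^sup>2) + 2 * (LINT x|lborel. (g x - (\<Sum>k<N. c k * \<phi> k x))\<^sup>2)"
    by (intro L2_square_add_le L2_diff L2_sum f g \<phi>)
  then have "(LINT x|lborel. (f x - (\<Sum>k<N. c k * \<phi> k x))\<^sup>2) < \<epsilon>"
    using c g(3) by simp
  then show "\<exists>N c. (LINT x|lborel. (f x - (\<Sum>k<N. c k * \<phi> k x))\<^sup>2) < \<epsilon>" by blast
qed

lemma approximable_add:
  assumes \<phi>: "\<And>k. \<phi> k \<in> L2" and f: "f \<in> L2" "approximable \<phi> f" and g: "g \<in> L2" "approximable \<phi> g"
  shows "approximable \<phi> (\<lambda>x. f x + g x)"
  unfolding approximable_def
proof (intro allI impI)
  fix \<epsilon> :: real assume e: "0 < \<epsilon>"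
  obtain N c where c: "(LINT x|lborel. (f x - (\<Sum>k<N. c k * \<phi> k x))\<^sup>2) < \<epsilon> / 4"
    using f(2) e unfolding approximable_def by (meson divide_pos_pos zero_less_numeral)
  obtain M d where d: "(LINT x|lborel. (g x - (\<Sum>k<M. d k * \<phi> k x))\<^sup>2) < \<epsilon> / 4"
    using g(2) e unfolding approximable_def by (meson divide_pos_pos zero_less_numeral)
  \<comment> \<open>Both coefficient families are padded with zeros to a common length.\<close>
  define b where "b k = (if k < N then c k else 0) + (if k < M then d k else 0)" for k
  have b: "(\<Sum>k<max N M. b k * \<phi> k x) = (\<Sum>k<N. c k * \<phi> k x) + (\<Sum>k<M. d k * \<phi> k x)" for x
  proof -
    have "(\<Sum>k<N. c k * \<phi> k x) = (\<Sum>k<max N M. (if k < N then c k else 0) * \<phi> k x)"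
      by (intro sum.mono_neutral_cong_left) auto
    moreover have "(\<Sum>k<M. d k * \<phi> k x) = (\<Sum>k<max N M. (if k < M then d k else 0) * \<phi> k x)"
      by (intro sum.mono_neutral_cong_left) auto
    ultimately show ?thesis by (simp add: b_def distrib_right sum.distrib)
  qed
  have "(LINT x|lborel. ((f x - (\<Sum>k<N. c k * \<phi> k x)) + (g x - (\<Sum>k<M. d k * \<phi> k x)))\<^sup>2)
     \<le> 2 * (LINT x|lborel. (f x - (\<Sum>k<N. c k * \<phi> k x))\<^sup>2) + 2 * (LINT x|lborel. (g x - (\<Sum>k<M. d k * \<phi> k x))\<^sup>2)"
    by (intro L2_square_add_le L2_diff L2_sum f g \<phi>)
  then have "(LINT x|lborel. (f x + g x - (\<Sum>k<max N M. b k * \<phi> k x))\<^sup>2) < \<epsilon>"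
    unfolding b using c d by (simp add: algebra_simps)
  then show "\<exists>N c. (LINT x|lborel. (f x + g x - (\<Sum>k<N. c k * \<phi> k x))\<^sup>2) < \<epsilon>" by blast
qed

lemma approximable_cmult:
  assumes "approximable \<phi> f" shows "approximable \<phi> (\<lambda>x. a * f x)"
  unfolding approximable_def
proof (intro allI impI)
  fix \<epsilon> :: real assume e: "0 < \<epsilon>"
  \<comment> \<open>Dividing by a^2 + 1 covers a = 0 as well.\<close>
  have p: "0 < a\<^sup>2 + 1" by (simp add: add_nonneg_pos)
  then obtain N c where c: "(LINT x|lborel. (f x - (\<Sum>k<N. c k * \<phi> k x))\<^sup>2) < \<epsilon> / (a\<^sup>2 + 1)"
    using assms e unfolding approximable_def by (meson divide_pos_pos)
  have "a * f x - (\<Sum>k<N. a * c k * \<phi> k x) = a * (f x - (\<Sum>k<N. c k * \<phi> k x))" for x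
    by (simp add: right_diff_distrib sum_distrib_left mult.assoc)
  then have "(LINT x|lborel. (a * f x - (\<Sum>k<N. a * c k * \<phi> k x))\<^sup>2)
      = a\<^sup>2 * (LINT x|lborel. (f x - (\<Sum>k<N. c k * \<phi> k x))\<^sup>2)"
    by (simp add: power_mult_distrib)
  also have "\<dots> \<le> a\<^sup>2 * (\<epsilon> / (a\<^sup>2 + 1))"
    using c by (intro mult_left_mono) auto
  also have "\<dots> < \<epsilon>" using p e by (simp add: field_simps)
  finally show "\<exists>N c. (LINT x|lborel. (a * f x - (\<Sum>k<N. c k * \<phi> k x))\<^sup>2) < \<epsilon>"
    by (intro exI[of _ N] exI[of _ "\<lambda>k. a * c k"])
qed

lemma approximable_basis: "approximable \<phi> (\<phi> n)"
  unfolding approximable_def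
proof (intro allI impI)
  fix \<epsilon> :: real assume "0 < \<epsilon>"
  moreover have "(\<Sum>k<Suc n. (if k = n then 1 else 0) * \<phi> k x) = \<phi> n x" for x
    by simp
  ultimately have "(LINT x|lborel. (\<phi> n x - (\<Sum>k<Suc n. (if k = n then 1 else 0) * \<phi> k x))\<^sup>2) < \<epsilon>"
    by (simp del: sum.lessThan_Suc)
  then show "\<exists>N c. (LINT x|lborel. (\<phi> n x - (\<Sum>k<N. c k * \<phi> k x))\<^sup>2) < \<epsilon>"
    by (intro exI[of _ "Suc n"] exI[of _ "\<lambda>k. if k = n then 1 else 0"])
qed

lemma approximable_zero: "approximable \<phi> (\<lambda>x. 0)"
  using approximable_cmult[OF approximable_basis, of \<phi> 0 0] by simp

lemma approximable_sum:
  assumes "\<And>k. \<phi> k \<in> L2" "\<And>k. \<psi> k \<in> L2" "\<And>k. approximable \<phi> (\<psi> k)"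
  shows "approximable \<phi> (\<lambda>x. \<Sum>k<(N::nat). c k * \<psi> k x)"
proof (induction N)
  case 0 show ?case by (simp add: approximable_zero)
next
  case (Suc N)
  have "approximable \<phi> (\<lambda>x. (\<Sum>k<N. c k * \<psi> k x) + c N * \<psi> N x)"
    by (intro approximable_add approximable_cmult Suc.IH L2_sum L2_cmult assms)
  then show ?case by simp
qed

text \<open>The dominating w also bounds the square of the limit, so 4 w dominates the squared
  differences and they tend to zero in the mean.\<close>

lemma approximable_limit:
  assumes \<phi>: "\<And>k. \<phi> k \<in> L2" and f: "f \<in> borel_measurable borel"
    and g: "\<And>n. g n \<in> borel_measurable borel" "\<And>n. approximable \<phi> (g n)"
    and lim: "AE x in lborel. (\<lambda>n. g n x) \<longlonglongrightarrow> f x"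
    and w: "integrable lborel w" and gw: "\<And>n x. (g n x)\<^sup>2 \<le> w x"
  shows "f \<in> L2" "approximable \<phi> f"
proof -
  note [measurable] = f g(1)
  have wm [measurable]: "w \<in> borel_measurable lborel" using w by auto
  have fw: "AE x in lborel. (f x)\<^sup>2 \<le> w x"
    using lim
  proof eventually_elim
    case (elim x)
    then have "(\<lambda>n. (g n x)\<^sup>2) \<longlonglongrightarrow> (f x)\<^sup>2" by (rule tendsto_power)
    then show ?case by (rule LIMSEQ_le_const2) (use gw in blast)
  qed
  show fL: "f \<in> L2"
  proof (rule L2_I)
    show "integrable lborel (\<lambda>x. (f x)\<^sup>2)"
      by (rule Bochner_Integration.integrable_bound[OF w]) (measurable, use fw in \<open>auto elim: eventually_mono\<close>)
  qed measurable
  have gL: "g n \<in> L2" for n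
  proof (rule L2_I)
    show "integrable lborel (\<lambda>x. (g n x)\<^sup>2)"
      by (rule Bochner_Integration.integrable_bound[OF w])
        (measurable, use gw in \<open>auto intro!: AE_I2 intro: order_trans[OF _ abs_ge_self]\<close>)
  qed measurable
  have "(\<lambda>n. LINT x|lborel. (f x - g n x)\<^sup>2) \<longlonglongrightarrow> (LINT x::real|lborel. (0::real))"
  proof (rule Bochner_Integration.integral_dominated_convergence[where w = "\<lambda>x. 4 * w x"])
    show "integrable lborel (\<lambda>x. 4 * w x)" using w by simp
    show "AE x in lborel. (\<lambda>n. (f x - g n x)\<^sup>2) \<longlonglongrightarrow> 0"
      using lim
    proof eventually_elim
      case (elim x)
      from tendsto_power[OF tendsto_diff[OF tendsto_const[of "f x"] elim], of 2] show ?case by simp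
    qed
    show "AE x in lborel. norm ((f x - g n x)\<^sup>2) \<le> 4 * w x" for n
      using fw
    proof eventually_elim
      case (elim x)
      have "(f x - g n x)\<^sup>2 \<le> 2 * (f x)\<^sup>2 + 2 * (g n x)\<^sup>2"
        using zero_le_power2[of "f x + g n x"] by (simp add: power2_sum power2_diff)
      then show ?case using elim gw[of n x] by simp
    qed
  qed (measurable)
  then have l: "(\<lambda>n. LINT x|lborel. (f x - g n x)\<^sup>2) \<longlonglongrightarrow> 0" by simp
  show "approximable \<phi> f"
  proof (rule approximable_closure[OF \<phi> fL])
    fix \<epsilon> :: real assume "0 < \<epsilon>"
    from order_tendstoD(2)[OF l this] obtain n where "(LINT x|lborel. (f x - g n x)\<^sup>2) < \<epsilon>"
      by (auto simp: eventually_sequentially)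
    then show "\<exists>h\<in>L2. approximable \<phi> h \<and> (LINT x|lborel. (f x - h x)\<^sup>2) < \<epsilon>"
      using gL g(2) by blast
  qed
qed

section \<open>From Hermite functions to trigonometric polynomials with Gaussian weight\<close>

lemma gauss_poly_L2: "gauss_poly p \<in> L2"
  by (intro decay1_L2 gauss_poly_decay1 gauss_poly_measurable)

lemma conj_hermite_L2: "conj_hermite n \<in> L2"
  by (intro decay1_L2 conj_hermite_decay1 conj_hermite_measurable)

lemma approximable_gauss_poly: "approximable hermite_fun_rec (gauss_poly p)"
proof (induction "degree p" arbitrary: p rule: less_induct)
  case less
  define c where "c = lead_coeff p / 2 ^ degree p"
  define r where "r = p - smult c (hermite_rec (degree p))"
  have p: "gauss_poly p = (\<lambda>x. gauss_poly r x + c * hermite_fun_rec (degree p) x)"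
    by (simp add: r_def gauss_poly_def algebra_simps fun_eq_iff)
  have "degree r \<le> degree p"
    unfolding r_def using degree_hermite_rec by (metis degree_diff_le degree_smult_le order_refl)
  moreover have "coeff r (degree p) = 0"
    using degree_hermite_rec[of "degree p"] by (simp add: r_def c_def)
  ultimately have "degree r < degree p \<or> r = 0"
    by (metis leading_coeff_0_iff le_neq_implies_less)
  then have "approximable hermite_fun_rec (gauss_poly r)"
  proof
    assume "r = 0"
    then show ?thesis using approximable_zero by (simp add: gauss_poly_def[abs_def])
  qed (rule less)
  then show ?case
    unfolding p by (intro approximable_add approximable_cmult approximable_basis L2_cmult gauss_poly_L2)
qed

text \<open>Partial sums of the series are polynomials, hence approximable after weighting. The
  bound 1/n! keeps them all below exp |b x|, whose square the Gaussian still dominates.\<close>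

lemma approximable_gauss_power_series:
  assumes a: "\<And>n. \<bar>a n\<bar> \<le> 1 / fact n" and f: "\<And>y. (\<lambda>n. a n * y ^ n) sums f y"
    and [measurable]: "f \<in> borel_measurable borel"
  shows "(\<lambda>x. exp (- x\<^sup>2 / 2) * f (b * x)) \<in> L2"
    "approximable hermite_fun_rec (\<lambda>x. exp (- x\<^sup>2 / 2) * f (b * x))"
proof -
  define p where "p N = (\<Sum>n<N. monom (a n * b ^ n) n)" for N
  have pp: "poly (p N) x = (\<Sum>n<N. a n * (b * x) ^ n)" for N x
    by (simp add: p_def poly_sum poly_monom power_mult_distrib mult_ac)
  \<comment> \<open>A sum of two exponentials replaces exp (2 |b x|), so that
    \<open>gaussian_exp_integral\<close> applies directly.\<close>
  let ?w = "\<lambda>x::real. exp (- x\<^sup>2 / 2) * exp (2 * b * x) + exp (- x\<^sup>2 / 2) * exp (- (2 * b) * x)"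
  have w: "integrable lborel ?w"
    using gaussian_exp_integral[of "2 * b"] gaussian_exp_integral[of "- (2 * b)"]
    by (intro Bochner_Integration.integrable_add) (auto intro: integrable.intros)
  have gw: "(gauss_poly (p N) x)\<^sup>2 \<le> ?w x" for N x
  proof -
    have "\<bar>poly (p N) x\<bar> \<le> (\<Sum>n<N. \<bar>b * x\<bar> ^ n /\<^sub>R fact n)"
      unfolding pp
    proof (rule order_trans[OF sum_abs], intro sum_mono)
      fix n
      have "\<bar>a n\<bar> * \<bar>(b * x) ^ n\<bar> \<le> 1 / fact n * \<bar>(b * x) ^ n\<bar>" by (intro mult_right_mono a) simp
      then show "\<bar>a n * (b * x) ^ n\<bar> \<le> \<bar>b * x\<bar> ^ n /\<^sub>R fact n"
        by (simp add: abs_mult power_abs divide_inverse)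
    qed
    also have "\<dots> \<le> exp \<bar>b * x\<bar>"
      unfolding sums_unique[OF exp_converges[of "\<bar>b * x\<bar>"]]
      by (intro sum_le_suminf sums_summable[OF exp_converges]) auto
    finally have "\<bar>poly (p N) x\<bar>\<^sup>2 \<le> (exp \<bar>b * x\<bar>)\<^sup>2" by (intro power_mono) auto
    also have "(exp \<bar>b * x\<bar>)\<^sup>2 = exp (2 * \<bar>b * x\<bar>)" by (simp add: exp_double)
    also have "\<dots> \<le> exp (2 * b * x) + exp (- (2 * b) * x)"
      by (cases "0 \<le> b * x") (auto simp: mult.assoc abs_if)
    finally have 1: "(poly (p N) x)\<^sup>2 \<le> exp (2 * b * x) + exp (- (2 * b) * x)" by simp
    have 2: "(exp (- x\<^sup>2 / 2))\<^sup>2 \<le> exp (- x\<^sup>2 / 2)"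
      using mult_left_le[of "exp (- x\<^sup>2 / 2)" "exp (- x\<^sup>2 / 2)"] by (simp add: power2_eq_square)
    have "(exp (- x\<^sup>2 / 2))\<^sup>2 * (poly (p N) x)\<^sup>2 \<le> exp (- x\<^sup>2 / 2) * (exp (2 * b * x) + exp (- (2 * b) * x))"
      by (intro mult_mono 1 2) auto
    then show ?thesis by (simp add: gauss_poly_def power_mult_distrib distrib_left)
  qed
  have lim: "AE x in lborel. (\<lambda>N. gauss_poly (p N) x) \<longlonglongrightarrow> exp (- x\<^sup>2 / 2) * f (b * x)"
    using f unfolding gauss_poly_def pp sums_def by (intro AE_I2 tendsto_mult tendsto_const) auto
  have m: "(\<lambda>x. exp (- x\<^sup>2 / 2) * f (b * x)) \<in> borel_measurable borel" by measurable
  note L = approximable_limit[OF gauss_poly_L2 m gauss_poly_measurable approximable_gauss_poly lim w gw]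
  show "(\<lambda>x. exp (- x\<^sup>2 / 2) * f (b * x)) \<in> L2"
    "approximable hermite_fun_rec (\<lambda>x. exp (- x\<^sup>2 / 2) * f (b * x))"
    by (rule L)+
qed

text \<open>Frequencies are arbitrary reals, so rescaling the period stays within the class;
  constants arise from frequency 0.\<close>

inductive trig_poly :: "(real \<Rightarrow> real) \<Rightarrow> bool" where
  cos: "trig_poly (\<lambda>x. cos (b * x))"
| sin: "trig_poly (\<lambda>x. sin (b * x))"
| add: "trig_poly f \<Longrightarrow> trig_poly g \<Longrightarrow> trig_poly (\<lambda>x. f x + g x)"
| cmult: "trig_poly f \<Longrightarrow> trig_poly (\<lambda>x. c * f x)"

lemma trig_poly_mult:
  assumes f: "trig_poly f" and g: "trig_poly g" shows "trig_poly (\<lambda>x. f x * g x)"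
proof -
  have half: "trig_poly (\<lambda>x. (f x + g x) / 2)" "trig_poly (\<lambda>x. (f x - g x) / 2)" if "trig_poly f" "trig_poly g" for f g
    using trig_poly.cmult[OF trig_poly.add[OF that], of "1/2"]
      trig_poly.cmult[OF trig_poly.add[OF that(1) trig_poly.cmult[OF that(2), of "-1"]], of "1/2"] by simp_all
  have basic: "trig_poly (\<lambda>x. cos (b * x) * f x) \<and> trig_poly (\<lambda>x. sin (b * x) * f x)" if "trig_poly f" for b f
    using that
  proof induction
    case (cos a)
    have eqs: "cos (b * x) * cos (a * x) = (cos ((b - a) * x) + cos ((b + a) * x)) / 2"
      "sin (b * x) * cos (a * x) = (sin ((b + a) * x) + sin ((b - a) * x)) / 2" for x
      unfolding cos_times_cos sin_times_cos by (simp_all only: left_diff_distrib distrib_right)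
    show ?case
      unfolding eqs by (intro conjI half trig_poly.cos trig_poly.sin)
  next
    case (sin a)
    have eqs: "cos (b * x) * sin (a * x) = (sin ((b + a) * x) - sin ((b - a) * x)) / 2"
      "sin (b * x) * sin (a * x) = (cos ((b - a) * x) - cos ((b + a) * x)) / 2" for x
      unfolding cos_times_sin sin_times_sin by (simp_all only: left_diff_distrib distrib_right)
    show ?case
      unfolding eqs by (intro conjI half trig_poly.cos trig_poly.sin)
  next
    case (add f g)
    then show ?case using trig_poly.add by (simp add: distrib_left)
  next
    case (cmult f c)
    then show ?case using trig_poly.cmult[of _ c] by (simp add: mult.left_commute)
  qed
  show ?thesis
    using f
  proof induction
    case (cmult f c)
    then show ?case using trig_poly.cmult[of _ c] by (simp add: mult.assoc)
  qed (use basic g trig_poly.add in \<open>auto simp: distrib_right\<close>)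
qed

lemma approximable_trig_poly:
  assumes "trig_poly f"
  shows "(\<lambda>x. exp (- x\<^sup>2 / 2) * f x) \<in> L2 \<and> approximable hermite_fun_rec (\<lambda>x. exp (- x\<^sup>2 / 2) * f x)"
  using assms
proof induction
  case (cos b)
  have "\<bar>cos_coeff n\<bar> \<le> 1 / fact n" for n by (simp add: cos_coeff_def abs_mult power_abs)
  from approximable_gauss_power_series[OF this, of cos b] cos_converges[where 'a = real] show ?case by simp
next
  case (sin b)
  have "\<bar>sin_coeff n\<bar> \<le> 1 / fact n" for n by (simp add: sin_coeff_def abs_mult power_abs)
  from approximable_gauss_power_series[OF this, of sin b] sin_converges[where 'a = real] show ?case by simp
next
  case (add f g)
  then show ?case
    using L2_add[of "\<lambda>x. exp (- x\<^sup>2 / 2) * f x" "\<lambda>x. exp (- x\<^sup>2 / 2) * g x"]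
      approximable_add[of hermite_fun_rec "\<lambda>x. exp (- x\<^sup>2 / 2) * f x" "\<lambda>x. exp (- x\<^sup>2 / 2) * g x"] gauss_poly_L2
    by (simp add: distrib_left)
next
  case (cmult f c)
  then show ?case
    using L2_cmult[of "\<lambda>x. exp (- x\<^sup>2 / 2) * f x" c]
      approximable_cmult[of hermite_fun_rec "\<lambda>x. exp (- x\<^sup>2 / 2) * f x" c]
    by (simp add: mult.left_commute)
qed

lemma trig_poly_real_polynomial_function:
  fixes P :: "complex \<Rightarrow> real"
  assumes "real_polynomial_function P" shows "trig_poly (\<lambda>x. P (cis (x / R)))"
  using assms
proof induction
  case (linear f)
  interpret bounded_linear f by (rule linear)
  have "f (cis (x / R)) = f 1 * cos (1 / R * x) + f \<i> * sin (1 / R * x)" for x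
  proof -
    have "cis (x / R) = cos (x / R) *\<^sub>R 1 + sin (x / R) *\<^sub>R \<i>" by (simp add: complex_eq_iff)
    then show ?thesis by (simp add: add scaleR)
  qed
  then show ?case
    using trig_poly.add[OF trig_poly.cmult[OF trig_poly.cos[of "1 / R"], of "f 1"]
        trig_poly.cmult[OF trig_poly.sin[of "1 / R"], of "f \<i>"]] by simp
next
  case (const c)
  show ?case using trig_poly.cmult[OF trig_poly.cos[of 0], of c] by simp
qed (simp_all add: trig_poly.add trig_poly_mult)

text \<open>The weight is moved to the target: \<open>q = g * exp (x\<^sup>2 / 2)\<close> is transplanted to an arc of the
  unit circle, and polynomials in \<open>cis (x / R)\<close> approximate it uniformly on \<open>\<bar>x\<bar> \<le> R\<close> and stay
  bounded elsewhere.\<close>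

lemma uniform_trig_approximation:
  fixes q :: "real \<Rightarrow> real"
  assumes q: "continuous_on UNIV q" and r: "0 < r" and supp: "\<And>x. r < \<bar>x\<bar> \<Longrightarrow> q x = 0"
    and M: "\<And>x. \<bar>q x\<bar> \<le> M" and \<delta>: "0 < \<delta>" and R: "2 * r \<le> R"
  obtains P where "trig_poly P" "\<And>x. \<bar>q x - P x\<bar> \<le> \<delta> + M * \<bar>x\<bar> / R"
proof -
  have R0: "0 < R" using r R by linarith
  have M0: "0 \<le> M" using M[of 0] by linarith
  \<comment> \<open>This cutoff is 1 for Re z \<ge> 1/2, which covers |x| \<le> r since then |x / R|
    \<le> 1/2 < pi/3. It is 0 for Re z \<le> 0, where \<open>arcsin\<close> no longer recovers the
    angle.\<close>
  define \<psi> :: "real \<Rightarrow> real" where "\<psi> c = max 0 (min 1 (2 * c))" for c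
  define F where "F z = \<psi> (Re z) * q (R * arcsin (Im z))" for z
  have "- 1 \<le> Im z \<and> Im z \<le> 1" if "cmod z = 1" for z
    using abs_Im_le_cmod[of z] that by (simp add: abs_le_iff)
  then have "continuous_on (sphere 0 1) F"
    unfolding F_def \<psi>_def
    by (intro continuous_intros continuous_on_compose2[OF q]) auto
  then obtain P where P: "real_polynomial_function P" "\<And>z. z \<in> sphere 0 1 \<Longrightarrow> \<bar>F z - P z\<bar> < \<delta>"
    using Stone_Weierstrass_real_polynomial_function[of "sphere 0 1" F \<delta>] \<delta> by auto
  have "\<bar>q x - P (cis (x / R))\<bar> \<le> \<delta> + M * \<bar>x\<bar> / R" for x
  proof -
    have "\<bar>q x - F (cis (x / R))\<bar> \<le> M * \<bar>x\<bar> / R"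
    proof (cases "\<bar>x / R\<bar> \<le> pi / 2")
      case True
      then have "- (pi / 2) \<le> x / R" "x / R \<le> pi / 2" unfolding abs_le_iff by linarith+
      then have as: "R * arcsin (sin (x / R)) = x" using R0 by (simp add: arcsin_sin)
      show ?thesis
      proof (cases "\<bar>x\<bar> \<le> r")
        case True
        then have xr: "\<bar>x / R\<bar> \<le> 1 / 2" using R R0 by (simp add: field_simps)
        have "1 / 2 \<le> cos \<bar>x / R\<bar>"
        proof -
          have "cos (pi / 3) \<le> cos \<bar>x / R\<bar>"
            using xr pi_gt3 by (intro cos_monotone_0_pi_le) auto
          then show ?thesis by (simp add: cos_60)
        qed
        then have "\<psi> (cos (x / R)) = 1" by (simp add: \<psi>_def cos_abs_real del: abs_divide)
        then show ?thesis using as M0 R0 by (simp add: F_def)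
      next
        case False
        then show ?thesis using as supp[of x] M0 R0 by (simp add: F_def)
      qed
    next
      case False
      \<comment> \<open>Here \<open>q\<close> vanishes but the periodic
        \<open>F (cis (x / R))\<close> need not; its bound M is at most M |x| / R.\<close>
      then have "pi / 2 < \<bar>x\<bar> / R" using R0 by (metis abs_divide abs_of_pos not_le)
      then have x1: "1 \<le> \<bar>x\<bar> / R" using pi_gt3 by linarith
      then have "R \<le> \<bar>x\<bar>" using R0 by simp
      then have "q x = 0" using r R by (intro supp) linarith
      moreover have "\<bar>F (cis (x / R))\<bar> \<le> M"
      proof -
        have "\<bar>\<psi> c\<bar> \<le> 1" for c by (simp add: \<psi>_def)
        then have "\<bar>F (cis (x / R))\<bar> \<le> 1 * M"
          unfolding F_def abs_mult by (intro mult_mono M) auto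
        then show ?thesis by simp
      qed
      moreover have "M * 1 \<le> M * (\<bar>x\<bar> / R)" by (intro mult_left_mono x1 M0)
      ultimately show ?thesis by simp
    qed
    moreover have "\<bar>F (cis (x / R)) - P (cis (x / R))\<bar> < \<delta>" by (rule P) simp
    ultimately show ?thesis by linarith
  qed
  then show ?thesis using that[OF trig_poly_real_polynomial_function[OF P(1)]] by blast
qed

section \<open>From compact support to all square integrable functions\<close>

text \<open>The growing error M |x| / R is harmless after weighting, since x^2 exp (-x^2) is
  integrable; it becomes small for large R.\<close>

lemma approximable_compact_support:
  fixes g :: "real \<Rightarrow> real"
  assumes g: "continuous_on UNIV g" and r: "0 < r" and supp: "\<And>x. r < \<bar>x\<bar> \<Longrightarrow> g x = 0"
  shows "g \<in> L2" "approximable hermite_fun_rec g"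
proof -
  have [measurable]: "g \<in> borel_measurable borel" by (rule borel_measurable_continuous_onI[OF g])
  define q where "q x = g x * exp (x\<^sup>2 / 2)" for x
  have q: "continuous_on UNIV q" unfolding q_def by (intro continuous_intros g) auto
  have qs: "q x = 0" if "r < \<bar>x\<bar>" for x using supp[OF that] by (simp add: q_def)
  have gq: "g x = exp (- x\<^sup>2 / 2) * q x" for x by (simp add: q_def exp_minus field_simps)
  have "bounded (q ` {-r..r})"
    by (intro compact_imp_bounded compact_continuous_image continuous_on_subset[OF q]) auto
  then obtain M where "\<forall>y\<in>q ` {-r..r}. norm y \<le> M" unfolding bounded_iff by blast
  then have M1: "\<bar>q x\<bar> \<le> M" if "\<bar>x\<bar> \<le> r" for x using that by (auto simp: abs_le_iff)
  have M: "\<bar>q x\<bar> \<le> M" for x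
    using M1[of x] qs[of x] M1[of 0] r by (cases "\<bar>x\<bar> \<le> r") auto
  have M0: "0 \<le> M" using M[of 0] by linarith
  have g1: "integrable lborel (\<lambda>x::real. exp (- x\<^sup>2))" and g2: "integrable lborel (\<lambda>x::real. x\<^sup>2 * exp (- x\<^sup>2))"
    using gauss_poly_mult_integrable[of 1 1] gauss_poly_mult_integrable[of "[:0,1:]" "[:0,1:]"]
    by (simp_all add: gauss_poly_times power2_eq_square)
  show gL: "g \<in> L2"
  proof (rule L2_I)
    show "integrable lborel (\<lambda>x. (g x)\<^sup>2)"
    proof (rule Bochner_Integration.integrable_bound)
      show "integrable lborel (\<lambda>x. M\<^sup>2 * exp (- x\<^sup>2))" using g1 by simp
      have "(g x)\<^sup>2 \<le> M\<^sup>2 * exp (- x\<^sup>2)" for x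
      proof -
        have "(q x)\<^sup>2 \<le> M\<^sup>2" using M[of x] M0 abs_le_square_iff[of "q x" M] by simp
        moreover have "(g x)\<^sup>2 = (q x)\<^sup>2 * exp (- x\<^sup>2)"
          unfolding gq by (simp add: power_mult_distrib flip: exp_double)
        ultimately show ?thesis by (simp add: mult_right_mono)
      qed
      then show "AE x in lborel. norm ((g x)\<^sup>2) \<le> norm (M\<^sup>2 * exp (- x\<^sup>2))" by simp
    qed measurable
  qed measurable
  define C1 where "C1 = (LINT x|lborel. exp (- (x::real)\<^sup>2))"
  define C2 where "C2 = (LINT x|lborel. (x::real)\<^sup>2 * exp (- x\<^sup>2))"
  have C: "0 \<le> C1" "0 \<le> C2" unfolding C1_def C2_def by (intro Bochner_Integration.integral_nonneg; simp)+
  show "approximable hermite_fun_rec g"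
  proof (rule approximable_closure[OF gauss_poly_L2 gL])
    fix \<epsilon> :: real assume e: "0 < \<epsilon>"
    \<comment> \<open>The choice makes 8 \<delta>^2 (C1 + 1) equal to \<epsilon>, so the uniform
      part of the error contributes less than \<epsilon> / 2.\<close>
    define \<delta> where "\<delta> = sqrt (\<epsilon> / (8 * (C1 + 1)))"
    have \<delta>: "0 < \<delta>" "2 * \<delta>\<^sup>2 * C1 < \<epsilon> / 2"
    proof -
      show "0 < \<delta>" using e C by (simp add: \<delta>_def)
      have "\<delta>\<^sup>2 = \<epsilon> / (8 * (C1 + 1))" using e C by (simp add: \<delta>_def)
      then have "8 * (\<delta>\<^sup>2 * C1) + 8 * \<delta>\<^sup>2 = \<epsilon>" using C by (simp add: field_simps add_nonneg_pos)
      then show "2 * \<delta>\<^sup>2 * C1 < \<epsilon> / 2" using e zero_le_power2[of \<delta>] unfolding mult.assoc by linarith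
    qed
    \<comment> \<open>R \<ge> 1 allows passing from R to R^2; the last entry then bounds the growing
      part of the error by \<epsilon> / 4.\<close>
    define R where "R = max (2 * r) (max 1 (8 * (M\<^sup>2 * C2) / \<epsilon>))"
    have R: "2 * r \<le> R" "1 \<le> R" "8 * (M\<^sup>2 * C2) / \<epsilon> \<le> R" by (auto simp: R_def)
    have R3: "2 * (M / R)\<^sup>2 * C2 < \<epsilon> / 2"
    proof -
      have "8 * (M\<^sup>2 * C2) \<le> \<epsilon> * R" using R(3) e by (simp add: field_simps)
      also have "\<dots> \<le> \<epsilon> * (R * R)" using R(2) e by (intro mult_left_mono) auto
      finally have "8 * (M\<^sup>2 * C2) / (R * R) \<le> \<epsilon>" using R(2) by (simp add: divide_le_eq)
      then have "2 * (M / R)\<^sup>2 * C2 \<le> \<epsilon> / 4" by (simp add: power2_eq_square)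
      then show ?thesis using e by linarith
    qed
    obtain P where P: "trig_poly P" "\<And>x. \<bar>q x - P x\<bar> \<le> \<delta> + M * \<bar>x\<bar> / R"
      using uniform_trig_approximation[OF q r qs M \<delta>(1) R(1)] by blast
    let ?h = "\<lambda>x. exp (- x\<^sup>2 / 2) * P x"
    have h: "?h \<in> L2" "approximable hermite_fun_rec ?h" using approximable_trig_poly[OF P(1)] by auto
    have le: "(g x - ?h x)\<^sup>2 \<le> 2 * \<delta>\<^sup>2 * exp (- x\<^sup>2) + 2 * (M / R)\<^sup>2 * (x\<^sup>2 * exp (- x\<^sup>2))" for x
    proof -
      have "(q x - P x)\<^sup>2 \<le> (\<delta> + M * \<bar>x\<bar> / R)\<^sup>2"
        using power_mono[OF P(2)[of x] abs_ge_zero, of 2] by simp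
      also have "\<dots> \<le> 2 * \<delta>\<^sup>2 + 2 * (M * \<bar>x\<bar> / R)\<^sup>2"
        using zero_le_power2[of "\<delta> - M * \<bar>x\<bar> / R"] unfolding power2_sum power2_diff by linarith
      also have "(M * \<bar>x\<bar> / R)\<^sup>2 = (M / R)\<^sup>2 * x\<^sup>2" by (simp add: power_mult_distrib power_divide)
      finally have "(q x - P x)\<^sup>2 * exp (- x\<^sup>2) \<le> (2 * \<delta>\<^sup>2 + 2 * ((M / R)\<^sup>2 * x\<^sup>2)) * exp (- x\<^sup>2)"
        by (intro mult_right_mono) auto
      moreover have "(g x - ?h x)\<^sup>2 = (q x - P x)\<^sup>2 * exp (- x\<^sup>2)"
        unfolding gq right_diff_distrib[symmetric] by (simp add: power_mult_distrib flip: exp_double)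
      ultimately show ?thesis by (simp add: algebra_simps)
    qed
    have "(LINT x|lborel. (g x - ?h x)\<^sup>2) \<le> (LINT x|lborel. 2 * \<delta>\<^sup>2 * exp (- x\<^sup>2) + 2 * (M / R)\<^sup>2 * (x\<^sup>2 * exp (- x\<^sup>2)))"
      by (intro integral_mono le L2_integrable_square L2_diff gL h(1) Bochner_Integration.integrable_add integrable_mult_right g1 g2)
    also have "\<dots> = 2 * \<delta>\<^sup>2 * C1 + 2 * (M / R)\<^sup>2 * C2"
      unfolding C1_def C2_def
      by (subst Bochner_Integration.integral_add) (auto intro: integrable_mult_right g1 g2)
    also have "\<dots> < \<epsilon>" using \<delta>(2) R3 by linarith
    finally show "\<exists>h\<in>L2. approximable hermite_fun_rec h \<and> (LINT x|lborel. (g x - h x)\<^sup>2) < \<epsilon>"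
      using h by blast
  qed
qed

text \<open>The predicate \<open>measurable_on\<close> is defined through limits of continuous
  functions off a negligible set; the exceptional set is then moved from \<open>lebesgue\<close> to
  \<open>lborel\<close>.\<close>

lemma AE_limit_of_continuous:
  fixes f :: "real \<Rightarrow> real"
  assumes "f \<in> borel_measurable borel"
  obtains g where "\<And>n. continuous_on UNIV (g n)" "AE x in lborel. (\<lambda>n. g n x) \<longlonglongrightarrow> f x"
proof -
  have "f \<in> borel_measurable lebesgue"
    using measurable_completion[of f lborel borel] assms by simp
  then have "f measurable_on UNIV"
    by (intro lebesgue_measurable_imp_measurable_on) auto
  then obtain N g where N: "negligible N" and g: "\<And>n. continuous_on UNIV (g n)"
      "\<And>x. x \<notin> N \<Longrightarrow> (\<lambda>n. g n x) \<longlonglongrightarrow> f x"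
    unfolding measurable_on_def by auto
  have "AE x in lebesgue. x \<notin> N"
    using N by (intro AE_not_in) (simp add: negligible_iff_null_sets)
  then have "AE x in lebesgue. (\<lambda>n. g n x) \<longlonglongrightarrow> f x"
    by eventually_elim (rule g)
  then have "AE x in lborel. (\<lambda>n. g n x) \<longlonglongrightarrow> f x"
    by (simp add: AE_completion_iff)
  with g(1) show ?thesis using that by blast
qed

definition clip :: "real \<Rightarrow> real \<Rightarrow> real" where
  "clip M y = max (- M) (min M y)"

lemma abs_clip_le: "0 \<le> M \<Longrightarrow> \<bar>clip M y\<bar> \<le> M" "0 \<le> M \<Longrightarrow> \<bar>clip M y\<bar> \<le> \<bar>y\<bar>"
  by (auto simp: clip_def)

lemma clip_eq: "\<bar>y\<bar> \<le> M \<Longrightarrow> clip M y = y"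
  by (auto simp: clip_def)

text \<open>The continuous approximants come with neither a bound nor a support. Clipping at M and
  multiplying by the cutoff \<tau>, which is 1 on [-r, r] and 0 beyond r + 1, supplies both and
  leaves the limit unchanged.\<close>

lemma approximable_bounded_support:
  fixes f :: "real \<Rightarrow> real"
  assumes f: "f \<in> borel_measurable borel" and M: "\<And>x. \<bar>f x\<bar> \<le> M" and r: "0 < r" "\<And>x. r < \<bar>x\<bar> \<Longrightarrow> f x = 0"
  shows "f \<in> L2" "approximable hermite_fun_rec f"
proof -
  obtain g where g: "\<And>n. continuous_on UNIV (g n)" "AE x in lborel. (\<lambda>n. g n x) \<longlonglongrightarrow> f x"
    using AE_limit_of_continuous[OF f] by blast
  have M0: "0 \<le> M" using M[of 0] by linarith
  define \<tau> :: "real \<Rightarrow> real" where "\<tau> x = max 0 (min 1 (r + 1 - \<bar>x\<bar>))" for x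
  define h where "h n x = \<tau> x * clip M (g n x)" for n x
  have hc: "continuous_on UNIV (h n)" for n
    unfolding h_def \<tau>_def clip_def by (intro continuous_intros g)
  have hs: "h n x = 0" if "r + 1 < \<bar>x\<bar>" for n x using that by (simp add: h_def \<tau>_def)
  have ha: "approximable hermite_fun_rec (h n)" for n
    using approximable_compact_support(2)[OF hc, of "r + 1"] hs r by auto
  have hm: "h n \<in> borel_measurable borel" for n by (rule borel_measurable_continuous_onI[OF hc])
  have w: "integrable lborel (\<lambda>x. M\<^sup>2 * indicator {- (r + 1)..r + 1} x)"
    by (intro integrable_mult_right integrable_real_indicator) (auto simp: emeasure_lborel_Icc_eq)
  have hw: "(h n x)\<^sup>2 \<le> M\<^sup>2 * indicator {- (r + 1)..r + 1} x" for n x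
  proof (cases "\<bar>x\<bar> \<le> r + 1")
    case True
    have "\<bar>h n x\<bar> \<le> 1 * M" unfolding h_def abs_mult
      by (intro mult_mono abs_clip_le M0) (auto simp: \<tau>_def)
    then have "(h n x)\<^sup>2 \<le> M\<^sup>2" using M0 abs_le_square_iff[of "h n x" M] by simp
    then show ?thesis using True by (simp add: indicator_def abs_le_iff)
  qed (use hs in simp)
  have lim: "AE x in lborel. (\<lambda>n. h n x) \<longlonglongrightarrow> f x"
    using g(2)
  proof eventually_elim
    case (elim x)
    have "(\<lambda>n. h n x) \<longlonglongrightarrow> \<tau> x * clip M (f x)"
      unfolding h_def clip_def by (intro tendsto_intros elim)
    moreover have "\<tau> x * clip M (f x) = f x"
      using M r M0 by (cases "\<bar>x\<bar> \<le> r") (auto simp: clip_eq \<tau>_def)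
    ultimately show ?case by simp
  qed
  show "f \<in> L2" "approximable hermite_fun_rec f"
    by (rule approximable_limit[OF gauss_poly_L2 f hm ha lim w hw])+
qed

text \<open>Truncation both in the argument and in the value; at each point the truncations
  eventually equal f, and their squares stay below that of f.\<close>

lemma approximable_hermite:
  assumes f: "f \<in> L2" shows "approximable hermite_fun_rec f"
proof -
  note [measurable] = L2_measurable[OF f]
  define g where "g n x = indicator {- real (Suc n)..real (Suc n)} x * clip (real (Suc n)) (f x)" for n x
  have gm: "g n \<in> borel_measurable borel" for n unfolding g_def clip_def by measurable
  have ga: "approximable hermite_fun_rec (g n)" for n
  proof (rule approximable_bounded_support(2)[OF gm])
    show "\<bar>g n x\<bar> \<le> real (Suc n)" for x
      using abs_clip_le(1)[of "real (Suc n)" "f x"] by (simp add: g_def indicator_def)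
    show "g n x = 0" if "real (Suc n) < \<bar>x\<bar>" for x
      using that by (auto simp: g_def indicator_def)
  qed simp
  have gw: "(g n x)\<^sup>2 \<le> (f x)\<^sup>2" for n x
    using abs_clip_le(2)[of "real (Suc n)" "f x"] by (simp add: g_def indicator_def abs_le_square_iff)
  have lim: "AE x in lborel. (\<lambda>n. g n x) \<longlonglongrightarrow> f x"
  proof (intro AE_I2 tendsto_eventually)
    fix x
    show "\<forall>\<^sub>F n in sequentially. g n x = f x"
      unfolding eventually_sequentially
    proof (intro exI allI impI)
      fix n assume "nat \<lceil>max \<bar>x\<bar> \<bar>f x\<bar>\<rceil> \<le> n"
      then have "\<bar>x\<bar> \<le> real (Suc n)" "\<bar>f x\<bar> \<le> real (Suc n)" by linarith+
      then show "g n x = f x" by (simp add: g_def indicator_def clip_eq abs_le_iff)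
    qed
  qed
  show ?thesis
    by (rule approximable_limit(2)[OF gauss_poly_L2 L2_measurable[OF f] gm ga lim L2_integrable_square[OF f] gw])
qed

section \<open>Transfer of completeness to the transforms\<close>

text \<open>The system enters only through its weights and its inner products with \<open>f\<close>,
  so two systems sharing these data have the same approximation error.\<close>

lemma square_norm_defect:
  fixes \<phi> :: "nat \<Rightarrow> real \<Rightarrow> real"
  assumes \<phi>: "\<And>k. \<phi> k \<in> L2" and f: "f \<in> L2"
    and o: "\<And>j k. (LINT x|lborel. \<phi> j x * \<phi> k x) = (if j = k then w k else 0)"
  shows "(LINT x|lborel. (f x - (\<Sum>k<N. c k * \<phi> k x))\<^sup>2)
    = (LINT x|lborel. (f x)\<^sup>2) - 2 * (\<Sum>k<N. c k * (LINT x|lborel. f x * \<phi> k x)) + (\<Sum>k<N. (c k)\<^sup>2 * w k)"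
proof -
  let ?S = "\<lambda>x. \<Sum>k<N. c k * \<phi> k x"
  have S: "?S \<in> L2" by (rule L2_sum[OF \<phi>])
  have inner: "(LINT x|lborel. h x * ?S x) = (\<Sum>k<N. c k * (LINT x|lborel. h x * \<phi> k x))" if "h \<in> L2" for h
  proof -
    have "(LINT x|lborel. h x * ?S x) = (LINT x|lborel. (\<Sum>k<N. c k * (h x * \<phi> k x)))"
      by (simp add: sum_distrib_left mult.left_commute)
    also have "\<dots> = (\<Sum>k<N. (LINT x|lborel. c k * (h x * \<phi> k x)))"
      by (rule Bochner_Integration.integral_sum) (intro integrable_mult_right L2_mult_integrable that \<phi>)
    finally show ?thesis by simp
  qed
  have "(LINT x|lborel. ?S x * ?S x) = (\<Sum>k<N. (c k)\<^sup>2 * w k)"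
    unfolding inner[OF S]
  proof (intro sum.cong refl)
    fix k assume k: "k \<in> {..<N}"
    have "(LINT x|lborel. ?S x * \<phi> k x) = (\<Sum>j<N. c j * (LINT x|lborel. \<phi> k x * \<phi> j x))"
      using inner[OF \<phi>[of k]] by (simp add: mult.commute)
    also have "\<dots> = (\<Sum>j<N. if j = k then c k * w k else 0)"
      by (intro sum.cong refl) (simp add: o)
    also have "\<dots> = c k * w k" using k by simp
    finally show "c k * (LINT x|lborel. ?S x * \<phi> k x) = (c k)\<^sup>2 * w k" by (simp add: power2_eq_square)
  qed
  moreover have "(LINT x|lborel. (f x - ?S x)\<^sup>2) = (LINT x|lborel. (f x)\<^sup>2 + ?S x * ?S x - 2 * (f x * ?S x))"
  proof -
    have "(a - b)\<^sup>2 = a\<^sup>2 + b * b - 2 * (a * b)" for a b :: real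
      by (simp add: power2_eq_square algebra_simps)
    then show ?thesis by (simp only:)
  qed
  moreover have "\<dots> = (LINT x|lborel. (f x)\<^sup>2) + (LINT x|lborel. ?S x * ?S x) - 2 * (LINT x|lborel. f x * ?S x)"
    by (subst Bochner_Integration.integral_diff Bochner_Integration.integral_add;
        (intro Bochner_Integration.integrable_add integrable_mult_right L2_integrable_square L2_mult_integrable S f)?)+ simp
  ultimately show ?thesis unfolding inner[OF f] by simp
qed

text \<open>Skew-adjointness of the Hilbert transform makes the error of approximating \<open>h\<^sub>n\<close> by
  \<open>- (\<Sum>k. c k * G\<^sub>k)\<close> equal to that of approximating \<open>G\<^sub>n\<close> by \<open>\<Sum>k. c k * h\<^sub>k\<close>.\<close>

lemma approximable_conj_hermite_basis: "approximable conj_hermite (hermite_fun_rec n)"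
  unfolding approximable_def
proof (intro allI impI)
  fix \<epsilon> :: real assume "0 < \<epsilon>"
  then obtain N c where c: "(LINT x|lborel. (conj_hermite n x - (\<Sum>k<N. c k * hermite_fun_rec k x))\<^sup>2) < \<epsilon>"
    using approximable_hermite[OF conj_hermite_L2] unfolding approximable_def by blast
  let ?w = "\<lambda>k. sqrt pi * 2 ^ k * fact k"
  have o: "(LINT x|lborel. hermite_fun_rec j x * hermite_fun_rec k x) = (if j = k then ?w k else 0)"
    "(LINT x|lborel. conj_hermite j x * conj_hermite k x) = (if j = k then ?w k else 0)" for j k
    by (simp_all add: hermite_fun_rec_inner conj_hermite_inner)
  have e: "(LINT x|lborel. (hermite_fun_rec n x)\<^sup>2) = (LINT x|lborel. (conj_hermite n x)\<^sup>2)"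
    unfolding power2_eq_square o ..
  have "(LINT x|lborel. (hermite_fun_rec n x - (\<Sum>k<N. - c k * conj_hermite k x))\<^sup>2)
     = (LINT x|lborel. (conj_hermite n x - (\<Sum>k<N. c k * hermite_fun_rec k x))\<^sup>2)"
    unfolding square_norm_defect[OF conj_hermite_L2 gauss_poly_L2 o(2)]
      square_norm_defect[OF gauss_poly_L2 conj_hermite_L2 o(1)] conj_hermite_skew e
    by simp
  then show "\<exists>N c. (LINT x|lborel. (hermite_fun_rec n x - (\<Sum>k<N. c k * conj_hermite k x))\<^sup>2) < \<epsilon>"
    using c by (metis (no_types))
qed

lemma approximable_conj_hermite:
  assumes f: "f \<in> L2" shows "approximable conj_hermite f"
proof (rule approximable_closure[OF conj_hermite_L2 f])
  fix \<epsilon> :: real assume "0 < \<epsilon>"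
  then obtain N c where "(LINT x|lborel. (f x - (\<Sum>k<N. c k * hermite_fun_rec k x))\<^sup>2) < \<epsilon>"
    using approximable_hermite[OF f] unfolding approximable_def by blast
  moreover have "approximable conj_hermite (\<lambda>x. \<Sum>k<N. c k * hermite_fun_rec k x)"
    by (intro approximable_sum conj_hermite_L2 gauss_poly_L2 approximable_conj_hermite_basis)
  ultimately show "\<exists>g\<in>L2. approximable conj_hermite g \<and> (LINT x|lborel. (f x - g x)\<^sup>2) < \<epsilon>"
    using L2_sum[of hermite_fun_rec c N] gauss_poly_L2 by blast
qed


lemma complete_orthogonal_system_conj_hermite: "complete_orthogonal_system conj_hermite"
  unfolding complete_orthogonal_system_def
proof (intro conjI allI impI ballI)
  show "conj_hermite n \<in> L2" for n by (rule conj_hermite_L2)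
  show "(LINT x|lborel. (conj_hermite n x)\<^sup>2) \<noteq> 0" for n
    unfolding power2_eq_square conj_hermite_inner by simp
  show "(LINT x|lborel. conj_hermite m x * conj_hermite n x) = 0" if "m \<noteq> n" for m n
    using that by (simp add: conj_hermite_inner)
  fix f :: "real \<Rightarrow> real" and \<epsilon> :: real
  assume "f \<in> L2" "0 < \<epsilon>"
  \<comment> \<open>The tolerance is squared because \<open>approximable\<close> measures squared
    norms.\<close>
  then obtain N c where "(LINT x|lborel. (f x - (\<Sum>k<N. c k * conj_hermite k x))\<^sup>2) < \<epsilon>\<^sup>2"
    using approximable_conj_hermite unfolding approximable_def by (meson zero_less_power)
  then have "sqrt (LINT x|lborel. (f x - (\<Sum>k<N. c k * conj_hermite k x))\<^sup>2) < \<epsilon>"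
    using real_sqrt_less_mono \<open>0 < \<epsilon>\<close> by fastforce
  then show "\<exists>N c. sqrt (LINT x|lborel. (f x - (\<Sum>k<N. c k * conj_hermite k x))\<^sup>2) < \<epsilon>" by blast
qed

text \<open>The first conjunct secures the existence of every principal value, without which the
  description operator inside \<open>G\<close> would carry no information.\<close>

theorem theorem2p1:
  shows "(\<forall>n x. \<exists>I. has_pv_integral (\<lambda>t. hermite_fun n t / (t - x)) x I)
    \<and> complete_orthogonal_system G
    \<and> (\<forall>m n. (LINT x|lborel. G n x * G m x) = (if m = n then sqrt pi * 2 ^ n * fact n else 0))
    \<and> (\<forall>m x. G (2 * m) x =
          - sqrt 2 * fact (2 * m) * x * exp (- x\<^sup>2 / 2) *
          (\<Sum>k=0..m. (-1) ^ k * 2 ^ k * kummer (1/2 - real k) (3/2) (x\<^sup>2 / 2)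
             / (fact (m - k) * Gamma (real k + 1/2))))
    \<and> (\<forall>m x. G (2 * m + 1) x =
          sqrt 2 * fact (2 * m + 1) * exp (- x\<^sup>2 / 2) *
          (\<Sum>k=0..m. (-1) ^ k * 2 ^ k * kummer (-1/2 - real k) (1/2) (x\<^sup>2 / 2)
             / (fact (m - k) * Gamma (real k + 3/2))))"
proof (intro conjI allI)
  show "\<exists>I. has_pv_integral (\<lambda>t. hermite_fun n t / (t - x)) x I" for n x
    unfolding hermite_fun_eq using has_pv_integral_hermite by blast
  have G: "G = conj_hermite" by (simp add: fun_eq_iff G_eq)
  show "complete_orthogonal_system G"
    unfolding G by (rule complete_orthogonal_system_conj_hermite)
  show "(LINT x|lborel. G n x * G m x) = (if m = n then sqrt pi * 2 ^ n * fact n else 0)" for m n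
    unfolding G conj_hermite_inner by auto
  show "G (2 * m) x =
          - sqrt 2 * fact (2 * m) * x * exp (- x\<^sup>2 / 2) *
          (\<Sum>k=0..m. (-1) ^ k * 2 ^ k * kummer (1/2 - real k) (3/2) (x\<^sup>2 / 2)
             / (fact (m - k) * Gamma (real k + 1/2)))" for m x
    unfolding G conj_hermite_even[OF order_refl] sum_distrib_left atLeast0AtMost
    by (intro sum.cong refl) (simp add: even_coeff_def kummer_sin_def)
  show "G (2 * m + 1) x =
          sqrt 2 * fact (2 * m + 1) * exp (- x\<^sup>2 / 2) *
          (\<Sum>k=0..m. (-1) ^ k * 2 ^ k * kummer (-1/2 - real k) (1/2) (x\<^sup>2 / 2)
             / (fact (m - k) * Gamma (real k + 3/2)))" for m x
    unfolding G Suc_eq_plus1[symmetric] conj_hermite_odd[OF order_refl] sum_distrib_left atLeast0AtMost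
    by (intro sum.cong refl) (simp add: odd_coeff_def kummer_cos_def del: fact_Suc)
qed

end
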